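(* Let $S$ be a planar symmetric simple random walk and $n\in\mathbb{N}$. Let - $\ell_1,\ell_1'$ be integer-valued functions of $n$ such that $\ell_1(n),\ell_1'(n)=o(n)$; - $0<a<1/2$, $0<a_x<a_y<1$ with $a_x+a_y\le 1$, $0<b<1$, and $\ell_2^a,\tilde\ell_2^a,\ell_2^b,\ell_2^{a_x},\ell_2^{a_y}$ be functions of $n$ such that $\ell_2^a(n),\tilde\ell_2^a(n),\ell_2^b(n),\ell_2^{a_x}(n),\ell_2^{a_y}(n)=o(n)$; - $\ell_3,\ell_3'$ be functions of $n$ such that $\ell_3(n),\ell_3'(n)=o(n)$ and $\ell_3(n),\ell_3'(n)\to\infty$ as $n\to\infty$; - $c,c_x,c_y>0$ be constants; - $d\in\left[\frac{e^{11/12}}{\sqrt{2\pi}},\frac{2\pi}{e^{11/6}}\right)$. For $(x,y)\in\mathbb{Z}^2$, suppose, moreover, that the constants $c,c_x,c_y$ and functions $\ell_1,\ell_1',\ell_2^a,\tilde\ell_2^a,\ell_2^b,\ell_2^{a_x},\ell_2^{a_y},\ell_3,\ell_3'$ are chosen below so that $\|(x,y)\|_1\le n$ and $x+y+n$ is an even integer. Then $$P(S_n=(x,y))=f_{x,y}(n)\cdot\exp\left\{-\sum_{\ell=1}^\infty\frac{1}{2\ell(2\ell-1)}\frac{(x+y)^{2\ell}+(y-x)^{2\ell}}{n^{2\ell-1}}\right\},$$ where, if $0\le x\le y$, with the notation $a_-=a_y-a_x$, $a_+=a_x+a_y$, $f_{x,y}(n)$ equals: 1. If $\|(x,y)\|_1=o(n)$: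 $\ \frac{2}{\pi n}\left(1+O\left(\frac{n+x^2+y^2}{n^2}\right)\right)$. 2. If $x=an+\ell_2^a(n)$, $y=an+\tilde\ell_2^a(n)$: $\ \frac{2}{\pi n\sqrt{1-4a^2}}\left(1+O\left(\frac{n|\ell_2^a(n)+\tilde\ell_2^a(n)|+n+(\tilde\ell_2^a(n)-\ell_2^a(n))^2}{n^2}\right)\right)$. 3. If $x=\ell_1(n)$, $y=bn+\ell_2^b(n)$: $\ \frac{2}{\pi n(1-b^2)}\left(1+O\left(\frac{|\ell_1(n)|+|\ell_2^b(n)|}{n}\right)\right)$. 4. If $x=a_xn+\ell_2^{a_x}(n)$, $y=a_yn+\ell_2^{a_y}(n)$, $a_x+a_y<1$: $\ \frac{2}{\pi n\sqrt{1-2(a_x^2+a_y^2)+(a_-a_+)^2}}\left(1+O\left(\frac{|\ell_2^{a_x}(n)|+|\ell_2^{a_y}(n)|}{n}\right)\right)$. 5. If $x=n/2+\ell_1(n)$, $y=n/2+\ell_1'(n)$, $x+y=n-\ell_3(n)$: $\ \frac{\sqrt2}{\pi\sqrt{n\ell_3(n)}}\left(1+O\left(\frac{(\ell_1'(n)-\ell_1(n))^2}{n^2}+\frac{\ell_3(n)}{n}+\frac{1}{\ell_3(n)}\right)\right)$. 6. If $x=a_xn+\ell_2^{a_x}(n)$, $y=a_yn+\ell_2^{a_y}(n)$, $x+y=n-\ell_3(n)$: $\ \frac{\sqrt2}{\pi\sqrt{n(1-a_-^2)\ell_3(n)}}\left(1+O\left(\frac{|\ell_2^{a_y}(n)|+|\ell_2^{a_x}(n)|}{n}+\frac{1}{\ell_3(n)}\right)\right)$.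 7. If $x=\ell_1(n)$, $y=n-\ell_3(n)$, $\ell_3(n)-\ell_1(n)=\ell_3'(n)$: $\ \frac{1}{\pi\sqrt{\ell_3(n)^2-\ell_1(n)^2}}\left(1+O\left(\frac{\ell_3(n)}{n}+\frac{1}{|\ell_3'(n)|}\right)\right)$. 8. If $x=n/2+\ell_1(n)$, $y=n/2+\ell_1'(n)$, $x+y=n-c$: $\ \frac{d\sqrt2\,e^{-1/(6c)}}{\pi\sqrt{nc}}\left(1+O\left(\frac{(\ell_1'(n)-\ell_1(n))^2+n}{n^2}\right)\right)$. 9. If $x=a_xn+\ell_2^{a_x}(n)$, $y=a_yn+\ell_2^{a_y}(n)$, $x+y=n-c$: $\ \frac{d\sqrt2\,e^{-1/(6c)}}{\pi\sqrt{nc(1-a_-^2)}}\left(1+O\left(\frac{1+|\ell_2^{a_y}(n)-\ell_2^{a_x}(n)|}{n}\right)\right)$. 10. If $x=\ell_1(n)$, $y=n-\ell_3(n)$, $\ell_3(n)-\ell_1(n)=c$: $\ \frac{d\,e^{-1/(6c)}}{\pi\sqrt{c(\ell_1(n)+\ell_3(n))}}\left(1+O\left(\frac{\ell_1(n)}{n}\right)+O\left(\frac{1}{\ell_1(n)}\right)\right)$. 11. If $x=c_x$, $y=n-c_y$: $\ \frac{d^2e^{-c_y/(3(c_y^2-c_x^2))}}{\pi\sqrt{c_y^2-c_x^2}}\left(1+O\left(\frac1n\right)\right)$. 12. If $x=n/2-\ell_3(n)$, $y=n/2+\ell_3(n)$: $\ \sqrt{\frac{2}{\pi n}}\left(1+O\left(\frac{\ell_3(n)^2+n}{n^2}\right)\right)$.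 13. If $x=a_xn+\ell_2^{a_x}(n)$, $y=a_yn+\ell_2^{a_y}(n)$, $x+y=n$: $\ \sqrt{\frac{2}{\pi n(1-a_-^2)}}\left(1+O\left(\frac{\ell_2^{a_x}(n)}{n}\right)\right)$. 14. If $x=\ell_3(n)$, $y=n-\ell_3(n)$: $\ \frac{1}{\sqrt{2\pi\ell_3(n)}}\left(1+O\left(\frac{\ell_3(n)}{n}\right)+O\left(\frac{1}{\ell_3(n)}\right)\right)$. 15. If $x=c$, $y=n-c$: $\ \frac{d\,e^{-1/(12c)}}{\sqrt{2\pi c}}\left(1+O\left(\frac1n\right)\right)$. 16. If $x=0$, $y=n$: $\ 1$. Here the $O(\cdot)$ terms may depend on the constants $a,a_x,a_y,b,c,c_x$, and $c_y$, and for general $x,y$, $f_{x,y}(n)$ is obtained from the values above by the axial symmetries of the walk. Moreover, if $x^2+y^2\le n^2/\log^4(n)$ and $|y^2-x^2|\le n^{3/2}/\log(n)$ (with $x+y+n$ even), we have $$P(S_n=(x,y))=\frac{2}{\pi n}e^{-s_0}\left(1+O\left(\frac{y^2-x^2}{n^2}\right)+O\left(\frac{(y^2-x^2)^2}{n^3}\right)\right),$$ where $$s_0=\sum_{\ell\ge1}\frac{1}{4\ell(2\ell-1)}\frac{(2x)^{2\ell}+(2y)^{2\ell}}{n^{2\ell-1}}.$$ In particular, for all $n\in\mathbb{N}$, $N\ge2$, $a<(2N-1)/(2N)$, and $(x,y)$ (with $x+y+n$ even) such that $\sqrt{x^2+y^2}\le n^a$ and $|y^2-x^2|\le n^{3/2}/\log(n)$,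 we have $$P(S_n=(x,y))=\frac{2}{\pi n}\exp\left\{-\sum_{\ell=1}^{N-1}\frac{1}{4\ell(2\ell-1)}\frac{(2x)^{2\ell}+(2y)^{2\ell}}{n^{2\ell-1}}\right\}\left(1+O\left(\frac{y^2-x^2}{n^2}\right)+O\left(\frac{(y^2-x^2)^2}{n^3}\right)+O\left(\frac{(x^2+y^2)^N}{n^{2N-1}}\right)\right).$$
   Context: Planar symmetric simple random walk: $S_0=0$, $S_n=\sum_{k=1}^nX_k$ with $X_k$ independent in $\mathbb{Z}^2$ and $P(X_k=\pm e_1)=P(X_k=\pm e_2)=\frac14$, where $e_1,e_2$ is the standard basis of $\mathbb{R}^2$. $\|\cdot\|_1$ is the $L^1$ norm. The point $(x,y)$ is thought of as depending on $n$. $f(n)=O(g(n))$ means that there is a universal constant $C$ such that $|f(n)|\le C|g(n)|$ for all $n$; any dependence of $C$ on other quantities is stated explicitly.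
   Formalization: Added: O(1/n) in items 3, 4, 13; O((n+x²+y²)/n²) in the last two displays; c_x≠c_y in item 11; n≥2 in the last two displays, with C depending on N in the last. Items with functions ℓ hold for large n, C independent of ℓ; d is some value in its interval depending on c (c_x, c_y). *)

theory Defs
  imports "HOL-Probability.Probability" "HOL-Library.Landau_Symbols"
begin

definition planar_srw :: "'a measure \<Rightarrow> (nat \<Rightarrow> 'a \<Rightarrow> int \<times> int) \<Rightarrow> bool" where
  "planar_srw M S \<longleftrightarrow> prob_space M \<and>
     (\<exists>X :: nat \<Rightarrow> 'a \<Rightarrow> int \<times> int.
        prob_space.indep_vars M (\<lambda>_. count_space UNIV) X {1..} \<and>
        (\<forall>k\<ge>1. \<forall>e\<in>{(1, 0), (-1, 0), (0, 1), (0, -1)}. \<P>(\<omega> in M. X k \<omega> = e) = 1 / 4) \<and>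
        (\<forall>n. \<forall>\<omega>\<in>space M. S n \<omega> = (\<Sum>k=1..n. X k \<omega>)))"

definition reachable :: "nat \<Rightarrow> int \<Rightarrow> int \<Rightarrow> bool" where
  "reachable n x y \<longleftrightarrow> \<bar>x\<bar> + \<bar>y\<bar> \<le> int n \<and> even (x + y + int n)"

text \<open>The range of the constant in the boundary regimes, where one or two of the factorials
  in the binomial coefficients have bounded argument and Stirling's formula only gives
  two-sided bounds.\<close>
definition stirling_range :: "real set" where
  "stirling_range = {exp (11/12) / sqrt (2 * pi) ..< 2 * pi / exp (11/6)}"

definition walk_exponent :: "nat \<Rightarrow> int \<Rightarrow> int \<Rightarrow> real" where
  "walk_exponent n x y =
     (\<Sum>\<^sub>\<infinity>l\<in>{1::nat..}. 1 / (2 * real l * (2 * real l - 1)) *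
        (real_of_int ((x + y) ^ (2 * l) + (y - x) ^ (2 * l)) / real n ^ (2 * l - 1)))"

definition s0_term :: "nat \<Rightarrow> int \<Rightarrow> int \<Rightarrow> nat \<Rightarrow> real" where
  "s0_term n x y l = 1 / (4 * real l * (2 * real l - 1)) *
     (real_of_int ((2 * x) ^ (2 * l) + (2 * y) ^ (2 * l)) / real n ^ (2 * l - 1))"

text \<open>If \<open>2\<bar>x\<bar> > n\<close> or \<open>2\<bar>y\<bar> > n\<close> the series diverges and the value below is the
  conventional 0. For \<open>x\<^sup>2 + y\<^sup>2 \<le> n\<^sup>2 / ln\<^sup>4 n\<close> this only concerns finitely many \<open>(n, x, y)\<close>,
  all with \<open>n \<le> 4\<close>.\<close>
definition s0 :: "nat \<Rightarrow> int \<Rightarrow> int \<Rightarrow> real" where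
  "s0 n x y = (\<Sum>\<^sub>\<infinity>l\<in>{1::nat..}. s0_term n x y l)"

end

theory Submission
  imports Defs "HOL-Real_Asymp.Real_Asymp"
begin

text \<open>
  In the rotated coordinates \<open>u = x + y\<close>, \<open>v = y - x\<close> the walk consists of two independent simple
  walks on the line, so \<open>P(S\<^sub>n = (x, y))\<close> is a product of two binomial weights
  \<open>2\<^sup>-\<^sup>n (n choose (n + u)/2)\<close>. The series in the exponent is \<open>n (h(u/n) + h(v/n))\<close> with
  \<open>h(t) = ((1 + t) ln (1 + t) + (1 - t) ln (1 - t))/2\<close>, and dividing it out leaves exactly
  \<open>s(n) / (s(k) s(m))\<close> for each factor, where \<open>k, m = (n \<plusminus> u)/2\<close> and \<open>s(j) = j! e\<^sup>j / j\<^sup>j\<close>.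
  By Stirling \<open>ln s(j)\<close> is \<open>ln (2 \<pi> j)/2\<close> up to an error in \<open>[0, 1/(12 j)]\<close>. In all regimes each
  factor is either in the bulk (\<open>u/n\<close> bounded away from \<open>1\<close>), or has \<open>m\<close> large but \<open>o(n)\<close>,
  or \<open>m\<close> constant, or \<open>m = 0\<close>; the constant \<open>d\<close> is the exact value of
  \<open>exp (1/(12 m))\<close> divided by the Stirling correction at a constant \<open>m\<close>
  (with two constant factors, the geometric mean of two such values).
  The local limit statements follow from
  \<open>h(A) + h(B) - (h(A + B) + h(A - B))/2 = O(A\<^sup>2 B\<^sup>2)\<close> with \<open>A = u/n\<close>, \<open>B = v/n\<close>.
\<close>

subsection \<open>Stirling's formula with explicit error bounds\<close>

text \<open>The constants \<open>C\<close> have to be uniform over all admissible functions of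
  \<open>n\<close>, while the threshold from which a regime applies may depend on them. So each
  factor is estimated for a fixed \<open>n\<close> with an explicit error, and the
  \<open>o(n)\<close> and divergence hypotheses enter only through the choice of that threshold.

  A bulk factor depends on \<open>u\<close> through \<open>u^2\<close> alone. Its error is therefore
  quadratic in \<open>u/n\<close> around the centre \<open>0\<close> but only linear around a
  nonzero slope, which is why squared deviations appear near the diagonal and near the midpoint of
  an edge, and first powers elsewhere.

  When \<open>m\<close> stays bounded, the Stirling correction at \<open>m\<close> is a fixed number
  that \<open>1/(12 m)\<close> overshoots by a fixed amount, so no vanishing error term could
  replace \<open>d\<close>.

  A relative correction of order \<open>1/n\<close> is present already at \<open>x = y = 0\<close>,
  where \<open>y^2 - x^2\<close> vanishes. This is why terms such as \<open>1/n\<close>, and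
  \<open>(n + x^2 + y^2)/n^2\<close> in the local limit statements, accompany error terms that can
  be zero.\<close>

definition stirling_quot :: "nat \<Rightarrow> real" where
  "stirling_quot j = fact j * exp (real j) / real j ^ j"

definition stirling_err :: "nat \<Rightarrow> real" where
  "stirling_err j = ln (stirling_quot j) - ln (2 * pi * real j) / 2"

lemma stirling_quot_pos: "stirling_quot j > 0"
  by (cases j) (simp_all add: stirling_quot_def)

lemma stirling_quot_0 [simp]: "stirling_quot 0 = 1"
  by (simp add: stirling_quot_def)

lemma ln_stirling_quot:
  "j \<ge> 1 \<Longrightarrow> ln (stirling_quot j) = ln (fact j) + real j - real j * ln (real j)"
  by (simp add: stirling_quot_def ln_div ln_mult ln_realpow)

lemma ln_stirling_quot_eq: "ln (stirling_quot j) = ln (2 * pi * real j) / 2 + stirling_err j"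
  by (simp add: stirling_err_def)

lemma stirling_err_diff:
  assumes "j \<ge> 1"
  shows "stirling_err j - stirling_err (Suc j) = (real j + 1/2) * ln ((real j + 1) / real j) - 1"
proof -
  have a: "ln (2 * pi * real j) = ln (2*pi) + ln (real j)"
    "ln (2 * pi * real (Suc j)) = ln (2*pi) + ln (real (Suc j))"
    using assms by (simp_all only: ln_mult) auto
  have b: "ln (fact (Suc j) :: real) = ln (real (Suc j)) + ln (fact j)"
    by (simp add: ln_mult add.commute)
  have c: "ln ((real j + 1) / real j) = ln (real (Suc j)) - ln (real j)"
    using assms by (simp add: ln_div add.commute)
  have d: "real (Suc j) = real j + 1" by simp
  show ?thesis
    unfolding stirling_err_def ln_stirling_quot[OF assms] ln_stirling_quot[OF le_SucI[OF assms]] a b c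
    unfolding d by (simp add: field_simps)
qed

text \<open>With \<open>y = 1/(2j+1)\<close> one has
  \<open>ln ((j+1)/j) = 2 (y + y^3/3 + y^5/5 + ...)\<close>, so the difference of consecutive errors
  is \<open>y^2/3 + y^4/5 + ...\<close>. It is nonnegative, and it is below the geometric series
  \<open>y^2/(3 (1 - y^2))\<close>, which equals \<open>1/(12 j) - 1/(12 (j+1))\<close>. The
  strictness of the second bound later yields \<open>1 < stirling_defect 1\<close>.\<close>

lemma stirling_err_step:
  assumes "j \<ge> 1"
  shows "stirling_err (Suc j) \<le> stirling_err j"
    and "1 / (12 * real (Suc j)) - stirling_err (Suc j) < 1 / (12 * real j) - stirling_err j"
proof -
  define J where "J = real j"
  have J: "J \<ge> 1" using assms by (simp add: J_def)
  define x where "x = (J + 1) / J"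
  define y where "y = 1 / (2 * J + 1)"
  have y: "0 < y" "y < 1" using J by (simp_all add: y_def)
  have xy: "(x - 1) / (x + 1) = y" using J by (simp add: x_def y_def field_simps)
  have x1: "x > 1" using J by (simp add: x_def)
  have b: "ln x \<ge> 2*y + 2*y^3/3" "ln x \<le> 2*y + 2*y^3/3 + 2 * (y^5 / (1-y^2) / 5)"
    using ln_approx_bounds[OF x1, of 2] unfolding xy
    by (simp_all add: numeral_eq_Suc)
  have yy: "J + 1/2 = 1 / (2 * y)" using J by (simp add: y_def field_simps)
  have e: "stirling_err j - stirling_err (Suc j) = ln x / (2 * y) - 1"
    using stirling_err_diff[OF assms] yy by (simp add: J_def x_def)
  have "ln x / (2*y) \<ge> (2*y + 2*y^3/3) / (2 * y)"
    using b y by (intro divide_right_mono) auto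
  moreover have "(2*y + 2*y^3/3) / (2 * y) = 1 + y^2/3"
    using y by (simp add: field_simps power2_eq_square power3_eq_cube)
  moreover have "y^2 \<ge> 0" by simp
  ultimately show "stirling_err (Suc j) \<le> stirling_err j" using e by linarith
  have y2: "y^2 < 1" using y by (simp add: power_less_one_iff)
  have "ln x / (2*y) \<le> (2*y + 2*y^3/3 + 2 * (y^5 / (1-y^2) / 5)) / (2 * y)"
    using b y by (intro divide_right_mono) auto
  also have "\<dots> = 1 + y^2/3 + y^4/(5*(1-y^2))"
    using y y2 by (simp add: field_simps power_numeral_reduce)
  \<comment> \<open>Weakening the denominator \<open>5\<close> to \<open>3\<close> completes the
    geometric series \<open>y^2/3 (1 + y^2 + ...)\<close>, whose value telescopes in
    \<open>j\<close>; the strict inequality arises here.\<close>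
  also have "\<dots> < 1 + y^2/3 + y^4/(3*(1-y^2))"
    using y y2 by (intro add_strict_left_mono divide_strict_left_mono) auto
  also have "\<dots> = 1 + y^2/(3*(1-y^2))"
    using y2 by (simp add: field_simps power_numeral_reduce)
  also have "1 - y^2 = 4 * J * (J + 1) * y^2"
  proof -
    have "y * (2*J+1) = 1" using J by (simp add: y_def)
    hence "y^2 * (2*J+1)^2 = 1" by (metis power_mult_distrib power_one)
    thus ?thesis by (simp add: power2_eq_square algebra_simps)
  qed
  also have "y^2/(3*(4 * J * (J + 1) * y^2)) = 1/(12 * J) - 1 / (12 * (J + 1))"
    using J y by (simp add: divide_simps)
  finally show "1 / (12 * real (Suc j)) - stirling_err (Suc j) < 1 / (12 * real j) - stirling_err j"
    using e by (simp add: J_def add.commute)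
qed

text \<open>The partial Wallis product is \<open>2^(4n) n!^4 / ((2n)!^2 (2n+1))\<close>. Written
  through \<open>stirling_err\<close>, the powers \<open>n^n\<close> and \<open>e^n\<close> cancel,
  and what is left determines the limit of the error.\<close>

lemma wallis_stirling:
  assumes "n \<ge> 1"
  shows "ln (\<Prod>k=1..n. (4*real k^2) / (4*real k^2 - 1)) =
           4 * stirling_err n - 2 * stirling_err (2 * n) + ln (2 * pi)
             + ln (real n / (2 * (2 * real n + 1)))"
proof -
  have prod: "(\<Prod>k=1..n. (4*real k^2) / (4*real k^2 - 1)) =
      2 ^ (4 * n) * fact n ^ 4 / ((fact (2 * n))\<^sup>2 * (2 * real n + 1))" for n
  proof (induction n)
    case (Suc n)
    have f: "fact (2 * Suc n) = (2 * real n + 2) * (2 * real n + 1) * fact (2 * n)"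
      by (simp add: algebra_simps)
    have g: "fact (Suc n) = (real n + 1) * fact n" by (simp add: add.commute)
    have q: "4 * (real (Suc n))^2 - 1 = (2 * real n + 1) * (2 * real n + 3)"
      by (simp add: power2_eq_square algebra_simps)
    have "(\<Prod>k=1..Suc n. (4*real k^2) / (4*real k^2 - 1)) =
        (2 ^ (4 * n) * fact n ^ 4 / ((fact (2 * n))\<^sup>2 * (2 * real n + 1))) *
        (4 * (real n + 1)^2 / ((2 * real n + 1) * (2 * real n + 3)))"
      using Suc q by (simp add: add.commute)
    also have "\<dots> = 2 ^ (4 * Suc n) * ((real n + 1) * fact n) ^ 4 /
        (((2 * real n + 2) * (2 * real n + 1) * fact (2 * n))\<^sup>2 * (2 * real n + 3))"
    proof -
      have *: "a * f ^ 4 / (F\<^sup>2 * m) * (4 * t^2 / (m * r)) =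
        16 * a * (t * f) ^ 4 / ((2 * t * m * F)\<^sup>2 * r)" if "m > 0" "r > 0" "F > 0" "t > 0"
        for a f F m t r :: real
        using that by (simp add: field_simps power_numeral_reduce)
      show ?thesis
        using *[of "2 * real n + 1" "2 * real n + 3" "fact (2*n)" "real n + 1" "2 ^ (4*n)" "fact n"]
        by (simp add: power_add algebra_simps)
    qed
    finally show ?case unfolding f g by (simp add: algebra_simps)
  qed simp
  have ln4: "ln (16::real) = 4 * ln 2" "ln (4::real) = 2 * ln 2"
    using ln_realpow[of 2 4] ln_realpow[of 2 2] by simp_all
  have a: "ln (\<Prod>k=1..n. (4*real k^2) / (4*real k^2 - 1)) =
     4 * real n * ln 2 + 4 * ln (fact n) - 2 * ln (fact (2 * n)) - ln (2 * real n + 1)"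
    unfolding prod using assms
    by (simp add: ln_div ln_mult ln_realpow add_pos_nonneg ln4 power_mult)
  have b: "ln (2 * pi * real n) = ln (2*pi) + ln (real n)"
    "ln (2 * pi * real (2*n)) = ln (2*pi) + (ln 2 + ln (real n))"
    "ln (real (2*n)) = ln 2 + ln (real n)"
    using assms by (simp_all add: ln_mult ln4)
  have c: "ln (real n / (2 * (2 * real n + 1))) = ln (real n) - (ln 2 + ln (2 * real n + 1))"
    using assms by (subst ln_div; (subst ln_mult)?) (simp_all add: add_pos_nonneg)
  have d: "real (2 * n) = 2 * real n" by simp
  have n2: "1 \<le> 2 * n" using assms by simp
  show ?thesis
    unfolding stirling_err_def ln_stirling_quot[OF assms] ln_stirling_quot[OF n2] a b c
    unfolding d by (simp add: field_simps)
qed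

lemma stirling_defect_decseq: "decseq (\<lambda>n. 1 / (12 * real (Suc n)) - stirling_err (Suc n))"
  unfolding decseq_Suc_iff by (metis le_add1 less_imp_le plus_1_eq_Suc stirling_err_step(2))

text \<open>Monotonicity yields some limit \<open>l\<close>. Passing to the limit in
  \<open>wallis_stirling\<close> gives \<open>4l - 2l + ln (2 pi) + ln (1/4) = ln (pi/2)\<close>, so
  \<open>l = 0\<close>: this is what fixes the factor \<open>2 pi\<close> in the
  normalisation.\<close>

lemma stirling_err_tendsto_0: "stirling_err \<longlonglongrightarrow> 0"
proof -
  define e where "e n = stirling_err (Suc n)" for n
  define d where "d n = 1 / (12 * real (Suc n)) - stirling_err (Suc n)" for n
  have dec: "decseq e"
    unfolding decseq_Suc_iff e_def using stirling_err_step(1) by simp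
  have decd: "decseq d"
    unfolding d_def by (rule stirling_defect_decseq)
  \<comment> \<open>The decreasing sequence \<open>d\<close> controls \<open>e\<close> from below,
    because their sum \<open>1/(12 (n+1))\<close> is nonnegative.\<close>
  have "e n \<ge> - d 0" for n
  proof -
    have "d n \<le> d 0" using decd by (simp add: decseq_def)
    moreover have "e n = 1 / (12 * real (Suc n)) - d n" by (simp add: e_def d_def)
    moreover have "1 / (12 * real (Suc n)) \<ge> 0" by simp
    ultimately show ?thesis by linarith
  qed
  then obtain l where "e \<longlonglongrightarrow> l" using decseq_convergent[OF dec] by blast
  hence l: "stirling_err \<longlonglongrightarrow> l" unfolding e_def by (rule filterlim_sequentially_Suc[THEN iffD1])
  have l2: "(\<lambda>n. stirling_err (2 * n)) \<longlonglongrightarrow> l"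
    by (rule filterlim_compose[OF l]) (rule mult_nat_left_at_top, simp)
  have "(\<lambda>n. real n / (2 * (2 * real n + 1))) \<longlonglongrightarrow> 1/4"
    by real_asymp
  hence "(\<lambda>n. ln (real n / (2 * (2 * real n + 1)))) \<longlonglongrightarrow> ln (1/4)"
    by (rule tendsto_ln) simp
  hence "(\<lambda>n. 4 * stirling_err n - 2 * stirling_err (2 * n) + ln (2 * pi)
             + ln (real n / (2 * (2 * real n + 1)))) \<longlonglongrightarrow> 4 * l - 2 * l + ln (2 * pi) + ln (1/4)"
    by (intro tendsto_add tendsto_diff tendsto_mult tendsto_const l l2)
  moreover have "(\<lambda>n. ln (\<Prod>k=1..n. (4*real k^2) / (4*real k^2 - 1))) \<longlonglongrightarrow> ln (pi / 2)"
    by (rule tendsto_ln[OF wallis]) simp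
  hence "(\<lambda>n. 4 * stirling_err n - 2 * stirling_err (2 * n) + ln (2 * pi)
             + ln (real n / (2 * (2 * real n + 1)))) \<longlonglongrightarrow> ln (pi / 2)"
    by (rule Lim_transform_eventually)
       (use wallis_stirling in \<open>auto simp: eventually_at_top_linorder\<close>)
  ultimately have "4 * l - 2 * l + ln (2 * pi) + ln (1/4) = ln (pi / 2)"
    by (rule LIMSEQ_unique)
  moreover have "ln (1/4::real) = - 2 * ln 2"
    using ln_realpow[of 2 2] by (simp add: ln_div)
  ultimately have "l = 0" by (simp add: ln_mult ln_div)
  with l show ?thesis by simp
qed

text \<open>Both \<open>stirling_err j\<close> and \<open>1/(12 j) - stirling_err j\<close> decrease
  to \<open>0\<close>, hence are nonnegative.\<close>

lemma stirling_err_bounds: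
  assumes "j \<ge> 1"
  shows "0 \<le> stirling_err j" and "stirling_err j \<le> 1 / (12 * real j)"
proof -
  obtain i where j: "j = Suc i" using assms by (cases j) auto
  have lim: "(\<lambda>n. stirling_err (Suc n)) \<longlonglongrightarrow> 0"
    using stirling_err_tendsto_0 by (rule LIMSEQ_Suc)
  have "decseq (\<lambda>n. stirling_err (Suc n))"
    unfolding decseq_Suc_iff using stirling_err_step(1) by simp
  from decseq_ge[OF this lim, of i] show "0 \<le> stirling_err j" by (simp add: j)
  have "(\<lambda>n. 1 / (12 * real (Suc n))) \<longlonglongrightarrow> 0" by real_asymp
  from tendsto_diff[OF this lim]
  have "(\<lambda>n. 1 / (12 * real (Suc n)) - stirling_err (Suc n)) \<longlonglongrightarrow> 0" by simp
  from decseq_ge[OF stirling_defect_decseq this, of i]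
  show "stirling_err j \<le> 1 / (12 * real j)" by (simp add: j)
qed

section \<open>The admissible range of the constant \<open>d\<close>\<close>

definition stirling_defect :: "nat \<Rightarrow> real" where
  "stirling_defect j = exp (1 / (12 * real j) - stirling_err j)"

text \<open>Since \<open>stirling_quot 1 = e\<close>, the number
  \<open>D = stirling_defect 1\<close> is \<open>sqrt (2 pi) / exp (11/12)\<close>. The endpoints of
  the range are \<open>1/D\<close> and \<open>D^2\<close>.\<close>

lemma stirling_range_conv:
  "stirling_range = {1 / stirling_defect 1 ..< (stirling_defect 1)\<^sup>2}"
proof -
  have e: "exp (ln (2 * pi) / 2) = sqrt (2 * pi)"
    by (simp add: powr_half_sqrt[symmetric] powr_def)
  have "stirling_defect 1 = exp (ln (2 * pi) / 2 - 11/12)"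
    by (simp add: stirling_defect_def stirling_err_def stirling_quot_def field_simps)
  hence d: "stirling_defect 1 = sqrt (2 * pi) / exp (11/12)" by (simp add: exp_diff e)
  have "(exp (11/12 :: real))\<^sup>2 = exp (11/6)" by (simp add: power2_eq_square flip: exp_add)
  thus ?thesis unfolding d by (simp add: stirling_range_def power_divide)
qed

text \<open>The first two bounds restate \<open>stirling_err_bounds\<close> and the monotonicity of
  the defect. The third combines the strict decrease from \<open>1\<close> to \<open>2\<close> with
  the nonnegative exponent at \<open>2\<close>.\<close>

lemma stirling_defect_bounds:
  assumes "j \<ge> 1"
  shows "1 \<le> stirling_defect j" and "stirling_defect j \<le> stirling_defect 1"
    and "1 < stirling_defect 1"
proof -
  show "1 \<le> stirling_defect j" using stirling_err_bounds[OF assms] by (simp add: stirling_defect_def)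
  obtain i where j: "j = Suc i" using assms by (cases j) auto
  show "stirling_defect j \<le> stirling_defect 1"
    using decseqD[OF stirling_defect_decseq, of 0 i] by (simp add: stirling_defect_def j)
  show "1 < stirling_defect 1"
    using stirling_err_step(2)[of 1] stirling_err_bounds(2)[of 2]
    by (simp add: stirling_defect_def numeral_2_eq_2)
qed

text \<open>With \<open>D = stirling_defect 1\<close>, a geometric mean of two numbers in
  \<open>[1, D]\<close> stays in \<open>[1, D]\<close>, and \<open>D > 1\<close> gives
  \<open>D < D^2\<close>, so the excluded right end of the range is not reached. The mean is needed
  when both factors sit at constant distance from the edge and \<open>d^2\<close> stands for the
  product of their defects.\<close>

lemma stirling_defect_mean_in_range:
  assumes "i \<ge> 1" "j \<ge> 1"
  shows "sqrt (stirling_defect i * stirling_defect j) \<in> stirling_range"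
proof -
  note bi = stirling_defect_bounds[OF assms(1)] and bj = stirling_defect_bounds[OF assms(2)]
  have "1 * 1 \<le> stirling_defect i * stirling_defect j"
    using bi bj by (intro mult_mono) auto
  hence "1 \<le> sqrt (stirling_defect i * stirling_defect j)" by simp
  moreover have "stirling_defect i * stirling_defect j \<le> stirling_defect 1 * stirling_defect 1"
    using bi bj by (intro mult_mono) auto
  hence "sqrt (stirling_defect i * stirling_defect j) \<le> stirling_defect 1"
    using bi by (intro real_le_lsqrt) (auto simp: power2_eq_square)
  moreover have "stirling_defect 1 * 1 < stirling_defect 1 * stirling_defect 1"
    using bi by (intro mult_strict_left_mono) auto
  moreover have "1 / stirling_defect 1 \<le> 1" using bi by simp
  ultimately show ?thesis
    unfolding stirling_range_conv power2_eq_square atLeastLessThan_iff by linarith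
qed

lemma stirling_defect_in_range: "j \<ge> 1 \<Longrightarrow> stirling_defect j \<in> stirling_range"
  using stirling_defect_mean_in_range[of j j] stirling_defect_bounds(1)[of j] by simp

lemma ln_stirling_quot_defect:
  "ln (stirling_quot j) = ln (2 * pi * real j) / 2 + 1 / (12 * real j) - ln (stirling_defect j)"
  by (simp add: stirling_defect_def ln_stirling_quot_eq)

subsection \<open>The exponent as a binary entropy\<close>

text \<open>This is \<open>ln 2\<close> minus the entropy of a coin with bias
  \<open>(1 + t)/2\<close>. At \<open>t = 1\<close> and \<open>t = -1\<close> the vanishing
  coefficient removes the term with \<open>ln 0\<close>, which leaves the correct value
  \<open>ln 2\<close>.\<close>

definition binary_entropy_defect :: "real \<Rightarrow> real" where
  "binary_entropy_defect t = ((1 + t) * ln (1 + t) + (1 - t) * ln (1 - t)) / 2"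

text \<open>Inside the interval the function is \<open>t/2\<close> times the series of
  \<open>ln (1+t) - ln (1-t)\<close> plus half the series of \<open>ln (1 - t^2)\<close>; the
  coefficients combine as \<open>1/(2n+1) - 1/(2n+2)\<close>. The endpoints cannot be dropped, since
  they occur for walks ending on the boundary \<open>x + y = n\<close>; there the series is the
  alternating harmonic one, grouped in pairs.\<close>

lemma binary_entropy_defect_sums:
  assumes "\<bar>t\<bar> \<le> 1"
  shows "(\<lambda>l. t ^ (2 * Suc l) / (2 * real (Suc l) * (2 * real (Suc l) - 1)))
           sums binary_entropy_defect t"
proof (cases "\<bar>t\<bar> < 1")
  case True
  \<comment> \<open>Chosen so that \<open>(x - 1)/(x + 1) = t\<close>, the variable of the quadratic
    series for \<open>ln x\<close>.\<close>
  define x where "x = (1 + t) / (1 - t)"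
  have x: "x > 0" using True by (simp add: x_def)
  have "1 - t \<noteq> 0" "x - 1 = 2 * t / (1 - t)" "x + 1 = 2 / (1 - t)"
    using True by (auto simp: x_def field_simps)
  hence xt: "(x - 1) / (x + 1) = t" by simp
  have lnx: "ln x = ln (1 + t) - ln (1 - t)" unfolding x_def using True by (subst ln_div) auto
  have a: "(\<lambda>n. 2 * t ^ (2*n+1) / real (2*n+1)) sums (ln (1 + t) - ln (1 - t))"
    using ln_series_quadratic[OF x] unfolding xt lnx by simp
  have t2: "t\<^sup>2 < 1" using True by (simp add: abs_square_less_1)
  have "(\<lambda>n. - ((t\<^sup>2) ^ n) / real n) sums ln (1 + - t\<^sup>2)"
    using ln_series'[of "- t\<^sup>2"] t2 by simp
  hence "(\<lambda>n. - ((t\<^sup>2) ^ Suc n) / real (Suc n)) sums ln (1 + - t\<^sup>2)"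
    by (subst sums_Suc_iff) simp
  moreover have "1 + - t\<^sup>2 = (1 + t) * (1 - t)" by (simp add: power2_eq_square algebra_simps)
  hence "ln (1 + - t\<^sup>2) = ln (1 + t) + ln (1 - t)"
    using True by (simp only:) (subst ln_mult, auto)
  ultimately have b: "(\<lambda>n. - ((t\<^sup>2) ^ Suc n) / real (Suc n)) sums (ln (1 + t) + ln (1 - t))"
    by simp
  have "(\<lambda>n. t / 2 * (2 * t ^ (2*n+1) / real (2*n+1)) + 1 / 2 * (- ((t\<^sup>2) ^ Suc n) / real (Suc n)))
     sums (t / 2 * (ln (1 + t) - ln (1 - t)) + 1 / 2 * (ln (1 + t) + ln (1 - t)))"
    by (intro sums_add sums_mult a b)
  also have "(\<lambda>n. t / 2 * (2 * t ^ (2*n+1) / real (2*n+1)) + 1 / 2 * (- ((t\<^sup>2) ^ Suc n) / real (Suc n)))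
     = (\<lambda>l. t ^ (2 * Suc l) / (2 * real (Suc l) * (2 * real (Suc l) - 1)))"
  proof
    fix n
    have p: "(t\<^sup>2) ^ Suc n = t ^ (2 * Suc n)" "t * t ^ (2*n+1) = t ^ (2 * Suc n)"
      by (simp_all only: power_mult [symmetric]) (simp add: power2_eq_square)
    have "t / 2 * (2 * t ^ (2*n+1) / real (2*n+1)) = (t * t ^ (2*n+1)) / (2 * real n + 1)"
      by simp
    hence "t / 2 * (2 * t ^ (2*n+1) / real (2*n+1)) + 1 / 2 * (- ((t\<^sup>2) ^ Suc n) / real (Suc n)) =
       t ^ (2 * Suc n) / (2 * real n + 1) - t ^ (2 * Suc n) / (2 * real (Suc n))"
      unfolding p by simp
    also have "\<dots> = t ^ (2 * Suc n) * (1 / (2 * real n + 1) - 1 / (2 * real n + 2))"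
      by (simp add: algebra_simps)
    also have "1 / (2 * real n + 1) - 1 / (2 * real n + 2) =
        1 / (2 * real (Suc n) * (2 * real (Suc n) - 1))"
      by (simp add: divide_simps) (simp add: algebra_simps)
    finally show "t / 2 * (2 * t ^ (2*n+1) / real (2*n+1)) + 1 / 2 * (- ((t\<^sup>2) ^ Suc n) / real (Suc n))
       = t ^ (2 * Suc n) / (2 * real (Suc n) * (2 * real (Suc n) - 1))" by simp
  qed
  also have "t / 2 * (ln (1 + t) - ln (1 - t)) + 1 / 2 * (ln (1 + t) + ln (1 - t)) =
      binary_entropy_defect t"
    by (simp add: binary_entropy_defect_def field_simps)
  finally show ?thesis .
next
  case False
  hence t: "t = 1 \<or> t = - 1" using assms by auto
  have "(\<lambda>l. t ^ (2 * Suc l) / (2 * real (Suc l) * (2 * real (Suc l) - 1))) =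
      (\<lambda>k. inverse (real (2*k+1)) - inverse (real (2*k+2)))"
  proof
    fix k
    have "t ^ (2 * Suc k) = 1" using t by (auto simp: power_mult)
    thus "t ^ (2 * Suc k) / (2 * real (Suc k) * (2 * real (Suc k) - 1)) =
       inverse (real (2*k+1)) - inverse (real (2*k+2))"
      by (simp add: divide_simps)
  qed
  moreover have "binary_entropy_defect t = ln 2"
    using t by (auto simp: binary_entropy_defect_def)
  ultimately show ?thesis using alternating_harmonic_series_sums' by simp
qed

text \<open>Nonnegative terms make the ordinary convergent series summable in the unordered sense of
  \<open>infsum\<close>.\<close>

lemma infsum_atLeast1_eq:
  fixes g :: "nat \<Rightarrow> real"
  assumes "(\<lambda>l. g (Suc l)) sums s" "\<And>l. g l \<ge> 0"
  shows "infsum g {1..} = s"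
proof -
  have "((\<lambda>l. g (Suc l)) has_sum s) UNIV"
    using assms by (intro sums_nonneg_imp_has_sum) auto
  moreover have "bij_betw Suc UNIV {1..}"
    by (auto simp: bij_betw_def image_iff) (metis Suc_le_D)
  ultimately have "(g has_sum s) {1..}"
    using has_sum_reindex_bij_betw[of Suc UNIV "{1..}" g s] by simp
  thus ?thesis by (rule infsumI)
qed

lemma scaled_even_power:
  assumes "n \<ge> 1" "l \<ge> 1"
  shows "real_of_int (a ^ (2 * l)) / real n ^ (2 * l - 1) = real n * (real_of_int a / real n) ^ (2 * l)"
proof -
  have "real n ^ (2 * l) = real n * real n ^ (2 * l - 1)"
    using assms by (metis Suc_diff_1 mult_pos_pos pos2 power_Suc zero_less_one order_less_le_trans)
  thus ?thesis using assms by (simp add: power_divide)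
qed

lemma walk_exponent_eq:
  assumes "n \<ge> 1" "reachable n x y"
  shows "walk_exponent n x y = real n * (binary_entropy_defect (real_of_int (x + y) / real n) +
           binary_entropy_defect (real_of_int (y - x) / real n))"
  unfolding walk_exponent_def
proof (rule infsum_atLeast1_eq)
  let ?U = "real_of_int (x + y) / real n" and ?V = "real_of_int (y - x) / real n"
  have "\<bar>real_of_int (x + y)\<bar> \<le> real n" "\<bar>real_of_int (y - x)\<bar> \<le> real n"
    using assms(2) unfolding reachable_def by linarith+
  hence "\<bar>?U\<bar> \<le> 1" "\<bar>?V\<bar> \<le> 1" using assms(1) by (auto simp: abs_divide)
  hence "(\<lambda>l. real n * (?U ^ (2 * Suc l) / (2 * real (Suc l) * (2 * real (Suc l) - 1)) +
      ?V ^ (2 * Suc l) / (2 * real (Suc l) * (2 * real (Suc l) - 1)))) sums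
      (real n * (binary_entropy_defect ?U + binary_entropy_defect ?V))"
    by (intro sums_mult sums_add binary_entropy_defect_sums)
  also have "(\<lambda>l. real n * (?U ^ (2 * Suc l) / (2 * real (Suc l) * (2 * real (Suc l) - 1)) +
      ?V ^ (2 * Suc l) / (2 * real (Suc l) * (2 * real (Suc l) - 1)))) =
     (\<lambda>l. 1 / (2 * real (Suc l) * (2 * real (Suc l) - 1)) *
        (real_of_int ((x + y) ^ (2 * Suc l) + (y - x) ^ (2 * Suc l)) / real n ^ (2 * Suc l - 1)))"
  proof
    fix l
    have l: "Suc l \<ge> 1" by simp
    show "real n * (?U ^ (2 * Suc l) / (2 * real (Suc l) * (2 * real (Suc l) - 1)) +
      ?V ^ (2 * Suc l) / (2 * real (Suc l) * (2 * real (Suc l) - 1))) =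
     1 / (2 * real (Suc l) * (2 * real (Suc l) - 1)) *
        (real_of_int ((x + y) ^ (2 * Suc l) + (y - x) ^ (2 * Suc l)) / real n ^ (2 * Suc l - 1))"
      unfolding of_int_add[of "(x+y) ^ _" "(y-x) ^ _"]
        add_divide_distrib[of "real_of_int ((x+y) ^ _)"] scaled_even_power[OF assms(1) l]
      by (simp only: distrib_left times_divide_times_eq) simp
  qed
  finally show "(\<lambda>l. 1 / (2 * real (Suc l) * (2 * real (Suc l) - 1)) *
        (real_of_int ((x + y) ^ (2 * Suc l) + (y - x) ^ (2 * Suc l)) / real n ^ (2 * Suc l - 1))) sums
      (real n * (binary_entropy_defect ?U + binary_entropy_defect ?V))" .
next
  fix l :: nat
  \<comment> \<open>Nonnegativity is required at \<open>l = 0\<close> too, where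
    \<open>2 l - 1\<close> is negative but the product is \<open>0\<close>.\<close>
  have w: "2 * real l * (2 * real l - 1) \<ge> 0" by (cases l) auto
  show "0 \<le> 1 / (2 * real l * (2 * real l - 1)) *
        (real_of_int ((x + y) ^ (2 * l) + (y - x) ^ (2 * l)) / real n ^ (2 * l - 1))"
    by (rule mult_nonneg_nonneg[OF divide_nonneg_nonneg[OF _ w]]) auto
qed

lemma s0_term_nonneg: "s0_term n x y l \<ge> 0"
proof -
  have w: "4 * real l * (2 * real l - 1) \<ge> 0" by (cases l) auto
  show ?thesis unfolding s0_term_def
    by (rule mult_nonneg_nonneg[OF divide_nonneg_nonneg[OF _ w]]) auto
qed

lemma s0_term_Suc:
  assumes "n \<ge> 1"
  shows "s0_term n x y (Suc l) = real n / 2 *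
     ((real_of_int (2 * x) / real n) ^ (2 * Suc l) / (2 * real (Suc l) * (2 * real (Suc l) - 1)) +
      (real_of_int (2 * y) / real n) ^ (2 * Suc l) / (2 * real (Suc l) * (2 * real (Suc l) - 1)))"
proof -
  define w where "w = 2 * real (Suc l) * (2 * real (Suc l) - 1)"
  have w: "4 * real (Suc l) * (2 * real (Suc l) - 1) = 2 * w" by (simp add: w_def)
  have l: "Suc l \<ge> 1" by simp
  show ?thesis unfolding s0_term_def w w_def[symmetric] of_int_add[of "(2*x) ^ _" "(2*y) ^ _"]
      add_divide_distrib[of "real_of_int ((2*x) ^ _)"] scaled_even_power[OF assms l]
    by (simp only: distrib_left times_divide_times_eq) simp
qed

lemma s0_sums:
  assumes "n \<ge> 1" "\<bar>real_of_int (2 * x) / real n\<bar> \<le> 1" "\<bar>real_of_int (2 * y) / real n\<bar> \<le> 1"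
  shows "(\<lambda>l. s0_term n x y (Suc l)) sums (real n / 2 *
    (binary_entropy_defect (real_of_int (2 * x) / real n) +
     binary_entropy_defect (real_of_int (2 * y) / real n)))"
  unfolding s0_term_Suc[OF assms(1)]
  by (intro sums_mult sums_add binary_entropy_defect_sums assms)

text \<open>The weight \<open>1/(4 l (2 l - 1))\<close> is half of the one in the entropy series,
  and the variables are \<open>2x/n\<close> and \<open>2y/n\<close>, which have to stay in
  \<open>[-1, 1]\<close> for convergence.\<close>

lemma s0_eq:
  assumes "n \<ge> 1" "\<bar>real_of_int (2 * x) / real n\<bar> \<le> 1" "\<bar>real_of_int (2 * y) / real n\<bar> \<le> 1"
  shows "s0 n x y = real n / 2 * (binary_entropy_defect (real_of_int (2 * x) / real n) +
     binary_entropy_defect (real_of_int (2 * y) / real n))"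
  unfolding s0_def by (rule infsum_atLeast1_eq[OF s0_sums[OF assms] s0_term_nonneg])

subsection \<open>The law of the walk\<close>

text \<open>Counts the paths of length \<open>n\<close> from \<open>0\<close> to \<open>u\<close> of
  the simple walk on the line. The value \<open>0\<close> for wrong parity or range makes Pascal's
  rule hold for all \<open>u\<close>.\<close>

definition signed_choose :: "nat \<Rightarrow> int \<Rightarrow> real" where
  "signed_choose n u =
     (if even (u + int n) \<and> \<bar>u\<bar> \<le> int n then real (n choose nat ((int n + u) div 2)) else 0)"

text \<open>For \<open>k > n\<close> the binomial coefficient vanishes by itself, so only the sign
  of \<open>k\<close> remains to be tested.\<close>

lemma signed_choose_double:
  "signed_choose n (2 * k - int n) = (if 0 \<le> k then real (n choose nat k) else 0)"
proof -
  have "\<not> k \<le> int n \<Longrightarrow> n choose nat k = 0"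
    by (rule binomial_eq_0) linarith
  moreover have "\<bar>2 * k - int n\<bar> \<le> int n \<longleftrightarrow> 0 \<le> k \<and> k \<le> int n" by linarith
  ultimately show ?thesis by (auto simp: signed_choose_def)
qed

lemma signed_choose_Suc: "signed_choose (Suc n) u = signed_choose n (u - 1) + signed_choose n (u + 1)"
proof (cases "even (u + int n + 1)")
  case False
  thus ?thesis by (simp add: signed_choose_def)
next
  case True
  define k where "k = (u + int n + 1) div 2"
  have u: "u = 2 * k - int (Suc n)" "u - 1 = 2 * (k - 1) - int n" "u + 1 = 2 * k - int n"
    using True unfolding k_def by presburger+
  have "signed_choose (Suc n) (2 * k - int (Suc n)) =
      signed_choose n (2 * (k - 1) - int n) + signed_choose n (2 * k - int n)"
  proof (cases "k \<ge> 1")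
    case True
    hence "nat k = Suc (nat (k - 1))" by linarith
    thus ?thesis using True unfolding signed_choose_double by simp
  next
    case False
    thus ?thesis unfolding signed_choose_double by (cases "k = 0") auto
  qed
  thus ?thesis unfolding u(2,3) using u(1) by simp
qed

text \<open>Functions of the disjoint subfamilies indexed by \<open>J\<close> and \<open>{i}\<close>
  are independent. Measurability is automatic, because a finite product of countable discrete spaces
  is again discrete.\<close>

lemma (in prob_space) indep_var_sum_countable:
  fixes X :: "nat \<Rightarrow> 'a \<Rightarrow> 'b :: {countable, comm_monoid_add}"
  assumes "indep_vars (\<lambda>_. count_space UNIV) X I" "finite J" "J \<subseteq> I" "i \<in> I" "i \<notin> J"
  shows "indep_var (count_space UNIV) (\<lambda>\<omega>. \<Sum>j\<in>J. X j \<omega>) (count_space UNIV) (X i)"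
proof -
  have "indep_var (count_space UNIV) ((\<lambda>f. \<Sum>j\<in>J. f j) \<circ> (\<lambda>\<omega>. restrict (\<lambda>j. X j \<omega>) J))
      (count_space UNIV) ((\<lambda>f. f i) \<circ> (\<lambda>\<omega>. restrict (\<lambda>j. X j \<omega>) {i}))"
    using assms
    by (intro indep_var_compose[OF indep_var_restrict[OF assms(1)]])
       (auto simp: count_space_PiM_finite)
  also have "(\<lambda>f. \<Sum>j\<in>J. f j) \<circ> (\<lambda>\<omega>. restrict (\<lambda>j. X j \<omega>) J) = (\<lambda>\<omega>. \<Sum>j\<in>J. X j \<omega>)"
    by auto
  also have "(\<lambda>f. f i) \<circ> (\<lambda>\<omega>. restrict (\<lambda>j. X j \<omega>) {i}) = X i"
    by auto
  finally show ?thesis .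
qed

text \<open>Induction on \<open>n\<close>, conditioning on the last step. The four steps change
  \<open>(x + y, y - x)\<close> by the four sign patterns \<open>(+-1, +-1)\<close>, so the sum over
  them factors into two instances of Pascal's rule.\<close>

lemma planar_srw_prob:
  assumes "planar_srw M S"
  shows "\<P>(\<omega> in M. S n \<omega> = (x, y)) =
    (signed_choose n (x + y) / 2 ^ n) * (signed_choose n (y - x) / 2 ^ n)"
proof -
  interpret prob_space M using assms by (simp add: planar_srw_def)
  define E :: "(int \<times> int) set" where "E = {(1, 0), (-1, 0), (0, 1), (0, -1)}"
  obtain X where ind: "indep_vars (\<lambda>_. count_space UNIV) X {1..}"
    and step: "\<And>k e. k \<ge> 1 \<Longrightarrow> e \<in> E \<Longrightarrow> \<P>(\<omega> in M. X k \<omega> = e) = 1 / 4"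
    and S: "\<And>n \<omega>. \<omega> \<in> space M \<Longrightarrow> S n \<omega> = (\<Sum>k=1..n. X k \<omega>)"
    using assms unfolding planar_srw_def E_def by auto
  have X: "X k \<in> measurable M (count_space UNIV)" if "k \<ge> 1" for k
    using ind that unfolding indep_vars_def by auto
  \<comment> \<open>\<open>S n\<close> agrees with this sum only on \<open>space M\<close>;
    \<open>T\<close> has the formula everywhere.\<close>
  define T where "T n \<omega> = (\<Sum>k=1..n. X k \<omega>)" for n \<omega>
  have indT: "indep_var (count_space UNIV) (T n) (count_space UNIV) (X (Suc n))" for n
    unfolding T_def by (rule indep_var_sum_countable[OF ind]) auto
  have T: "T n \<in> measurable M (count_space UNIV)" for n
    using indep_var_rv1[OF indT] .
  have joint: "prob {\<omega> \<in> space M. T n \<omega> = z \<and> X (Suc n) \<omega> = e} =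
      prob {\<omega> \<in> space M. T n \<omega> = z} / 4" if "e \<in> E" for n z e
  proof -
    have "prob ((\<lambda>\<omega>. (T n \<omega>, X (Suc n) \<omega>)) -` ({z} \<times> {e}) \<inter> space M) =
      prob (T n -` {z} \<inter> space M) * prob (X (Suc n) -` {e} \<inter> space M)"
      by (rule indep_varD[OF indT]) auto
    moreover have "(\<lambda>\<omega>. (T n \<omega>, X (Suc n) \<omega>)) -` ({z} \<times> {e}) \<inter> space M =
        {\<omega> \<in> space M. T n \<omega> = z \<and> X (Suc n) \<omega> = e}"
      "T n -` {z} \<inter> space M = {\<omega> \<in> space M. T n \<omega> = z}"
      "X (Suc n) -` {e} \<inter> space M = {\<omega> \<in> space M. X (Suc n) \<omega> = e}" by auto
    ultimately show ?thesis using step[of "Suc n" e] that by simp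
  qed
  \<comment> \<open>The four prescribed probabilities already add up to \<open>1\<close>, so other
    values of a step have probability \<open>0\<close>.\<close>
  have full: "AE \<omega> in M. X (Suc n) \<omega> \<in> E" for n
  proof -
    have [measurable]: "{\<omega> \<in> space M. X (Suc n) \<omega> = e} \<in> events" for e
      using measurable_sets[OF X[of "Suc n"], of "{e}"] by (simp add: vimage_def Int_def conj_commute)
    have "prob (\<Union>e\<in>E. {\<omega> \<in> space M. X (Suc n) \<omega> = e}) = (\<Sum>e\<in>E. prob {\<omega> \<in> space M. X (Suc n) \<omega> = e})"
      by (rule finite_measure_finite_Union) (auto simp: E_def disjoint_family_on_def)
    also have "\<dots> = (\<Sum>e\<in>E. 1 / 4)" using step by (intro sum.cong) auto
    also have "\<dots> = 1" by (simp add: E_def)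
    finally have "AE \<omega> in M. \<omega> \<in> (\<Union>e\<in>E. {\<omega> \<in> space M. X (Suc n) \<omega> = e})"
      by (rule prob_eq_1[THEN iffD1, rotated]) (auto simp: E_def)
    thus ?thesis by eventually_elim auto
  qed
  have rec: "prob {\<omega> \<in> space M. T (Suc n) \<omega> = z} =
      (\<Sum>e\<in>E. prob {\<omega> \<in> space M. T n \<omega> = z - e}) / 4" for n z
  proof -
    have ev: "{\<omega> \<in> space M. T n \<omega> = w \<and> X (Suc n) \<omega> = e} \<in> events" for e w
    proof -
      have "{\<omega> \<in> space M. T n \<omega> = w \<and> X (Suc n) \<omega> = e} =
         (T n -` {w} \<inter> space M) \<inter> (X (Suc n) -` {e} \<inter> space M)" by auto
      thus ?thesis using measurable_sets[OF X[of "Suc n"], of "{e}"] measurable_sets[OF T[of n], of "{w}"]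
        by auto
    qed
    have evT: "{\<omega> \<in> space M. T (Suc n) \<omega> = z} \<in> events"
      using measurable_sets[OF T[of "Suc n"], of "{z}"] by (simp add: vimage_def Int_def conj_commute)
    have "prob {\<omega> \<in> space M. T (Suc n) \<omega> = z} =
        prob (\<Union>e\<in>E. {\<omega> \<in> space M. T n \<omega> = z - e \<and> X (Suc n) \<omega> = e})"
    proof (rule finite_measure_eq_AE)
      show "AE \<omega> in M. (\<omega> \<in> {\<omega> \<in> space M. T (Suc n) \<omega> = z}) =
         (\<omega> \<in> (\<Union>e\<in>E. {\<omega> \<in> space M. T n \<omega> = z - e \<and> X (Suc n) \<omega> = e}))"
        using full[of n] by eventually_elim (auto simp: T_def algebra_simps)
    qed (use ev evT in \<open>auto simp: E_def\<close>)
    also have "\<dots> = (\<Sum>e\<in>E. prob {\<omega> \<in> space M. T n \<omega> = z - e \<and> X (Suc n) \<omega> = e})"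
      using ev by (intro finite_measure_finite_Union) (auto simp: E_def disjoint_family_on_def)
    also have "\<dots> = (\<Sum>e\<in>E. prob {\<omega> \<in> space M. T n \<omega> = z - e} / 4)"
      using joint by (intro sum.cong) auto
    finally show ?thesis by (simp add: sum_divide_distrib)
  qed
  have "prob {\<omega> \<in> space M. T n \<omega> = (x, y)} =
      (signed_choose n (x + y) / 2 ^ n) * (signed_choose n (y - x) / 2 ^ n)" for x y
  proof (induction n arbitrary: x y)
    case 0
    have "{\<omega> \<in> space M. T 0 \<omega> = (x, y)} = (if x = 0 \<and> y = 0 then space M else {})"
      by (auto simp: T_def zero_prod_def)
    thus ?case by (auto simp: signed_choose_def prob_space)
  next
    case (Suc n)
    have "prob {\<omega> \<in> space M. T (Suc n) \<omega> = (x, y)} =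
      (\<Sum>e\<in>E. prob {\<omega> \<in> space M. T n \<omega> = (x - fst e, y - snd e)}) / 4"
      unfolding rec by (intro arg_cong2[where f = "(/)"] sum.cong refl) (auto simp: E_def)
    also have "\<dots> = (\<Sum>e\<in>E. (signed_choose n (x - fst e + (y - snd e)) / 2 ^ n) *
        (signed_choose n (y - snd e - (x - fst e)) / 2 ^ n)) / 4"
      unfolding Suc by simp
    \<comment> \<open>Multiplying out the two Pascal sums on the right gives exactly the four
      summands; \<open>4 = 2 * 2\<close> supplies one factor \<open>1/2\<close> to each.\<close>
    also have "\<dots> = (signed_choose (Suc n) (x + y) / 2 ^ Suc n) * (signed_choose (Suc n) (y - x) / 2 ^ Suc n)"
      unfolding signed_choose_Suc E_def by (simp add: field_simps)
    finally show ?case .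
  qed
  moreover have "{\<omega> \<in> space M. S n \<omega> = (x, y)} = {\<omega> \<in> space M. T n \<omega> = (x, y)}"
    using S by (auto simp: T_def)
  ultimately show ?thesis by simp
qed

section \<open>Splitting the binomial weight into exponential and prefactor\<close>

definition log_factor :: "nat \<Rightarrow> int \<Rightarrow> real" where
  "log_factor n u = ln (stirling_quot n) - ln (stirling_quot (nat ((int n + u) div 2)))
     - ln (stirling_quot (nat ((int n - u) div 2)))"

definition walk_prefactor :: "int \<Rightarrow> int \<Rightarrow> nat \<Rightarrow> real" where
  "walk_prefactor x y n = exp (log_factor n (x + y) + log_factor n (y - x))"

lemma log_factor_minus: "log_factor n (- u) = log_factor n u"
  by (simp add: log_factor_def)

lemma log_factor_minus_diff: "log_factor n (a - b) = log_factor n (b - a)"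
  using log_factor_minus[of n "a - b"] by simp

lemma walk_prefactor_symmetric:
  "walk_prefactor (- x) y n = walk_prefactor x y n"
  "walk_prefactor x (- y) n = walk_prefactor x y n"
  "walk_prefactor y x n = walk_prefactor x y n"
proof -
  show "walk_prefactor (- x) y n = walk_prefactor x y n"
    by (simp add: walk_prefactor_def add.commute)
  show "walk_prefactor x (- y) n = walk_prefactor x y n"
    using log_factor_minus[of n "y + x"] log_factor_minus_diff[of n x y]
    by (simp add: walk_prefactor_def add.commute[of x y] add.commute[of "log_factor n (y - x)"])
  show "walk_prefactor y x n = walk_prefactor x y n"
    using log_factor_minus_diff[of n x y] by (simp add: walk_prefactor_def add.commute)
qed

text \<open>The case \<open>k = 0\<close>, \<open>a = 0\<close> is included on purpose: it occurs at
  \<open>u = n\<close> and \<open>u = -n\<close>, where both sides are \<open>1\<close>.\<close>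

lemma exp_real_mult_ln: "(k > 0 \<Longrightarrow> a > 0) \<Longrightarrow> exp (real k * ln a) = a ^ k"
  by (cases "k = 0") (simp_all add: exp_of_nat_mult)

text \<open>With \<open>n = k + m\<close> and \<open>u = k - m\<close>, the entropy term
  exponentiates to \<open>2^n k^k m^m / n^n\<close>, which is what separates
  \<open>n!/(k! m!)\<close> from the quotient of the \<open>stirling_quot\<close>s; the powers of
  \<open>e\<close> cancel because \<open>k + m = n\<close>.\<close>

lemma signed_choose_eq_exp_log_factor:
  assumes "n \<ge> 1" "even (u + int n)" "\<bar>u\<bar> \<le> int n"
  shows "signed_choose n u / 2 ^ n =
    exp (log_factor n u) * exp (- real n * binary_entropy_defect (real_of_int u / real n))"
proof -
  define k where "k = nat ((int n + u) div 2)"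
  define m where "m = nat ((int n - u) div 2)"
  have km: "int k + int m = int n" "u = int k - int m"
  proof -
    have "2 * ((int n + u) div 2) = int n + u" "2 * ((int n - u) div 2) = int n - u"
      using assms(2) by (auto simp: add.commute)
    moreover have "int k = (int n + u) div 2" "int m = (int n - u) div 2"
      using assms(3) by (auto simp: k_def m_def)
    ultimately show "int k + int m = int n" "u = int k - int m" by linarith+
  qed
  have n: "n = k + m" using km by linarith
  have pn: "real n > 0" using assms by simp
  have a: "1 + real_of_int u / real n = 2 * real k / real n" "1 - real_of_int u / real n = 2 * real m / real n"
    using pn by (simp_all add: km n field_simps)
  have "real n * binary_entropy_defect (real_of_int u / real n) =
     real k * ln (2 * real k / real n) + real m * ln (2 * real m / real n)"
    unfolding binary_entropy_defect_def a using pn by (simp add: field_simps)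
  hence "exp (real n * binary_entropy_defect (real_of_int u / real n)) =
     (2 * real k / real n) ^ k * (2 * real m / real n) ^ m"
    using pn by (simp add: exp_add exp_real_mult_ln)
  also have "\<dots> = 2 ^ n * (real k ^ k * real m ^ m) / real n ^ n"
    by (simp add: n power_add power_divide power_mult_distrib)
  finally have H: "exp (real n * binary_entropy_defect (real_of_int u / real n)) =
    2 ^ n * (real k ^ k * real m ^ m) / real n ^ n" .
  have L: "exp (log_factor n u) = stirling_quot n / stirling_quot k / stirling_quot m"
    unfolding log_factor_def k_def[symmetric] m_def[symmetric]
    by (simp add: exp_diff stirling_quot_pos)
  have "signed_choose n u = real (n choose k)"
    using assms by (simp add: signed_choose_def k_def)
  hence C: "signed_choose n u = fact n / (fact k * fact m)"
    using binomial_fact[of k n, where 'a = real] by (simp add: n)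
  \<comment> \<open>Also true for \<open>k = 0\<close> or \<open>m = 0\<close>, by
    \<open>0 ^ 0 = 1\<close>.\<close>
  have nz: "real k ^ k \<noteq> 0" "real m ^ m \<noteq> 0" "real n ^ n \<noteq> 0" using pn by (cases k; cases m; simp)+
  have "exp (log_factor n u) = signed_choose n u / 2 ^ n * exp (real n * binary_entropy_defect (real_of_int u / real n))"
    unfolding H L C stirling_quot_def using nz
    by (simp add: n exp_add field_simps)
  thus ?thesis by (simp add: exp_minus field_simps)
qed

lemma planar_srw_prob_reachable:
  assumes "planar_srw M S" "n \<ge> 1" "reachable n x y"
  shows "\<P>(\<omega> in M. S n \<omega> = (x, y)) = walk_prefactor x y n * exp (- walk_exponent n x y)"
proof -
  have "even (x + y + int n)" "even (y - x + int n)" "\<bar>x + y\<bar> \<le> int n" "\<bar>y - x\<bar> \<le> int n"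
    using assms(3) unfolding reachable_def by (auto simp: abs_if split: if_splits)
  note e = signed_choose_eq_exp_log_factor[OF assms(2) this(1,3)]
    signed_choose_eq_exp_log_factor[OF assms(2) this(2,4)]
  show ?thesis
    unfolding planar_srw_prob[OF assms(1)] walk_exponent_eq[OF assms(2,3)] walk_prefactor_def e
      exp_add[symmetric] by (simp add: algebra_simps)
qed

subsection \<open>Logarithmic approximation of the binomial factors\<close>

lemma log_factor_split:
  "log_factor (k + m) (int k - int m) =
     ln (stirling_quot (k + m)) - ln (stirling_quot k) - ln (stirling_quot m)"
proof -
  have "int (k + m) + (int k - int m) = 2 * int k" "int (k + m) - (int k - int m) = 2 * int m"
    by linarith+
  thus ?thesis by (simp only: log_factor_def) simp
qed

lemma even_abs_le_split:
  assumes "even (u + int n)" "\<bar>u\<bar> \<le> int n"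
  obtains k m where "n = k + m" "u = int k - int m"
proof
  have "2 * ((int n + u) div 2) = int n + u" "2 * ((int n - u) div 2) = int n - u"
    using assms(1) by (auto simp: add.commute)
  moreover have "int (nat ((int n + u) div 2)) = (int n + u) div 2"
    "int (nat ((int n - u) div 2)) = (int n - u) div 2"
    using assms(2) by auto
  ultimately show "n = nat ((int n + u) div 2) + nat ((int n - u) div 2)"
    "u = int (nat ((int n + u) div 2)) - int (nat ((int n - u) div 2))" by linarith+
qed

text \<open>The Lipschitz bound for \<open>ln\<close> on \<open>[c, oo)\<close>, from
  \<open>ln t \<le> t - 1\<close> at \<open>t = a/b\<close> and \<open>t = b/a\<close>.\<close>

lemma ln_diff_le:
  fixes a b c :: real
  assumes "c > 0" "c \<le> a" "c \<le> b"
  shows "\<bar>ln a - ln b\<bar> \<le> \<bar>a - b\<bar> / c"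
proof -
  have *: "ln a - ln b \<le> \<bar>a - b\<bar> / c" if "c \<le> a" "c \<le> b" for a b
  proof -
    have "ln a - ln b = ln (a / b)" using assms(1) that by (simp add: ln_div)
    also have "\<dots> \<le> a / b - 1" using assms(1) that by (intro ln_le_minus_one) auto
    also have "\<dots> = (a - b) / b" using assms(1) that by (simp add: field_simps)
    also have "\<dots> \<le> \<bar>a - b\<bar> / b" using assms(1) that by (intro divide_right_mono) auto
    also have "\<dots> \<le> \<bar>a - b\<bar> / c" using assms(1) that by (intro divide_left_mono) auto
    finally show ?thesis .
  qed
  show ?thesis using *[of a b] *[of b a] assms by (simp add: abs_minus_commute abs_le_iff)
qed

text \<open>Every regime of the theorem approximates a factor by the square root of an explicit quantity;
  on the logarithmic scale the errors of the two factors simply add up.\<close>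
definition factor_approx :: "nat \<Rightarrow> int \<Rightarrow> real \<Rightarrow> real \<Rightarrow> bool" where
  "factor_approx n u a \<delta> \<longleftrightarrow> a > 0 \<and> \<bar>log_factor n u - ln a / 2\<bar> \<le> \<delta>"

lemma factor_approx_mono: "factor_approx n u a \<delta> \<Longrightarrow> \<delta> \<le> \<delta>' \<Longrightarrow> factor_approx n u a \<delta>'"
  unfolding factor_approx_def by linarith

text \<open>For \<open>U = u/n\<close> one has \<open>k m = n^2 (1 - U^2)/4\<close>, so Stirling's
  formula turns the factor into the square root of \<open>2/(pi n (1 - U^2))\<close>. Replacing
  \<open>U^2\<close> by \<open>\<alpha>^2\<close> costs a Lipschitz error of \<open>ln\<close>. The
  bound keeps the difference of squares, so that \<open>\<alpha> = 0\<close> gives a quadratic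
  error.\<close>

lemma factor_approx_center:
  assumes "even (u + int n)" "n \<ge> 1" "0 \<le> \<beta>" "\<beta> < 1"
    and u: "\<bar>real_of_int u\<bar> \<le> \<beta> * real n" and \<alpha>: "\<bar>\<alpha>\<bar> \<le> \<beta>"
  shows "factor_approx n u (2 / (pi * real n * (1 - \<alpha>\<^sup>2)))
    ((\<bar>(real_of_int u / real n)\<^sup>2 - \<alpha>\<^sup>2\<bar> + 1 / real n) / (1 - \<beta>))"
proof -
  define U where "U = real_of_int u / real n"
  have N: "real n \<ge> 1" using assms(2) by simp
  have "\<beta> * real n \<le> 1 * real n" using assms N by (intro mult_right_mono) auto
  hence "\<bar>u\<bar> \<le> int n" using u by linarith
  with assms(1) obtain k m where km: "n = k + m" "u = int k - int m"
    using even_abs_le_split by blast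
  have kU: "real k = real n * (1 + U) / 2" "real m = real n * (1 - U) / 2"
    using N by (simp_all add: U_def km field_simps)
  have U: "\<bar>U\<bar> \<le> \<beta>" using u N by (simp add: U_def abs_divide field_simps)
  have kge: "real k \<ge> real n * (1 - \<beta>) / 2" "real m \<ge> real n * (1 - \<beta>) / 2"
    unfolding kU using U N by (auto intro!: divide_right_mono mult_left_mono)
  have pos: "real n * (1 - \<beta>) / 2 > 0" using N assms by simp
  have k1: "k \<ge> 1" "m \<ge> 1" using kge pos by (cases k; cases m; simp)+
  \<comment> \<open>Since \<open>k\<close> and \<open>m\<close> are at least
    \<open>n (1 - \<beta>)/2\<close>, their Stirling errors are at most \<open>r/6\<close> each, and
    the one of \<open>n\<close> is at most \<open>r/12\<close>.\<close>
  define r where "r = 1 / real n / (1 - \<beta>)"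
  have "1 / (12 * real k) \<le> 1 / (12 * (real n * (1 - \<beta>) / 2))"
    "1 / (12 * real m) \<le> 1 / (12 * (real n * (1 - \<beta>) / 2))"
    using kge pos by (intro divide_left_mono; simp)+
  moreover have "1 / (12 * (real n * (1 - \<beta>) / 2)) = r / 6"
    using N by (simp add: r_def)
  moreover have "1 / (12 * real n) \<le> r / 12"
    using assms N by (simp add: r_def field_simps)
  moreover have "0 \<le> r" using assms by (simp add: r_def)
  ultimately have "\<bar>stirling_err n - stirling_err k - stirling_err m\<bar> \<le> r"
    using stirling_err_bounds[OF k1(1)] stirling_err_bounds[OF k1(2)] stirling_err_bounds[OF assms(2)]
    by linarith
  hence err: "\<bar>stirling_err n - stirling_err k - stirling_err m\<bar> \<le> 1 / real n / (1 - \<beta>)"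
    by (simp add: r_def)
  have sq: "U\<^sup>2 \<le> \<beta>\<^sup>2" "\<alpha>\<^sup>2 \<le> \<beta>\<^sup>2" using U \<alpha> assms(3) by (simp_all add: abs_le_square_iff[symmetric])
  \<comment> \<open>Bounds \<open>1 - U^2\<close> and \<open>1 - \<alpha>^2\<close> below by
    \<open>1 - \<beta>\<close>, so that both error sources share one denominator.\<close>
  have b2: "\<beta>\<^sup>2 \<le> \<beta>" using assms by (simp add: power2_eq_square mult_left_le_one_le)
  have lnd: "\<bar>ln (1 - U\<^sup>2) - ln (1 - \<alpha>\<^sup>2)\<bar> \<le> \<bar>U\<^sup>2 - \<alpha>\<^sup>2\<bar> / (1 - \<beta>)"
    using ln_diff_le[of "1 - \<beta>" "1 - U\<^sup>2" "1 - \<alpha>\<^sup>2"] sq b2 assms by (simp add: abs_minus_commute)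
  have p: "1 - U\<^sup>2 > 0" "1 - \<alpha>\<^sup>2 > 0" using sq b2 assms by linarith+
  have "real k * real m = (real n)\<^sup>2 * (1 - U\<^sup>2) / 4"
    unfolding kU by (simp add: power2_eq_square algebra_simps)
  hence "ln (real k * real m) = ln ((real n)\<^sup>2 * (1 - U\<^sup>2) / 4)" by (rule arg_cong)
  hence "ln (real k) + ln (real m) = ln ((real n)\<^sup>2 * (1 - U\<^sup>2) / 4)"
    using k1 by (simp add: ln_mult)
  also have "\<dots> = 2 * ln (real n) + ln (1 - U\<^sup>2) - ln 4"
    using p N by (simp add: ln_mult ln_div ln_realpow)
  finally have lkm: "ln (real k) + ln (real m) = 2 * ln (real n) + ln (1 - U\<^sup>2) - ln 4" .
  have l4: "ln (4::real) = 2 * ln 2" using ln_realpow[of 2 2] by simp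
  have e: "ln (2 * pi * real j) = ln 2 + ln pi + ln (real j)" if "j \<ge> 1" for j :: nat
    using that by (simp add: ln_mult)
  have "ln (2 / (pi * real n * (1 - \<alpha>\<^sup>2))) = ln 2 - (ln pi + ln (real n) + ln (1 - \<alpha>\<^sup>2))"
    using p N by (simp add: ln_div ln_mult)
  hence "log_factor n u - ln (2 / (pi * real n * (1 - \<alpha>\<^sup>2))) / 2 =
      (stirling_err n - stirling_err k - stirling_err m) - (ln (1 - U\<^sup>2) - ln (1 - \<alpha>\<^sup>2)) / 2"
    using log_factor_split[of k m] lkm l4 e[OF k1(1)] e[OF k1(2)] e[OF assms(2)]
    unfolding km[symmetric] ln_stirling_quot_eq by (simp add: field_simps)
  moreover have "\<bar>E - A / 2\<bar> \<le> b + a" if "\<bar>E\<bar> \<le> b" "\<bar>A\<bar> \<le> a" for A E a b :: real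
    using that by linarith
  note this[OF err lnd]
  ultimately have "\<bar>log_factor n u - ln (2 / (pi * real n * (1 - \<alpha>\<^sup>2))) / 2\<bar> \<le>
      1 / real n / (1 - \<beta>) + \<bar>U\<^sup>2 - \<alpha>\<^sup>2\<bar> / (1 - \<beta>)"
    by simp
  also have "\<dots> = (\<bar>U\<^sup>2 - \<alpha>\<^sup>2\<bar> + 1 / real n) / (1 - \<beta>)" by (simp add: add_divide_distrib)
  finally show ?thesis using p N unfolding factor_approx_def U_def by simp
qed

lemma factor_approx_origin:
  assumes "even (u + int n)" "n \<ge> 1" "\<bar>real_of_int u\<bar> \<le> real n / 2"
  shows "factor_approx n u (2 / (pi * real n)) (2 * ((real_of_int u / real n)\<^sup>2 + 1 / real n))"
  using factor_approx_center[of u n "1/2" 0] assms by (simp add: mult.commute)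

text \<open>The linear form of the previous estimate:
  \<open>U^2 - \<alpha>^2 = (U + \<alpha>)(U - \<alpha>)\<close> with
  \<open>|U + \<alpha>| \<le> 2\<close>.\<close>

lemma factor_approx_bulk:
  assumes "even (u + int n)" "n \<ge> 1" "0 \<le> \<beta>" "\<beta> < 1"
    and u: "\<bar>real_of_int u\<bar> \<le> \<beta> * real n" and \<alpha>: "\<bar>\<alpha>\<bar> \<le> \<beta>"
  shows "factor_approx n u (2 / (pi * real n * (1 - \<alpha>\<^sup>2)))
    (2 / (1 - \<beta>) * (\<bar>real_of_int u - \<alpha> * real n\<bar> / real n + 1 / real n))"
proof (rule factor_approx_mono[OF factor_approx_center[OF assms]])
  define U where "U = real_of_int u / real n"
  have N: "real n \<ge> 1" using assms(2) by simp
  have U: "\<bar>U\<bar> \<le> \<beta>" using u N by (simp add: U_def abs_divide field_simps)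
  have "U\<^sup>2 - \<alpha>\<^sup>2 = (U + \<alpha>) * (U - \<alpha>)" by (simp add: power2_eq_square algebra_simps)
  hence "\<bar>U\<^sup>2 - \<alpha>\<^sup>2\<bar> = \<bar>U + \<alpha>\<bar> * \<bar>U - \<alpha>\<bar>" by (simp add: abs_mult)
  also have "\<dots> \<le> 2 * \<bar>U - \<alpha>\<bar>" using U \<alpha> assms by (intro mult_right_mono) auto
  also have "\<bar>U - \<alpha>\<bar> = \<bar>real_of_int u - \<alpha> * real n\<bar> / real n"
  proof -
    have "U - \<alpha> = (real_of_int u - \<alpha> * real n) / real n" using N by (simp add: U_def field_simps)
    thus ?thesis by (simp add: abs_divide)
  qed
  finally have "\<bar>U\<^sup>2 - \<alpha>\<^sup>2\<bar> + 1 / real n \<le>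
      2 * (\<bar>real_of_int u - \<alpha> * real n\<bar> / real n + 1 / real n)"
    unfolding distrib_left by (rule add_mono) (use N in \<open>simp add: divide_right_mono\<close>)
  hence "(\<bar>U\<^sup>2 - \<alpha>\<^sup>2\<bar> + 1 / real n) / (1 - \<beta>) \<le>
      2 * (\<bar>real_of_int u - \<alpha> * real n\<bar> / real n + 1 / real n) / (1 - \<beta>)"
    using assms by (intro divide_right_mono) auto
  thus "(\<bar>(real_of_int u / real n)\<^sup>2 - \<alpha>\<^sup>2\<bar> + 1 / real n) / (1 - \<beta>) \<le>
      2 / (1 - \<beta>) * (\<bar>real_of_int u - \<alpha> * real n\<bar> / real n + 1 / real n)"
    by (simp add: U_def)
qed

text \<open>Here \<open>k = n - m\<close> is at least \<open>n/2\<close>, so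
  \<open>stirling_quot n\<close> and \<open>stirling_quot k\<close> differ by a factor
  \<open>1 + O(m/n)\<close>, and only the factor at \<open>m\<close> is left. As
  \<open>m \<ge> 1\<close>, the Stirling errors of order \<open>1/n\<close> are absorbed by
  \<open>m/n\<close>. Nothing is assumed on the size of \<open>m\<close> beyond this, so the bound
  serves growing and constant \<open>m\<close> alike.\<close>

lemma log_factor_edge:
  assumes "m \<ge> 1" "2 * m \<le> n"
  shows "\<bar>log_factor n (int n - 2 * int m) + ln (stirling_quot m)\<bar> \<le> 2 * real m / real n"
proof -
  define k where "k = n - m"
  have n: "n = k + m" and k1: "k \<ge> 1" "n \<ge> 1" using assms by (auto simp: k_def)
  have kn: "2 * real k \<ge> real n" "real m \<ge> 1" using assms by (auto simp: k_def)
  have "\<bar>ln (real n) - ln (real k)\<bar> \<le> \<bar>real n - real k\<bar> / real k"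
    using k1 n by (intro ln_diff_le) auto
  also have "\<dots> = real m / real k" by (simp add: n)
  also have "\<dots> \<le> real m / (real n / 2)"
    using kn k1 by (intro divide_left_mono) auto
  finally have a: "\<bar>ln (real n) - ln (real k)\<bar> \<le> 2 * (real m / real n)" by (simp add: mult.commute)
  define r where "r = 1 / real n"
  have "1 / (12 * real k) \<le> 1 / (12 * (real n / 2))"
    using kn k1 by (intro divide_left_mono) auto
  hence "1 / (12 * real k) \<le> r / 6" by (simp add: r_def)
  moreover have "r \<le> real m / real n" unfolding r_def using kn by (intro divide_right_mono) auto
  moreover have "1 / (12 * real n) = r / 12" "0 \<le> r" by (simp_all add: r_def)
  ultimately have err: "\<bar>stirling_err n - stirling_err k\<bar> \<le> real m / real n"
    using stirling_err_bounds[OF k1(1)] stirling_err_bounds[OF k1(2)] by linarith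
  have f: "ln (2 * pi * real j) = ln (2 * pi) + ln (real j)" if "j \<ge> 1" for j :: nat
    using that by (simp add: ln_mult)
  have "int n - 2 * int m = int k - int m" by (simp add: n)
  hence "log_factor n (int n - 2 * int m) + ln (stirling_quot m) =
     (ln (real n) - ln (real k)) / 2 + (stirling_err n - stirling_err k)"
    using log_factor_split[of k m] f[OF k1(1)] f[OF k1(2)] unfolding n[symmetric]
    by (simp add: ln_stirling_quot_eq[of n] ln_stirling_quot_eq[of k] field_simps)
  moreover have "\<bar>A / 2 + E\<bar> \<le> 2 * \<rho>" if "\<bar>A\<bar> \<le> 2 * \<rho>" "\<bar>E\<bar> \<le> \<rho>" for A E \<rho> :: real
    using that by linarith
  from this[OF a err] have "\<bar>(ln (real n) - ln (real k)) / 2 + (stirling_err n - stirling_err k)\<bar> \<le>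
      2 * real m / real n" by simp
  ultimately show ?thesis by simp
qed

text \<open>Parity and positivity force the real number \<open>w\<close> to be an even integer
  \<open>2m\<close> with \<open>m \<ge> 1\<close>; \<open>u \<ge> 0\<close> means
  \<open>2m \<le> n\<close>.\<close>

lemma edge_split:
  assumes "even (u + int n)" "0 \<le> u" "real_of_int u = real n - w" "w > 0"
  obtains m where "m \<ge> 1" "2 * m \<le> n" "u = int n - 2 * int m" "w = 2 * real m"
proof
  define m where "m = nat ((int n - u) div 2)"
  have un: "u < int n" using assms by linarith
  have "2 * ((int n - u) div 2) = int n - u" using assms(1) by (auto simp: add.commute)
  moreover have "int m = (int n - u) div 2" using un by (auto simp: m_def)
  ultimately have m: "2 * int m = int n - u" by linarith
  show "m \<ge> 1" "2 * m \<le> n" "u = int n - 2 * int m" using m un assms by linarith+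
  have "2 * real m = real_of_int (2 * int m)" by simp
  also have "\<dots> = real n - real_of_int u" unfolding m by simp
  finally show "w = 2 * real m" using assms by simp
qed

text \<open>\<open>stirling_quot m\<close> is \<open>sqrt (2 pi m) = sqrt (pi w)\<close> up to a
  logarithmic error \<open>1/(12 m) = 1/(6 w)\<close>.\<close>

lemma factor_approx_edge:
  assumes "even (u + int n)" "0 \<le> u" "real_of_int u = real n - w" "w > 0"
  shows "factor_approx n u (1 / (pi * w)) (w / real n + 1 / (6 * w))"
proof -
  obtain m where m: "m \<ge> 1" "2 * m \<le> n" "u = int n - 2 * int m" "w = 2 * real m"
    using edge_split[OF assms] .
  have "ln (stirling_quot m) = - (ln (1 / (pi * w)) / 2) + stirling_err m"
    using m(1) by (simp add: ln_stirling_quot_eq m ln_div ln_mult field_simps)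
  moreover have "1 / (12 * real m) = 1 / (6 * w)" by (simp add: m)
  ultimately have "\<bar>log_factor n u - ln (1 / (pi * w)) / 2\<bar> \<le> w / real n + 1 / (6 * w)"
    using log_factor_edge[OF m(1,2)] stirling_err_bounds[OF m(1)] unfolding m(3) m(4)[symmetric]
    by linarith
  thus ?thesis using assms by (simp add: factor_approx_def)
qed

text \<open>Only even integers \<open>w \<ge> 2\<close> occur as the distance \<open>n - u\<close>; for other \<open>w\<close> the regimes are void
  and any element of the admissible range will do.\<close>
definition edge_const :: "real \<Rightarrow> real" where
  "edge_const w = stirling_defect (max 1 (nat \<lfloor>w / 2\<rfloor>))"

lemma edge_const_in_range: "edge_const w \<in> stirling_range"
  unfolding edge_const_def by (rule stirling_defect_in_range) simp

lemma edge_const_mean_in_range: "sqrt (edge_const v * edge_const w) \<in> stirling_range"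
  unfolding edge_const_def by (rule stirling_defect_mean_in_range) simp_all

lemma edge_const_pos: "edge_const w > 0"
  by (simp add: edge_const_def stirling_defect_def)

text \<open>For constant \<open>w\<close> the error \<open>1/(6 w)\<close> would not vanish. The
  value of \<open>stirling_quot m\<close> is therefore kept exactly, in the form of
  \<open>edge_const\<close> and the exponential, and only the error \<open>w/n\<close> of
  \<open>log_factor_edge\<close> remains.\<close>

lemma factor_approx_const_edge:
  assumes "even (u + int n)" "0 \<le> u" "real_of_int u = real n - w" "w > 0"
  shows "factor_approx n u ((edge_const w * exp (- 1 / (6 * w)))\<^sup>2 / (pi * w)) (w / real n)"
proof -
  obtain m where m: "m \<ge> 1" "2 * m \<le> n" "u = int n - 2 * int m" "w = 2 * real m"
    using edge_split[OF assms] .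
  have d: "edge_const w = stirling_defect m" using m by (simp add: edge_const_def max_def)
  have dp: "stirling_defect m > 0" by (simp add: stirling_defect_def)
  have "ln ((edge_const w * exp (- 1 / (6 * w)))\<^sup>2 / (pi * w)) / 2 =
      ln (stirling_defect m) - 1 / (6 * w) - ln (pi * w) / 2"
    using dp assms(4) by (simp add: d ln_div ln_mult ln_realpow field_simps)
  also have "\<dots> = - ln (stirling_quot m)"
    unfolding ln_stirling_quot_defect m(4) by (simp add: mult_ac)
  finally show ?thesis
    using log_factor_edge[OF m(1,2)] assms(4) edge_const_pos[of w]
    unfolding m(3) m(4)[symmetric] factor_approx_def by simp
qed

text \<open>At \<open>m = 0\<close> the quotient is exactly \<open>1\<close> because
  \<open>stirling_quot 0 = 1\<close>; the boundary contributes no error.\<close>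

lemma log_factor_full: "log_factor n (int n) = 0"
  by (simp add: log_factor_def)

lemma factor_approx_full: "factor_approx n (int n) 1 0"
  by (simp add: factor_approx_def log_factor_full)

section \<open>From logarithmic to relative errors\<close>

lemma abs_exp_minus_1_le: "\<bar>exp t - 1\<bar> \<le> \<bar>t\<bar> * exp \<bar>t\<bar>" for t :: real
proof -
  have "exp t * (1 - t) \<le> exp t * exp (- t)"
    using exp_ge_add_one_self[of "- t"] by (intro mult_left_mono) auto
  hence "exp t - 1 \<le> t * exp t" by (simp add: algebra_simps flip: exp_add)
  also have "\<dots> \<le> \<bar>t\<bar> * exp \<bar>t\<bar>" by (intro mult_mono) auto
  finally have "exp t - 1 \<le> \<bar>t\<bar> * exp \<bar>t\<bar>" .
  moreover have "- (exp t - 1) \<le> \<bar>t\<bar> * exp \<bar>t\<bar>"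
  proof -
    have "- (exp t - 1) \<le> \<bar>t\<bar> * 1" using exp_ge_add_one_self[of t] by linarith
    also have "\<dots> \<le> \<bar>t\<bar> * exp \<bar>t\<bar>" by (intro mult_left_mono) auto
    finally show ?thesis .
  qed
  ultimately show ?thesis by linarith
qed

text \<open>An a priori bound \<open>B\<close> on the error quantity is what makes the constant
  \<open>K * exp (K * B)\<close> independent of \<open>n\<close>; each regime supplies its own
  \<open>B\<close>.\<close>

lemma relative_error_of_exp:
  fixes t K q B :: real
  assumes "\<bar>t\<bar> \<le> K * q" "0 \<le> K" "0 \<le> q" "q \<le> B"
  shows "\<bar>exp t - 1\<bar> \<le> K * exp (K * B) * q"
proof -
  have "K * q \<le> K * B" using assms by (intro mult_left_mono) auto
  have "\<bar>t\<bar> * exp \<bar>t\<bar> \<le> (K * q) * exp (K * B)"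
    using assms \<open>K * q \<le> K * B\<close> by (intro mult_mono) auto
  thus ?thesis using abs_exp_minus_1_le[of t] by (simp add: algebra_simps)
qed

text \<open>\<open>F\<close> is the product of the two square roots that approximate the factors,
  written without roots as \<open>F^2 = a b\<close>.\<close>

lemma walk_prefactor_relative_error:
  assumes "factor_approx n (x + y) a \<delta>" "factor_approx n (y - x) b \<delta>'" "\<delta> + \<delta>' \<le> K * q"
    and "0 \<le> K" "0 \<le> q" "q \<le> B" "F > 0" "F\<^sup>2 = a * b"
  shows "\<exists>e. \<bar>e\<bar> \<le> K * exp (K * B) * \<bar>q\<bar> \<and> walk_prefactor x y n = F * (1 + e)"
proof -
  have "2 * ln F = ln a + ln b"
    using assms ln_realpow[of F 2] by (simp add: factor_approx_def ln_mult)
  hence t: "\<bar>log_factor n (x + y) + log_factor n (y - x) - ln F\<bar> \<le> K * q" (is "\<bar>?t\<bar> \<le> _")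
    using assms unfolding factor_approx_def by linarith
  have "walk_prefactor x y n = F * exp ?t"
    using \<open>F > 0\<close> by (simp add: walk_prefactor_def exp_diff)
  thus ?thesis
    using relative_error_of_exp[OF t assms(4,5,6)] assms(5) by (intro exI[of _ "exp ?t - 1"]) simp
qed

lemma abs_le_add_split:
  fixes e a b :: real
  assumes "\<bar>e\<bar> \<le> a + b" "0 \<le> a" "0 \<le> b"
  obtains e1 e2 where "e = e1 + e2" "\<bar>e1\<bar> \<le> a" "\<bar>e2\<bar> \<le> b"
proof
  \<comment> \<open>Clamping \<open>e\<close> to \<open>[-a, a]\<close> leaves a remainder of size
    at most \<open>b\<close>.\<close>
  define e1 where "e1 = max (- a) (min a e)"
  show "e = e1 + (e - e1)" "\<bar>e1\<bar> \<le> a" "\<bar>e - e1\<bar> \<le> b" using assms unfolding e1_def by linarith+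
qed

text \<open>For the regimes whose error consists of two separate \<open>O\<close> terms: a single
  error bounded by their sum is split between them.\<close>

lemma walk_prefactor_relative_error2:
  assumes "factor_approx n (x + y) a \<delta>" "factor_approx n (y - x) b \<delta>'" "\<delta> + \<delta>' \<le> K * (\<bar>q1\<bar> + \<bar>q2\<bar>)"
    and "0 \<le> K" "\<bar>q1\<bar> + \<bar>q2\<bar> \<le> B" "F > 0" "F\<^sup>2 = a * b"
  shows "\<exists>e1 e2. \<bar>e1\<bar> \<le> K * exp (K * B) * \<bar>q1\<bar> \<and> \<bar>e2\<bar> \<le> K * exp (K * B) * \<bar>q2\<bar> \<and>
    walk_prefactor x y n = F * (1 + e1 + e2)"
proof -
  obtain e where e: "\<bar>e\<bar> \<le> K * exp (K * B) * \<bar>\<bar>q1\<bar> + \<bar>q2\<bar>\<bar>" "walk_prefactor x y n = F * (1 + e)"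
    using walk_prefactor_relative_error[OF assms(1,2,3,4) _ assms(5,6,7)] by auto
  have "\<bar>e\<bar> \<le> K * exp (K * B) * \<bar>q1\<bar> + K * exp (K * B) * \<bar>q2\<bar>"
    using e(1) by (simp add: algebra_simps)
  then obtain e1 e2 where "e = e1 + e2" "\<bar>e1\<bar> \<le> K * exp (K * B) * \<bar>q1\<bar>" "\<bar>e2\<bar> \<le> K * exp (K * B) * \<bar>q2\<bar>"
    using abs_le_add_split[of e "K * exp (K * B) * \<bar>q1\<bar>" "K * exp (K * B) * \<bar>q2\<bar>"] assms(4)
    by (metis abs_ge_zero exp_ge_zero mult_nonneg_nonneg)
  thus ?thesis using e(2) by (auto simp: add.assoc)
qed

subsection \<open>The regimes of the prefactor\<close>

lemma smallo_real_le:
  fixes l :: "nat \<Rightarrow> real"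
  assumes "l \<in> o(\<lambda>n. real n)" "\<epsilon> > 0"
  shows "\<forall>\<^sub>F n in sequentially. \<bar>l n\<bar> \<le> \<epsilon> * real n"
  using landau_o.smallD[OF assms] by simp

lemma reachable_even:
  assumes "reachable n x y"
  shows "even (x + y + int n)" "even (y - x + int n)"
  using assms by (auto simp: reachable_def)

lemma real_square_le: "\<bar>a\<bar> \<le> b \<Longrightarrow> a\<^sup>2 \<le> b\<^sup>2" for a b :: real
  by (simp add: abs_le_square_iff[symmetric])

section \<open>Both factors in the bulk\<close>

text \<open>The identity \<open>(x + y)^2 + (y - x)^2 = 2 (x^2 + y^2)\<close> turns the two
  quadratic errors into the stated one. The bound is not asymptotic, so it also feeds the local
  limit statements.\<close>

lemma walk_prefactor_origin:
  assumes "n \<ge> 1" "even (x + y + int n)" "\<bar>real_of_int x\<bar> + \<bar>real_of_int y\<bar> \<le> real n / 2"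
  shows "\<exists>e. \<bar>e\<bar> \<le> 4 * exp (4 * 3) *
           \<bar>(real n + (real_of_int x)\<^sup>2 + (real_of_int y)\<^sup>2) / (real n)\<^sup>2\<bar> \<and>
         walk_prefactor x y n = 2 / (pi * real n) * (1 + e)"
proof (rule walk_prefactor_relative_error)
  have N: "real n \<ge> 1" using assms by simp
  show "factor_approx n (x + y) (2 / (pi * real n)) (2 * ((real_of_int (x + y) / real n)\<^sup>2 + 1 / real n))"
    "factor_approx n (y - x) (2 / (pi * real n)) (2 * ((real_of_int (y - x) / real n)\<^sup>2 + 1 / real n))"
  proof -
    have "even (y - x + int n)" using assms(2) by auto
    moreover have "\<bar>real_of_int (x + y)\<bar> \<le> real n / 2" "\<bar>real_of_int (y - x)\<bar> \<le> real n / 2"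
      using assms(3) by linarith+
    ultimately show "factor_approx n (x + y) (2 / (pi * real n)) (2 * ((real_of_int (x + y) / real n)\<^sup>2 + 1 / real n))"
      "factor_approx n (y - x) (2 / (pi * real n)) (2 * ((real_of_int (y - x) / real n)\<^sup>2 + 1 / real n))"
      using factor_approx_origin assms(1,2) by blast+
  qed
  show "2 * ((real_of_int (x + y) / real n)\<^sup>2 + 1 / real n) + 2 * ((real_of_int (y - x) / real n)\<^sup>2 + 1 / real n)
    \<le> 4 * ((real n + (real_of_int x)\<^sup>2 + (real_of_int y)\<^sup>2) / (real n)\<^sup>2)"
    using N by (simp add: field_simps power2_eq_square)
  have "(real_of_int x)\<^sup>2 \<le> (real n)\<^sup>2" "(real_of_int y)\<^sup>2 \<le> (real n)\<^sup>2"
    using assms by (intro real_square_le; linarith)+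
  moreover have "real n \<le> (real n)\<^sup>2" using N by (simp add: power2_eq_square)
  ultimately have "real n + (real_of_int x)\<^sup>2 + (real_of_int y)\<^sup>2 \<le> 3 * (real n)\<^sup>2" by argo
  thus "(real n + (real_of_int x)\<^sup>2 + (real_of_int y)\<^sup>2) / (real n)\<^sup>2 \<le> 3"
    using N by (simp add: divide_le_eq)
qed (use assms in \<open>auto simp: power_divide power_mult_distrib power2_eq_square\<close>)

lemma walk_prefactor_near_origin:
  "\<exists>C. \<forall>x y :: nat \<Rightarrow> int.
        (\<lambda>n. real_of_int (\<bar>x n\<bar> + \<bar>y n\<bar>)) \<in> o(\<lambda>n. real n) \<longrightarrow>
        (\<forall>\<^sub>F n in sequentially.
          0 \<le> x n \<and> x n \<le> y n \<and> reachable n (x n) (y n) \<longrightarrow>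
          (\<exists>e. \<bar>e\<bar> \<le> C * abs ((real n + (real_of_int (x n))\<^sup>2 + (real_of_int (y n))\<^sup>2) / (real n)\<^sup>2) \<and>
            walk_prefactor (x n) (y n) n = 2 / (pi * real n) * (1 + e)))"
proof (intro exI allI impI)
  fix x y :: "nat \<Rightarrow> int"
  assume "(\<lambda>n. real_of_int (\<bar>x n\<bar> + \<bar>y n\<bar>)) \<in> o(\<lambda>n. real n)"
  from smallo_real_le[OF this half_gt_zero[OF zero_less_one]] eventually_ge_at_top[of 1]
  show "\<forall>\<^sub>F n in sequentially. 0 \<le> x n \<and> x n \<le> y n \<and> reachable n (x n) (y n) \<longrightarrow>
     (\<exists>e. \<bar>e\<bar> \<le> 4 * exp (4 * 3) * \<bar>(real n + (real_of_int (x n))\<^sup>2 + (real_of_int (y n))\<^sup>2) / (real n)\<^sup>2\<bar> \<and>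
            walk_prefactor (x n) (y n) n = 2 / (pi * real n) * (1 + e))"
  proof eventually_elim
    case (elim n)
    show ?case
    proof (intro impI walk_prefactor_origin)
      show "\<bar>real_of_int (x n)\<bar> + \<bar>real_of_int (y n)\<bar> \<le> real n / 2" using elim by simp
    qed (use elim reachable_even(1)[of n "x n" "y n"] in auto)
  qed
qed

text \<open>\<open>x + y\<close> follows the slope \<open>2a\<close>, with an error linear in
  \<open>la + la'\<close>, while \<open>y - x = la' - la\<close> is near \<open>0\<close>, with a
  quadratic error; hence the asymmetric error term.\<close>

lemma walk_prefactor_near_diagonal:
  fixes a :: real
  assumes a: "0 < a" "a < 1/2"
  shows "\<exists>C. \<forall>la la' :: nat \<Rightarrow> real.
        la \<in> o(\<lambda>n. real n) \<and>
        la' \<in> o(\<lambda>n. real n) \<longrightarrow>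
        (\<forall>\<^sub>F n in sequentially. \<forall>x y.
          0 \<le> x \<and> x \<le> y \<and> reachable n x y \<and>
          real_of_int x = a * real n + la n \<and>
          real_of_int y = a * real n + la' n \<longrightarrow>
          (\<exists>e. \<bar>e\<bar> \<le> C * abs ((real n * \<bar>la n + la' n\<bar> + real n + (la' n - la n)\<^sup>2) / (real n)\<^sup>2) \<and>
            walk_prefactor x y n = 2 / (pi * real n * sqrt (1 - 4 * a\<^sup>2)) * (1 + e)))"
proof -
  \<comment> \<open>\<open>\<beta>\<close> lies midway between the slope \<open>2a\<close> and
    \<open>1\<close>. With the \<open>\<epsilon>\<close> below, two deviations of size
    \<open>\<epsilon> n\<close> add up to exactly \<open>(\<beta> - 2a) n\<close>, which keeps
    \<open>x + y\<close> below \<open>\<beta> n\<close>.\<close>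
  define \<beta> where "\<beta> = (1 + 2 * a) / 2"
  define K where "K = 2 / (1 - \<beta>) + 2"
  define \<epsilon> where "\<epsilon> = (1 - 2 * a) / 4"
  have \<beta>: "0 \<le> \<beta>" "\<beta> < 1" "\<bar>2 * a\<bar> \<le> \<beta>" and \<epsilon>: "\<epsilon> > 0" and K: "K \<ge> 0"
    using a by (auto simp: \<beta>_def \<epsilon>_def K_def)
  have sq: "1 - 4 * a\<^sup>2 > 0" using a abs_square_less_1[of "2 * a"] by (simp add: power_mult_distrib)
  show ?thesis
  proof (intro exI[of _ "K * exp (K * 3)"] allI impI, elim conjE, goal_cases)
    case (1 la la')
    from 1[THEN smallo_real_le, OF \<epsilon>] eventually_ge_at_top[of 1] show ?case
    proof eventually_elim
      case (elim n)
      show ?case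
      proof (intro allI impI, elim conjE, goal_cases)
        case (1 x y)
        define N where "N = real n"
        define S where "S = la n + la' n"
        define D where "D = la' n - la n"
        have n1: "n \<ge> 1" and R: "reachable n x y" using elim 1 by auto
        have N: "N \<ge> 1" using n1 by (simp add: N_def)
        have aN: "0 \<le> a * N" "2 * (a * N) \<le> N" using a N mult_right_mono[of "2*a" 1 N] by auto
        have \<epsilon>N: "\<epsilon> * N = N / 4 - a * N / 2" "\<beta> * N = N / 2 + a * N"
          by (simp_all add: \<epsilon>_def \<beta>_def field_simps)
        have "\<bar>la n\<bar> \<le> N / 4 - a * N / 2" "\<bar>la' n\<bar> \<le> N / 4 - a * N / 2"
          using elim \<epsilon>N by (auto simp: N_def)
        hence SD: "\<bar>S\<bar> \<le> N / 2 - a * N" "\<bar>D\<bar> \<le> N / 2 - a * N" unfolding S_def D_def by linarith+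
        have u: "real_of_int (x + y) = 2 * a * N + S" "real_of_int (y - x) = D"
          using 1 by (simp_all add: N_def S_def D_def)
        define q where "q = \<bar>S\<bar> / N + 1 / N + (D / N)\<^sup>2"
        have qeq: "(N * \<bar>S\<bar> + N + D\<^sup>2) / N\<^sup>2 = q"
          using N unfolding q_def by (simp add: field_simps power2_eq_square)
        have "\<bar>real_of_int (x + y)\<bar> \<le> \<beta> * real n"
          using SD aN unfolding N_def[symmetric] \<epsilon>N u by linarith
        from factor_approx_bulk[OF reachable_even(1)[OF R] n1 \<beta>(1,2) this \<beta>(3)]
        have A: "factor_approx n (x + y) (2 / (pi * N * (1 - (2 * a)\<^sup>2))) (2 / (1 - \<beta>) * (\<bar>S\<bar> / N + 1 / N))"
          unfolding N_def[symmetric] u by simp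
        have "\<bar>real_of_int (y - x)\<bar> \<le> real n / 2" using SD aN unfolding N_def[symmetric] u by linarith
        from factor_approx_origin[OF reachable_even(2)[OF R] n1 this]
        have B: "factor_approx n (y - x) (2 / (pi * N)) (2 * ((D / N)\<^sup>2 + 1 / N))"
          unfolding N_def[symmetric] u .
        have *: "k * (p + r) + 2 * (s + r) \<le> (k + 2) * (p + r + s)"
          if "k \<ge> 0" "p \<ge> 0" "r \<ge> 0" "s \<ge> 0" for k p r s :: real
          using that by (simp add: algebra_simps)
        have bound: "2 / (1 - \<beta>) * (\<bar>S\<bar> / N + 1 / N) + 2 * ((D / N)\<^sup>2 + 1 / N) \<le> K * q"
          unfolding K_def q_def by (rule *) (use N \<beta> in simp_all)
        have "\<bar>S\<bar> / N \<le> 1" using N SD aN by (simp add: divide_le_eq)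
        moreover have "1 / N \<le> 1" using N by simp
        moreover have "(D / N)\<^sup>2 \<le> 1\<^sup>2"
          using N SD aN by (intro real_square_le) (simp add: abs_divide divide_le_eq)
        ultimately have q3: "q \<le> 3" by (simp add: q_def)
        have q0: "0 \<le> q" using N by (simp add: q_def)
        have "(2 / (pi * N * sqrt (1 - 4 * a\<^sup>2)))\<^sup>2 = 2 / (pi * N * (1 - (2 * a)\<^sup>2)) * (2 / (pi * N))"
          using sq by (simp add: power_divide power_mult_distrib) (simp add: power2_eq_square)
        with walk_prefactor_relative_error[OF A B bound K q0 q3 _ this] sq N
        show ?case unfolding N_def[symmetric] S_def[symmetric] D_def[symmetric] qeq by simp
      qed
    qed
  qed
qed

text \<open>\<open>D\<close> bounds the deviations of both \<open>x + y\<close> and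
  \<open>y - x\<close> from their slopes, and the room \<open>\<beta> - |slope|\<close> keeps both
  coordinates below \<open>\<beta> n\<close>. Used near an axis, where the two slopes coincide, and
  for a generic direction.\<close>

lemma walk_prefactor_bulk:
  assumes "n \<ge> 1" "reachable n x y" "0 \<le> \<beta>" "\<beta> < 1" "\<bar>\<alpha>\<bar> \<le> \<beta>" "\<bar>\<alpha>'\<bar> \<le> \<beta>"
    and du: "\<bar>real_of_int (x + y) - \<alpha> * real n\<bar> \<le> D" "D \<le> (\<beta> - \<bar>\<alpha>\<bar>) * real n"
    and dv: "\<bar>real_of_int (y - x) - \<alpha>' * real n\<bar> \<le> D" "D \<le> (\<beta> - \<bar>\<alpha>'\<bar>) * real n"
    and F: "F > 0" "F\<^sup>2 = (2 / (pi * real n))\<^sup>2 / ((1 - \<alpha>\<^sup>2) * (1 - \<alpha>'\<^sup>2))"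
  shows "\<exists>e1 e2. \<bar>e1\<bar> \<le> 4 / (1 - \<beta>) * exp (4 / (1 - \<beta>) * 3) * \<bar>D / real n\<bar> \<and>
           \<bar>e2\<bar> \<le> 4 / (1 - \<beta>) * exp (4 / (1 - \<beta>) * 3) * \<bar>1 / real n\<bar> \<and>
           walk_prefactor x y n = F * (1 + e1 + e2)"
proof (rule walk_prefactor_relative_error2)
  define k where "k = 2 / (1 - \<beta>)"
  have N: "real n \<ge> 1" using assms by simp
  have k: "k \<ge> 0" "4 / (1 - \<beta>) = 2 * k" using assms by (simp_all add: k_def)
  have *: "\<bar>u\<bar> \<le> \<beta> * real n" if "\<bar>u - \<gamma> * real n\<bar> \<le> D" "D \<le> (\<beta> - \<bar>\<gamma>\<bar>) * real n" for u \<gamma>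
  proof -
    have "\<bar>u\<bar> \<le> \<bar>u - \<gamma> * real n\<bar> + \<bar>\<gamma> * real n\<bar>" by linarith
    also have "\<dots> \<le> (\<beta> - \<bar>\<gamma>\<bar>) * real n + \<bar>\<gamma>\<bar> * real n" using that by (simp add: abs_mult)
    finally show ?thesis by (simp add: algebra_simps)
  qed
  show "factor_approx n (x + y) (2 / (pi * real n * (1 - \<alpha>\<^sup>2)))
    (2 / (1 - \<beta>) * (\<bar>real_of_int (x + y) - \<alpha> * real n\<bar> / real n + 1 / real n))"
    "factor_approx n (y - x) (2 / (pi * real n * (1 - \<alpha>'\<^sup>2)))
    (2 / (1 - \<beta>) * (\<bar>real_of_int (y - x) - \<alpha>' * real n\<bar> / real n + 1 / real n))"
    by (intro factor_approx_bulk reachable_even[OF assms(2)] assms *[OF du] *[OF dv])+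
  have D0: "D \<ge> 0" using du(1) by linarith
  have "\<bar>real_of_int (x + y) - \<alpha> * real n\<bar> / real n \<le> D / real n"
    "\<bar>real_of_int (y - x) - \<alpha>' * real n\<bar> / real n \<le> D / real n"
    using du(1) dv(1) by (intro divide_right_mono; simp)+
  moreover have **: "k * (p + r) + k * (q + r) \<le> 2 * k * (\<bar>s\<bar> + \<bar>r\<bar>)" if "p \<le> s" "q \<le> s" "r \<ge> 0" for p q r s
  proof -
    have "k * (p + r) + k * (q + r) = k * ((p + r) + (q + r))" by (simp add: algebra_simps)
    also have "\<dots> \<le> k * (2 * (\<bar>s\<bar> + \<bar>r\<bar>))" using k that by (intro mult_left_mono) auto
    finally show ?thesis by (simp add: mult_ac)
  qed
  ultimately
  show "2 / (1 - \<beta>) * (\<bar>real_of_int (x + y) - \<alpha> * real n\<bar> / real n + 1 / real n) +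
    2 / (1 - \<beta>) * (\<bar>real_of_int (y - x) - \<alpha>' * real n\<bar> / real n + 1 / real n) \<le>
      4 / (1 - \<beta>) * (\<bar>D / real n\<bar> + \<bar>1 / real n\<bar>)"
    unfolding k(2) k_def[symmetric] by (intro **) simp_all
  have "(\<beta> - \<bar>\<alpha>\<bar>) * real n \<le> 2 * real n" using assms(4) by (intro mult_right_mono) auto
  hence D: "D \<le> 2 * real n" using du(2) by linarith
  have "D / real n \<le> 2" "1 / real n \<le> 1" using N D by (simp_all add: divide_le_eq)
  thus "\<bar>D / real n\<bar> + \<bar>1 / real n\<bar> \<le> 3" using D0 by simp
  show "F\<^sup>2 = 2 / (pi * real n * (1 - \<alpha>\<^sup>2)) * (2 / (pi * real n * (1 - \<alpha>'\<^sup>2)))"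
    unfolding F(2) by (simp add: power2_eq_square)
qed (use F(1) assms(4) in simp_all)

lemma walk_prefactor_near_axis:
  fixes b :: real
  assumes b: "0 < b" "b < 1"
  shows "\<exists>C. \<forall>(l1 :: nat \<Rightarrow> int) (lb :: nat \<Rightarrow> real).
        (\<lambda>n. real_of_int (l1 n)) \<in> o(\<lambda>n. real n) \<and>
        lb \<in> o(\<lambda>n. real n) \<longrightarrow>
        (\<forall>\<^sub>F n in sequentially. \<forall>x y.
          0 \<le> x \<and> x \<le> y \<and> reachable n x y \<and>
          real_of_int x = real_of_int (l1 n) \<and>
          real_of_int y = b * real n + lb n \<longrightarrow>
          (\<exists>e1 e2. \<bar>e1\<bar> \<le> C * abs ((\<bar>real_of_int (l1 n)\<bar> + \<bar>lb n\<bar>) / real n) \<and>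
            \<bar>e2\<bar> \<le> C * abs (1 / real n) \<and>
            walk_prefactor x y n = 2 / (pi * real n * (1 - b\<^sup>2)) * (1 + e1 + e2)))"
proof -
  define \<beta> where "\<beta> = (1 + b) / 2"
  define K where "K = 4 / (1 - \<beta>)"
  define \<epsilon> where "\<epsilon> = (1 - b) / 4"
  have \<epsilon>: "\<epsilon> > 0" using b by (simp add: \<epsilon>_def)
  have sq: "1 - b\<^sup>2 > 0" using b abs_square_less_1[of b] by simp
  show ?thesis
  proof (intro exI[of _ "K * exp (K * 3)"] allI impI, elim conjE, goal_cases)
    case (1 l1 lb)
    from 1[THEN smallo_real_le, OF \<epsilon>] eventually_ge_at_top[of 1] show ?case
    proof eventually_elim
      case (elim n)
      show ?case
      proof (intro allI impI, elim conjE, goal_cases)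
        case (1 x y)
        have n1: "n \<ge> 1" and R: "reachable n x y" using elim 1 by auto
        show ?case
          unfolding K_def
        proof (rule walk_prefactor_bulk[OF n1 R])
          show "\<bar>b\<bar> \<le> \<beta>" "\<bar>b\<bar> \<le> \<beta>" "0 \<le> \<beta>" "\<beta> < 1" using b by (auto simp: \<beta>_def)
          show "\<bar>real_of_int (x + y) - b * real n\<bar> \<le> \<bar>real_of_int (l1 n)\<bar> + \<bar>lb n\<bar>"
            "\<bar>real_of_int (y - x) - b * real n\<bar> \<le> \<bar>real_of_int (l1 n)\<bar> + \<bar>lb n\<bar>"
            unfolding of_int_add of_int_diff 1(4,5) by linarith+
          have eq: "(\<beta> - \<bar>b\<bar>) * real n = \<epsilon> * real n + \<epsilon> * real n"
            using b by (simp add: \<beta>_def \<epsilon>_def field_simps)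
          show "\<bar>real_of_int (l1 n)\<bar> + \<bar>lb n\<bar> \<le> (\<beta> - \<bar>b\<bar>) * real n"
            "\<bar>real_of_int (l1 n)\<bar> + \<bar>lb n\<bar> \<le> (\<beta> - \<bar>b\<bar>) * real n"
            unfolding eq by (rule add_mono[OF elim(1,2)])+
        qed (use sq n1 in \<open>simp_all add: power_divide power_mult_distrib power2_eq_square\<close>)
      qed
    qed
  qed
qed

lemma walk_prefactor_generic_direction:
  fixes ax ay :: real
  assumes a: "0 < ax" "ax < ay" "ax + ay < 1"
  shows "\<exists>C. \<forall>lx ly :: nat \<Rightarrow> real.
        lx \<in> o(\<lambda>n. real n) \<and>
        ly \<in> o(\<lambda>n. real n) \<longrightarrow>
        (\<forall>\<^sub>F n in sequentially. \<forall>x y.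
          0 \<le> x \<and> x \<le> y \<and> reachable n x y \<and>
          real_of_int x = ax * real n + lx n \<and>
          real_of_int y = ay * real n + ly n \<longrightarrow>
          (\<exists>e1 e2. \<bar>e1\<bar> \<le> C * abs ((\<bar>lx n\<bar> + \<bar>ly n\<bar>) / real n) \<and>
            \<bar>e2\<bar> \<le> C * abs (1 / real n) \<and>
            walk_prefactor x y n = 2 / (pi * real n * sqrt (1 - 2 * (ax\<^sup>2 + ay\<^sup>2) + ((ay - ax) * (ax + ay))\<^sup>2)) * (1 + e1 + e2)))"
proof -
  define \<beta> where "\<beta> = (1 + ax + ay) / 2"
  define K where "K = 4 / (1 - \<beta>)"
  define \<epsilon> where "\<epsilon> = (1 - ax - ay) / 4"
  define Q where "Q = 1 - 2 * (ax\<^sup>2 + ay\<^sup>2) + ((ay - ax) * (ax + ay))\<^sup>2"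
  have \<epsilon>: "\<epsilon> > 0" using a by (simp add: \<epsilon>_def)
  \<comment> \<open>The expression under the root is the product of the two bulk densities, because
    \<open>(ax + ay)^2 + (ay - ax)^2 = 2 (ax^2 + ay^2)\<close>.\<close>
  have Q: "Q = (1 - (ax + ay)\<^sup>2) * (1 - (ay - ax)\<^sup>2)"
    by (simp add: Q_def power2_eq_square algebra_simps)
  have sq: "1 - (ax + ay)\<^sup>2 > 0" "1 - (ay - ax)\<^sup>2 > 0"
    using a abs_square_less_1[of "ax + ay"] abs_square_less_1[of "ay - ax"] by simp_all
  hence Qp: "Q > 0" by (simp add: Q)
  show ?thesis
    unfolding Q_def[symmetric]
  proof (intro exI[of _ "K * exp (K * 3)"] allI impI, elim conjE, goal_cases)
    case (1 lx ly)
    from 1[THEN smallo_real_le, OF \<epsilon>] eventually_ge_at_top[of 1] show ?case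
    proof eventually_elim
      case (elim n)
      show ?case
      proof (intro allI impI, elim conjE, goal_cases)
        case (1 x y)
        have n1: "n \<ge> 1" and R: "reachable n x y" using elim 1 by auto
        show ?case
          unfolding K_def
        proof (rule walk_prefactor_bulk[OF n1 R])
          show "\<bar>ax + ay\<bar> \<le> \<beta>" "\<bar>ay - ax\<bar> \<le> \<beta>" "0 \<le> \<beta>" "\<beta> < 1" using a by (auto simp: \<beta>_def)
          show "\<bar>real_of_int (x + y) - (ax + ay) * real n\<bar> \<le> \<bar>lx n\<bar> + \<bar>ly n\<bar>"
            "\<bar>real_of_int (y - x) - (ay - ax) * real n\<bar> \<le> \<bar>lx n\<bar> + \<bar>ly n\<bar>"
            unfolding of_int_add of_int_diff 1(4,5) distrib_right left_diff_distrib by linarith+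
          have eq: "(\<beta> - \<bar>ax + ay\<bar>) * real n = \<epsilon> * real n + \<epsilon> * real n"
            using a by (simp add: \<beta>_def \<epsilon>_def field_simps)
          have "\<bar>lx n\<bar> + \<bar>ly n\<bar> \<le> (\<beta> - \<bar>ax + ay\<bar>) * real n"
            unfolding eq by (rule add_mono[OF elim(1,2)])
          moreover have "(\<beta> - \<bar>ax + ay\<bar>) * real n \<le> (\<beta> - \<bar>ay - ax\<bar>) * real n"
            using a by (intro mult_right_mono) auto
          ultimately show "\<bar>lx n\<bar> + \<bar>ly n\<bar> \<le> (\<beta> - \<bar>ax + ay\<bar>) * real n"
            "\<bar>lx n\<bar> + \<bar>ly n\<bar> \<le> (\<beta> - \<bar>ay - ax\<bar>) * real n"
            by simp_all
          show "(2 / (pi * real n * sqrt Q))\<^sup>2 =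
              (2 / (pi * real n))\<^sup>2 / ((1 - (ax + ay)\<^sup>2) * (1 - (ay - ax)\<^sup>2))"
            using Qp unfolding Q[symmetric] by (simp add: power_divide power_mult_distrib)
        qed (use Qp n1 in simp_all)
      qed
    qed
  qed
qed

section \<open>A factor at growing distance from the edge\<close>

lemma filterlim_at_top_ge:
  fixes l :: "nat \<Rightarrow> real"
  assumes "filterlim l at_top sequentially"
  shows "\<forall>\<^sub>F n in sequentially. l n \<ge> c"
  using assms by (simp add: filterlim_at_top)

text \<open>\<open>x + y\<close> is at distance \<open>l3\<close> from \<open>n\<close> and
  \<open>y - x\<close> is near \<open>0\<close>. The \<open>1/n\<close> of the second factor is
  absorbed by \<open>1/l3\<close>, since \<open>l3 \<le> n\<close>.\<close>

lemma walk_prefactor_edge_midpoint: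
  "\<exists>C. \<forall>(l1 :: nat \<Rightarrow> int) (l1' :: nat \<Rightarrow> int) (l3 :: nat \<Rightarrow> real).
        (\<lambda>n. real_of_int (l1 n)) \<in> o(\<lambda>n. real n) \<and>
        (\<lambda>n. real_of_int (l1' n)) \<in> o(\<lambda>n. real n) \<and>
        l3 \<in> o(\<lambda>n. real n) \<and>
        filterlim l3 at_top sequentially \<longrightarrow>
        (\<forall>\<^sub>F n in sequentially. \<forall>x y.
          0 \<le> x \<and> x \<le> y \<and> reachable n x y \<and>
          real_of_int x = real n / 2 + real_of_int (l1 n) \<and>
          real_of_int y = real n / 2 + real_of_int (l1' n) \<and>
          real_of_int (x + y) = real n - l3 n \<longrightarrow>
          (\<exists>e. \<bar>e\<bar> \<le> C * abs ((real_of_int (l1' n) - real_of_int (l1 n))\<^sup>2 / (real n)\<^sup>2 + l3 n / real n + 1 / l3 n) \<and>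
            walk_prefactor x y n = sqrt 2 / (pi * sqrt (real n * l3 n)) * (1 + e)))"
proof (intro exI[of _ "3 * exp (3 * 3)"] allI impI, elim conjE, goal_cases)
  case (1 l1 l1' l3)
  have "(1/4 :: real) > 0" by simp
  from 1(1,2)[THEN smallo_real_le, OF this] filterlim_at_top_ge[OF 1(4), of 1] eventually_ge_at_top[of 1]
  show ?case
  proof eventually_elim
    case (elim n)
    show ?case
    proof (intro allI impI, elim conjE, goal_cases)
      case (1 x y)
      define N where "N = real n"
      define D where "D = real_of_int (l1' n) - real_of_int (l1 n)"
      define w where "w = l3 n"
      have N: "N \<ge> 1" and w: "w \<ge> 1" using elim by (simp_all add: N_def w_def)
      note even = reachable_even[OF 1(3)]
      have wN: "w \<le> N" using 1(1,2,6) by (simp add: w_def N_def)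
      have D: "\<bar>D\<bar> \<le> N / 2" using elim(1,2) unfolding D_def N_def by linarith
      have v: "real_of_int (y - x) = D" using 1(4,5) by (simp add: D_def)
      have A: "factor_approx n (x + y) (1 / (pi * w)) (w / N + 1 / (6 * w))"
        unfolding N_def using 1 even w by (intro factor_approx_edge) (auto simp: w_def)
      have B: "factor_approx n (y - x) (2 / (pi * N)) (2 * ((D / N)\<^sup>2 + 1 / N))"
        using factor_approx_origin[OF even(2) elim(4)] v D unfolding N_def by simp
      define q where "q = D\<^sup>2 / N\<^sup>2 + w / N + 1 / w"
      have q0: "0 \<le> q" using N w by (simp add: q_def)
      have "p + r / 6 + 2 * (s + t) \<le> 3 * (s + p + r)" if "t \<le> r" "0 \<le> p" "0 \<le> r" "0 \<le> s"
        for p r s t :: real using that by simp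
      from this[of "1 / N" "1 / w" "w / N" "D\<^sup>2 / N\<^sup>2"] N w wN
      have bound: "w / N + 1 / (6 * w) + 2 * ((D / N)\<^sup>2 + 1 / N) \<le> 3 * q"
        unfolding q_def by (simp add: power_divide frac_le mult.commute)
      have "D\<^sup>2 / N\<^sup>2 \<le> 1" using real_square_le[of D N] D N by (simp add: divide_le_eq)
      moreover have "w / N \<le> 1" "1 / w \<le> 1" using N w wN by simp_all
      ultimately have q3: "q \<le> 3" by (simp add: q_def)
      have F: "sqrt 2 / (pi * sqrt (N * w)) > 0" using N w by simp
      have F2: "(sqrt 2 / (pi * sqrt (N * w)))\<^sup>2 = 1 / (pi * w) * (2 / (pi * N))"
        using N w by (simp add: power_divide power_mult_distrib) (simp add: power2_eq_square)
      from walk_prefactor_relative_error[OF A B bound _ q0 q3 F F2]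
      show ?case unfolding q_def N_def w_def D_def by simp
    qed
  qed
qed

text \<open>If \<open>ax + ay < 1\<close>, then \<open>n - x - y\<close> grows linearly, which is
  incompatible with \<open>l3 = o(n)\<close>. The edge regimes are then eventually void.\<close>

lemma edge_slopes_sum:
  fixes lx ly l3 :: "nat \<Rightarrow> real"
  assumes "lx \<in> o(\<lambda>n. real n)" "ly \<in> o(\<lambda>n. real n)" "l3 \<in> o(\<lambda>n. real n)" "ax + ay \<le> 1"
  shows "\<forall>\<^sub>F n in sequentially. (ax * real n + lx n) + (ay * real n + ly n) = real n - l3 n \<longrightarrow> ax + ay = 1"
proof (cases "ax + ay = 1")
  case False
  \<comment> \<open>Three deviations of size at most \<open>\<epsilon> n\<close> cannot fill the gap
    \<open>4 \<epsilon> n\<close>.\<close>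
  define \<epsilon> where "\<epsilon> = (1 - ax - ay) / 4"
  have \<epsilon>: "\<epsilon> > 0" using False assms by (simp add: \<epsilon>_def)
  from assms(1-3)[THEN smallo_real_le, OF \<epsilon>] eventually_ge_at_top[of 1] show ?thesis
  proof eventually_elim
    case (elim n)
    have "\<epsilon> * real n > 0" using \<epsilon> elim by simp
    moreover have "ax * real n + ay * real n = real n - 4 * (\<epsilon> * real n)"
      by (simp add: \<epsilon>_def field_simps)
    ultimately show ?case using elim by linarith
  qed
qed simp

lemma walk_prefactor_edge_interior:
  fixes ax ay :: real
  assumes a: "0 < ax" "ax < ay" "ay < 1" "ax + ay \<le> 1"
  shows "\<exists>C. \<forall>lx ly l3 :: nat \<Rightarrow> real.
        lx \<in> o(\<lambda>n. real n) \<and>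
        ly \<in> o(\<lambda>n. real n) \<and>
        l3 \<in> o(\<lambda>n. real n) \<and>
        filterlim l3 at_top sequentially \<longrightarrow>
        (\<forall>\<^sub>F n in sequentially. \<forall>x y.
          0 \<le> x \<and> x \<le> y \<and> reachable n x y \<and>
          real_of_int x = ax * real n + lx n \<and>
          real_of_int y = ay * real n + ly n \<and>
          real_of_int (x + y) = real n - l3 n \<longrightarrow>
          (\<exists>e. \<bar>e\<bar> \<le> C * abs ((\<bar>ly n\<bar> + \<bar>lx n\<bar>) / real n + 1 / l3 n) \<and>
            walk_prefactor x y n = sqrt 2 / (pi * sqrt (real n * (1 - (ay - ax)\<^sup>2) * l3 n)) * (1 + e)))"
proof -
  define \<alpha> where "\<alpha> = ay - ax"
  define \<beta> where "\<beta> = (1 + \<alpha>) / 2"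
  define k where "k = 2 / (1 - \<beta>)"
  define \<epsilon> where "\<epsilon> = (1 - \<alpha>) / 4"
  have \<alpha>: "0 < \<alpha>" "\<alpha> < 1" using a by (auto simp: \<alpha>_def)
  have \<beta>: "0 \<le> \<beta>" "\<beta> < 1" "\<bar>\<alpha>\<bar> \<le> \<beta>" and \<epsilon>: "\<epsilon> > 0" "\<epsilon> \<le> 1" and k: "k \<ge> 0"
    using \<alpha> by (auto simp: \<beta>_def \<epsilon>_def k_def)
  have sq: "1 - \<alpha>\<^sup>2 > 0" using \<alpha> abs_square_less_1[of \<alpha>] by simp
  show ?thesis
  proof (intro exI[of _ "(1 + k) * exp ((1 + k) * 3)"] allI impI, elim conjE, goal_cases)
    case (1 lx ly l3)
    from 1(1,2)[THEN smallo_real_le, OF \<epsilon>(1)] filterlim_at_top_ge[OF 1(4), of 1]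
      eventually_ge_at_top[of 1] edge_slopes_sum[OF 1(1,2,3) a(4)]
    show ?case
    proof eventually_elim
      case (elim n)
      show ?case
      proof (intro allI impI, elim conjE, goal_cases)
        case (1 x y)
        define N where "N = real n"
        define L where "L = \<bar>ly n\<bar> + \<bar>lx n\<bar>"
        define w where "w = l3 n"
        have N: "N \<ge> 1" and w: "w \<ge> 1" using elim by (simp_all add: N_def w_def)
        note even = reachable_even[OF 1(3)]
        have wN: "w \<le> N" using 1(1,2,6) by (simp add: w_def N_def)
        have one: "ax + ay = 1" using elim(5) 1(4,5,6) by simp
        have "ax * N + ay * N = N" using one by (simp flip: distrib_right)
        \<comment> \<open>Slopes adding up to \<open>1\<close> leave \<open>lx + ly = -l3\<close>,
          so the edge error \<open>w/n\<close> is covered by \<open>(|lx| + |ly|)/n\<close>.\<close>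
        hence wL: "w \<le> L" using 1(4,5,6) unfolding w_def L_def N_def of_int_add by linarith
        have v: "real_of_int (y - x) - \<alpha> * real n = ly n - lx n"
          using 1(4,5) by (simp add: \<alpha>_def algebra_simps)
        have LN: "L \<le> 2 * (\<epsilon> * N)" using elim(1,2) by (simp add: L_def N_def)
        have "\<bar>real_of_int (y - x)\<bar> \<le> \<alpha> * real n + L"
          using v \<alpha> mult_nonneg_nonneg[of \<alpha> "real n"] unfolding L_def by linarith
        also have "\<dots> \<le> \<beta> * real n" using LN by (simp add: \<beta>_def \<epsilon>_def N_def field_simps)
        finally have "factor_approx n (y - x) (2 / (pi * N * (1 - \<alpha>\<^sup>2)))
           (k * (\<bar>real_of_int (y - x) - \<alpha> * real n\<bar> / N + 1 / N))"
          unfolding N_def k_def by (rule factor_approx_bulk[OF even(2) elim(4) \<beta>(1,2) _ \<beta>(3)])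
        moreover have "k * (\<bar>real_of_int (y - x) - \<alpha> * real n\<bar> / N + 1 / N) \<le> k * (L / N + 1 / w)"
          unfolding v using k N w wN
          by (intro mult_left_mono add_mono divide_right_mono frac_le) (auto simp: L_def)
        ultimately have B: "factor_approx n (y - x) (2 / (pi * N * (1 - \<alpha>\<^sup>2))) (k * (L / N + 1 / w))"
          by (rule factor_approx_mono)
        have "factor_approx n (x + y) (1 / (pi * w)) (w / N + 1 / (6 * w))"
          unfolding N_def using 1 even w by (intro factor_approx_edge) (auto simp: w_def)
        moreover have "w / N + 1 / (6 * w) \<le> L / N + 1 / w"
          using N w wL by (intro add_mono divide_right_mono divide_left_mono) auto
        ultimately have A: "factor_approx n (x + y) (1 / (pi * w)) (L / N + 1 / w)"
          by (rule factor_approx_mono)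
        define q where "q = L / N + 1 / w"
        have q0: "0 \<le> q" using N w by (simp add: q_def L_def)
        have bound: "L / N + 1 / w + k * (L / N + 1 / w) \<le> (1 + k) * q"
          by (simp add: q_def distrib_right)
        have "\<epsilon> * N \<le> 1 * N" using \<epsilon> N by (intro mult_right_mono) auto
        hence "L \<le> 2 * N" using LN by linarith
        hence "L / N \<le> 2" "1 / w \<le> 1" using N w by (simp_all add: divide_le_eq)
        hence q3: "q \<le> 3" by (simp add: q_def)
        have F: "sqrt 2 / (pi * sqrt (N * (1 - \<alpha>\<^sup>2) * w)) > 0" using N w sq by simp
        have F2: "(sqrt 2 / (pi * sqrt (N * (1 - \<alpha>\<^sup>2) * w)))\<^sup>2 = 1 / (pi * w) * (2 / (pi * N * (1 - \<alpha>\<^sup>2)))"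
          using N w sq by (simp add: power_divide power_mult_distrib) (simp add: power2_eq_square)
        from walk_prefactor_relative_error[OF A B bound _ q0 q3 F F2] k
        show ?case unfolding q_def N_def w_def L_def \<alpha>_def by simp
      qed
    qed
  qed
qed

text \<open>Both factors are near the edge, at distances \<open>l3 - l1\<close> and
  \<open>l3 + l1\<close>, whose product \<open>l3^2 - l1^2\<close> appears under the root. The
  smaller distance is \<open>l3'\<close>, so \<open>1/l3'\<close> dominates both Stirling
  errors.\<close>

lemma walk_prefactor_corner:
  "\<exists>C. \<forall>(l1 :: nat \<Rightarrow> int) (l3 :: nat \<Rightarrow> real) (l3' :: nat \<Rightarrow> real).
        (\<lambda>n. real_of_int (l1 n)) \<in> o(\<lambda>n. real n) \<and>
        l3 \<in> o(\<lambda>n. real n) \<and>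
        filterlim l3 at_top sequentially \<and>
        l3' \<in> o(\<lambda>n. real n) \<and>
        filterlim l3' at_top sequentially \<longrightarrow>
        (\<forall>\<^sub>F n in sequentially. \<forall>x y.
          0 \<le> x \<and> x \<le> y \<and> reachable n x y \<and>
          real_of_int x = real_of_int (l1 n) \<and>
          real_of_int y = real n - l3 n \<and>
          l3 n - real_of_int (l1 n) = l3' n \<longrightarrow>
          (\<exists>e. \<bar>e\<bar> \<le> C * abs (l3 n / real n + 1 / \<bar>l3' n\<bar>) \<and>
            walk_prefactor x y n = 1 / (pi * sqrt ((l3 n)\<^sup>2 - (real_of_int (l1 n))\<^sup>2)) * (1 + e)))"
proof (intro exI[of _ "3 * exp (3 * 2)"] allI impI, elim conjE, goal_cases)
  case (1 l1 l3 l3')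
  from filterlim_at_top_ge[OF 1(5), of 1] eventually_ge_at_top[of 1] show ?case
  proof eventually_elim
    case (elim n)
    show ?case
    proof (intro allI impI, elim conjE, goal_cases)
      case (1 x y)
      define N where "N = real n"
      define m where "m = real_of_int (l1 n)"
      define r where "r = l3 n"
      define w where "w = r - m"
      have N: "N \<ge> 1" using elim by (simp add: N_def)
      have w': "l3' n = w" using 1(6) by (simp add: w_def r_def m_def)
      have w: "w \<ge> 1" using elim w' by simp
      have m: "m \<ge> 0" using 1(1,4) by (simp add: m_def)
      have mr: "m \<le> r" "w \<le> r" "w \<le> r + m" using m w by (auto simp: w_def)
      have rN: "r \<le> N" using 1(1,2,5) by (simp add: r_def N_def)
      note even = reachable_even[OF 1(3)]
      have u: "real_of_int (x + y) = real n - w" "real_of_int (y - x) = real n - (r + m)"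
        using 1(4,5) by (simp_all add: w_def r_def m_def)
      have A: "factor_approx n (x + y) (1 / (pi * w)) (w / N + 1 / (6 * w))"
        unfolding N_def using 1 even w u by (intro factor_approx_edge) auto
      have B: "factor_approx n (y - x) (1 / (pi * (r + m))) ((r + m) / N + 1 / (6 * (r + m)))"
        unfolding N_def using 1 even w mr u by (intro factor_approx_edge) auto
      define q where "q = r / N + 1 / w"
      have q0: "0 \<le> q" using N w mr by (simp add: q_def)
      have "w / N \<le> r / N" "(r + m) / N \<le> 2 * r / N" "1 / (6 * (r + m)) \<le> 1 / w" "1 / (6 * w) \<le> 1 / w"
        using N w m mr by (auto intro!: divide_right_mono divide_left_mono)
      moreover have "a + b + (c + d) \<le> 3 * (s + t)" if "a \<le> s" "c \<le> 2 * s" "d \<le> t" "b \<le> t" "0 \<le> t"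
        for a b c d s t :: real using that by simp
      ultimately have bound: "w / N + 1 / (6 * w) + ((r + m) / N + 1 / (6 * (r + m))) \<le> 3 * q"
        unfolding q_def using w by simp
      have "r / N \<le> 1" "1 / w \<le> 1" using N w rN by simp_all
      hence q2: "q \<le> 2" by (simp add: q_def)
      have wr: "r\<^sup>2 - m\<^sup>2 = w * (r + m)" by (simp add: w_def power2_eq_square algebra_simps)
      have F: "1 / (pi * sqrt (r\<^sup>2 - m\<^sup>2)) > 0" using w mr unfolding wr by simp
      have F2: "(1 / (pi * sqrt (r\<^sup>2 - m\<^sup>2)))\<^sup>2 = 1 / (pi * w) * (1 / (pi * (r + m)))"
        using w mr unfolding wr by (simp add: power_divide power_mult_distrib) (simp add: power2_eq_square)
      from walk_prefactor_relative_error[OF A B bound _ q0 q2 F F2] w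
      show ?case unfolding w' unfolding q_def N_def r_def m_def by simp
    qed
  qed
qed

section \<open>A factor at constant distance from the edge\<close>

lemma walk_prefactor_const_edge_midpoint:
  fixes c :: real
  assumes c: "0 < c"
  shows "\<exists>d\<in>stirling_range. (\<exists>C. \<forall>l1 l1' :: nat \<Rightarrow> int.
        (\<lambda>n. real_of_int (l1 n)) \<in> o(\<lambda>n. real n) \<and>
        (\<lambda>n. real_of_int (l1' n)) \<in> o(\<lambda>n. real n) \<longrightarrow>
        (\<forall>\<^sub>F n in sequentially. \<forall>x y.
          0 \<le> x \<and> x \<le> y \<and> reachable n x y \<and>
          real_of_int x = real n / 2 + real_of_int (l1 n) \<and>
          real_of_int y = real n / 2 + real_of_int (l1' n) \<and>
          real_of_int (x + y) = real n - c \<longrightarrow>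
          (\<exists>e. \<bar>e\<bar> \<le> C * abs (((real_of_int (l1' n) - real_of_int (l1 n))\<^sup>2 + real n) / (real n)\<^sup>2) \<and>
            walk_prefactor x y n = (d * sqrt 2 * exp (- 1 / (6 * c)) / (pi * sqrt (real n * c))) * (1 + e))))"
proof (intro bexI[OF _ edge_const_in_range[of c]] exI[of _ "(c + 2) * exp ((c + 2) * 2)"] allI impI,
    elim conjE, goal_cases)
  case (1 l1 l1')
  have "(1/4 :: real) > 0" by simp
  from 1(1,2)[THEN smallo_real_le, OF this] eventually_ge_at_top[of 1] show ?case
  proof eventually_elim
    case (elim n)
    show ?case
    proof (intro allI impI, elim conjE, goal_cases)
      case (1 x y)
      define N where "N = real n"
      define D where "D = real_of_int (l1' n) - real_of_int (l1 n)"
      have N: "N \<ge> 1" using elim by (simp add: N_def)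
      note even = reachable_even[OF 1(3)]
      have D: "\<bar>D\<bar> \<le> N / 2" using elim(1,2) unfolding D_def N_def by linarith
      have v: "real_of_int (y - x) = D" using 1(4,5) by (simp add: D_def)
      have A: "factor_approx n (x + y) ((edge_const c * exp (- 1 / (6 * c)))\<^sup>2 / (pi * c)) (c / N)"
        unfolding N_def using 1 even c by (intro factor_approx_const_edge) auto
      have B: "factor_approx n (y - x) (2 / (pi * N)) (2 * ((D / N)\<^sup>2 + 1 / N))"
        using factor_approx_origin[OF even(2) elim(3)] v D unfolding N_def by simp
      define q where "q = (D / N)\<^sup>2 + 1 / N"
      have qeq: "(D\<^sup>2 + N) / N\<^sup>2 = q"
        using N unfolding q_def by (simp add: field_simps power2_eq_square)
      have q0: "0 \<le> q" using N by (simp add: q_def)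
      have "c * (1 / N) \<le> c * q" using c by (intro mult_left_mono) (auto simp: q_def)
      hence bound: "c / N + 2 * ((D / N)\<^sup>2 + 1 / N) \<le> (c + 2) * q"
        unfolding q_def[symmetric] by (simp add: distrib_right)
      have "(D / N)\<^sup>2 \<le> 1\<^sup>2" using D N by (intro real_square_le) (simp add: abs_divide divide_le_eq)
      moreover have "1 / N \<le> 1" using N by simp
      ultimately have q2: "q \<le> 2" by (simp add: q_def)
      have F: "edge_const c * sqrt 2 * exp (- 1 / (6 * c)) / (pi * sqrt (N * c)) > 0"
        using N c edge_const_pos by simp
      have F2: "(edge_const c * sqrt 2 * exp (- 1 / (6 * c)) / (pi * sqrt (N * c)))\<^sup>2 =
          (edge_const c * exp (- 1 / (6 * c)))\<^sup>2 / (pi * c) * (2 / (pi * N))"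
        using N c by (simp add: power_divide power_mult_distrib) (simp add: power2_eq_square mult_ac)
      from walk_prefactor_relative_error[OF A B bound _ q0 q2 F F2] c
      show ?case unfolding N_def[symmetric] D_def[symmetric] qeq by simp
    qed
  qed
qed

text \<open>The first factor contributes only \<open>c/n\<close>, and the second deviates from its
  slope by exactly \<open>ly - lx\<close>, so the error involves just this difference. The constant
  \<open>d\<close> is the defect at distance \<open>c\<close> and does not vary with the
  slopes.\<close>

lemma walk_prefactor_const_edge_interior:
  fixes c :: real
  assumes c: "0 < c"
  shows "\<exists>d\<in>stirling_range. (\<forall>ax ay :: real. 0 < ax \<and> ax < ay \<and> ay < 1 \<and> ax + ay \<le> 1 \<longrightarrow> (\<exists>C. \<forall>lx ly :: nat \<Rightarrow> real.
        lx \<in> o(\<lambda>n. real n) \<and>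
        ly \<in> o(\<lambda>n. real n) \<longrightarrow>
        (\<forall>\<^sub>F n in sequentially. \<forall>x y.
          0 \<le> x \<and> x \<le> y \<and> reachable n x y \<and>
          real_of_int x = ax * real n + lx n \<and>
          real_of_int y = ay * real n + ly n \<and>
          real_of_int (x + y) = real n - c \<longrightarrow>
          (\<exists>e. \<bar>e\<bar> \<le> C * abs ((1 + \<bar>ly n - lx n\<bar>) / real n) \<and>
            walk_prefactor x y n = (d * sqrt 2 * exp (- 1 / (6 * c)) / (pi * sqrt (real n * c * (1 - (ay - ax)\<^sup>2)))) * (1 + e)))))"
proof (intro bexI[OF _ edge_const_in_range[of c]] allI impI, elim conjE, goal_cases)
  case (1 ax ay)
  define \<alpha> where "\<alpha> = ay - ax"
  define \<beta> where "\<beta> = (1 + \<alpha>) / 2"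
  define k where "k = 2 / (1 - \<beta>)"
  define \<epsilon> where "\<epsilon> = (1 - \<alpha>) / 4"
  have \<alpha>: "0 < \<alpha>" "\<alpha> < 1" using 1 by (auto simp: \<alpha>_def)
  have \<beta>: "0 \<le> \<beta>" "\<beta> < 1" "\<bar>\<alpha>\<bar> \<le> \<beta>" and \<epsilon>: "\<epsilon> > 0" "\<epsilon> \<le> 1" and k: "k \<ge> 0"
    using \<alpha> by (auto simp: \<beta>_def \<epsilon>_def k_def)
  have sq: "1 - \<alpha>\<^sup>2 > 0" using \<alpha> abs_square_less_1[of \<alpha>] by simp
  show ?case
  proof (intro exI[of _ "(c + k) * exp ((c + k) * 3)"] allI impI, elim conjE, goal_cases)
    case (1 lx ly)
    from 1(1,2)[THEN smallo_real_le, OF \<epsilon>(1)] eventually_ge_at_top[of 1] show ?case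
    proof eventually_elim
      case (elim n)
      show ?case
      proof (intro allI impI, elim conjE, goal_cases)
        case (1 x y)
        define N where "N = real n"
        define L where "L = \<bar>ly n - lx n\<bar>"
        have N: "N \<ge> 1" using elim by (simp add: N_def)
        note even = reachable_even[OF 1(3)]
        have v: "real_of_int (y - x) - \<alpha> * real n = ly n - lx n"
          using 1(4,5) by (simp add: \<alpha>_def algebra_simps)
        have LN: "L \<le> 2 * (\<epsilon> * N)" using elim(1,2) unfolding L_def N_def by linarith
        have "\<bar>real_of_int (y - x)\<bar> \<le> \<alpha> * real n + L"
          using v \<alpha> mult_nonneg_nonneg[of \<alpha> "real n"] unfolding L_def by linarith
        also have "\<dots> \<le> \<beta> * real n" using LN by (simp add: \<beta>_def \<epsilon>_def N_def field_simps)
        finally have B: "factor_approx n (y - x) (2 / (pi * N * (1 - \<alpha>\<^sup>2))) (k * (L / N + 1 / N))"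
          unfolding N_def k_def L_def v[symmetric]
          by (rule factor_approx_bulk[OF even(2) elim(3) \<beta>(1,2) _ \<beta>(3)])
        have A: "factor_approx n (x + y) ((edge_const c * exp (- 1 / (6 * c)))\<^sup>2 / (pi * c)) (c / N)"
          unfolding N_def using 1 even c by (intro factor_approx_const_edge) auto
        define q where "q = (1 + L) / N"
        have q0: "0 \<le> q" using N by (simp add: q_def L_def)
        have "c * (1 / N) \<le> c * q"
          using c N unfolding q_def by (intro mult_left_mono divide_right_mono) (auto simp: L_def)
        moreover have "L / N + 1 / N = q" by (simp add: q_def add_divide_distrib)
        ultimately have bound: "c / N + k * (L / N + 1 / N) \<le> (c + k) * q"
          by (simp add: distrib_right)
        have "\<epsilon> * N \<le> 1 * N" using \<epsilon> N by (intro mult_right_mono) auto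
        hence "1 + L \<le> 3 * N" using LN N by linarith
        hence q3: "q \<le> 3" using N by (simp add: q_def divide_le_eq)
        have F: "edge_const c * sqrt 2 * exp (- 1 / (6 * c)) / (pi * sqrt (N * c * (1 - \<alpha>\<^sup>2))) > 0"
          using N c edge_const_pos sq by simp
        have F2: "(edge_const c * sqrt 2 * exp (- 1 / (6 * c)) / (pi * sqrt (N * c * (1 - \<alpha>\<^sup>2))))\<^sup>2 =
            (edge_const c * exp (- 1 / (6 * c)))\<^sup>2 / (pi * c) * (2 / (pi * N * (1 - \<alpha>\<^sup>2)))"
          using N c sq by (simp add: power_divide power_mult_distrib) (simp add: power2_eq_square mult_ac)
        from walk_prefactor_relative_error[OF A B bound _ q0 q3 F F2] c k
        show ?case unfolding N_def q_def L_def \<alpha>_def by simp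
      qed
    qed
  qed
qed

lemma walk_prefactor_const_edge_corner:
  fixes c :: real
  assumes c: "0 < c"
  shows "\<exists>d\<in>stirling_range. (\<exists>C. \<forall>(l1 :: nat \<Rightarrow> int) (l3 :: nat \<Rightarrow> real).
        (\<lambda>n. real_of_int (l1 n)) \<in> o(\<lambda>n. real n) \<and>
        l3 \<in> o(\<lambda>n. real n) \<and>
        filterlim l3 at_top sequentially \<longrightarrow>
        (\<forall>\<^sub>F n in sequentially. \<forall>x y.
          0 \<le> x \<and> x \<le> y \<and> reachable n x y \<and>
          real_of_int x = real_of_int (l1 n) \<and>
          real_of_int y = real n - l3 n \<and>
          l3 n - real_of_int (l1 n) = c \<longrightarrow>
          (\<exists>e1 e2. \<bar>e1\<bar> \<le> C * abs (real_of_int (l1 n) / real n) \<and>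
            \<bar>e2\<bar> \<le> C * abs (1 / real_of_int (l1 n)) \<and>
            walk_prefactor x y n = (d * exp (- 1 / (6 * c)) / (pi * sqrt (c * (real_of_int (l1 n) + l3 n)))) * (1 + e1 + e2))))"
proof (intro bexI[OF _ edge_const_in_range[of c]] exI[of _ "(2 * c + 2) * exp ((2 * c + 2) * 2)"] allI impI,
    elim conjE, goal_cases)
  case (1 l1 l3)
  \<comment> \<open>Since \<open>l1 = l3 - c\<close>, the threshold \<open>c + 1\<close> makes
    \<open>l1 \<ge> 1\<close>, so that \<open>c/n\<close> can be absorbed by
    \<open>c l1/n\<close>.\<close>
  from filterlim_at_top_ge[OF 1(3), of "c + 1"] eventually_ge_at_top[of 1] show ?case
  proof eventually_elim
    case (elim n)
    show ?case
    proof (intro allI impI, elim conjE, goal_cases)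
      case (1 x y)
      define N where "N = real n"
      define m where "m = real_of_int (l1 n)"
      define r where "r = l3 n"
      define w where "w = m + r"
      have N: "N \<ge> 1" using elim by (simp add: N_def)
      have r: "r = m + c" using 1(6) by (simp add: r_def m_def)
      have m: "m \<ge> 1" using elim(1) r by (simp add: r_def)
      have w: "w = 2 * m + c" "w > 0" using r m c by (auto simp: w_def)
      have u: "real_of_int (x + y) = real n - c" "real_of_int (y - x) = real n - w"
        using 1(4,5) r by (simp_all add: w_def r_def m_def)
      have mN: "m \<le> N" using 1(1,2) u(1) 1(4) c by (simp add: m_def N_def)
      note even = reachable_even[OF 1(3)]
      have A: "factor_approx n (x + y) ((edge_const c * exp (- 1 / (6 * c)))\<^sup>2 / (pi * c)) (c / N)"
        unfolding N_def using 1 even c u by (intro factor_approx_const_edge) auto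
      have B: "factor_approx n (y - x) (1 / (pi * w)) (w / N + 1 / (6 * w))"
        unfolding N_def using 1 even w u by (intro factor_approx_edge) auto
      have "c / N \<le> c * (m / N)" using N m c by (simp add: field_simps)
      moreover have "w / N = 2 * (m / N) + c / N" by (simp add: w add_divide_distrib)
      moreover have "1 / (6 * w) \<le> 1 / m" using m w c by (intro divide_left_mono) auto
      moreover have "1 / m \<le> (2 * c + 2) * (1 / m)" using mult_right_mono[of 1 "2 * c + 2" "1 / m"] m c by simp
      moreover have "p + (v + t) \<le> (2 * c + 2) * (s + h)"
        if "p \<le> c * s" "v = 2 * s + p" "t \<le> h" "h \<le> (2 * c + 2) * h" for p s t h v
        using that by (simp add: algebra_simps)
      ultimately have "c / N + (w / N + 1 / (6 * w)) \<le> (2 * c + 2) * (m / N + 1 / m)" by blast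
      hence bound: "c / N + (w / N + 1 / (6 * w)) \<le> (2 * c + 2) * (\<bar>m / N\<bar> + \<bar>1 / m\<bar>)"
        using N m by simp
      have "\<bar>m / N\<bar> \<le> 1" "\<bar>1 / m\<bar> \<le> 1" using N m mN by simp_all
      hence q2: "\<bar>m / N\<bar> + \<bar>1 / m\<bar> \<le> 2" by linarith
      have F: "edge_const c * exp (- 1 / (6 * c)) / (pi * sqrt (c * w)) > 0"
        using w c edge_const_pos by simp
      have F2: "(edge_const c * exp (- 1 / (6 * c)) / (pi * sqrt (c * w)))\<^sup>2 =
          (edge_const c * exp (- 1 / (6 * c)))\<^sup>2 / (pi * c) * (1 / (pi * w))"
        using w(2) c by (simp add: power_divide power_mult_distrib) (simp add: power2_eq_square mult_ac)
      from walk_prefactor_relative_error2[OF A B bound _ q2 F F2] c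
      show ?case unfolding w_def N_def m_def r_def by simp
    qed
  qed
qed

lemma walk_prefactor_const_corner:
  fixes cx cy :: real
  assumes c: "0 < cx" "0 < cy" "cx \<noteq> cy"
  shows "\<exists>d\<in>stirling_range. (\<exists>C.
        \<forall>n\<ge>1. \<forall>x y.
          0 \<le> x \<and> x \<le> y \<and> reachable n x y \<and>
          real_of_int x = cx \<and>
          real_of_int y = real n - cy \<longrightarrow>
          (\<exists>e. \<bar>e\<bar> \<le> C * abs (1 / real n) \<and>
            walk_prefactor x y n = (d\<^sup>2 * exp (- cy / (3 * (cy\<^sup>2 - cx\<^sup>2))) / (pi * sqrt (cy\<^sup>2 - cx\<^sup>2))) * (1 + e)))"
proof (rule bexI[OF _ edge_const_mean_in_range[of "cy - cx" "cy + cx"]],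
    rule exI[of _ "(2 * cy) * exp ((2 * cy) * 1)"], intro allI impI, elim conjE, goal_cases)
  case (1 n x y)
  define v where "v = cy - cx"
  define w where "w = cy + cx"
  have "real_of_int (x + y) \<le> real n" using 1(4) unfolding reachable_def by linarith
  \<comment> \<open>Reachability gives \<open>cx \<le> cy\<close>; equality belongs to the boundary
    regime.\<close>
  hence v: "v > 0" using 1(5,6) c by (simp add: v_def)
  have w: "w > 0" using c by (simp add: w_def)
  note even = reachable_even[OF 1(4)]
  have A: "factor_approx n (x + y) ((edge_const v * exp (- 1 / (6 * v)))\<^sup>2 / (pi * v)) (v / real n)"
    using 1 even v by (intro factor_approx_const_edge) (auto simp: v_def)
  have B: "factor_approx n (y - x) ((edge_const w * exp (- 1 / (6 * w)))\<^sup>2 / (pi * w)) (w / real n)"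
    using 1 even w by (intro factor_approx_const_edge) (auto simp: w_def)
  have bound: "v / real n + w / real n \<le> (2 * cy) * (1 / real n)"
    by (simp add: v_def w_def flip: add_divide_distrib)
  have q1: "1 / real n \<le> 1" using 1(1) by simp
  have vw: "cy\<^sup>2 - cx\<^sup>2 = v * w" by (simp add: v_def w_def power2_eq_square algebra_simps)
  have cy: "cy = (v + w) / 2" by (simp add: v_def w_def)
  define E where "E = edge_const v * edge_const w"
  have E: "E > 0" using edge_const_pos by (simp add: E_def)
  \<comment> \<open>The exponent comes from \<open>1/(6v) + 1/(6w) = (v + w)/(6 v w)\<close> with
    \<open>v + w = 2 cy\<close>.\<close>
  have e: "exp (- cy / (3 * (v * w))) = exp (- 1 / (6 * v)) * exp (- 1 / (6 * w))"
    unfolding exp_add[symmetric] using v w by (simp add: cy field_simps)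
  have F: "(sqrt E)\<^sup>2 * exp (- cy / (3 * (v * w))) / (pi * sqrt (v * w)) > 0" using v w E by simp
  have F2: "((sqrt E)\<^sup>2 * exp (- cy / (3 * (v * w))) / (pi * sqrt (v * w)))\<^sup>2 =
      (edge_const v * exp (- 1 / (6 * v)))\<^sup>2 / (pi * v) * ((edge_const w * exp (- 1 / (6 * w)))\<^sup>2 / (pi * w))"
    unfolding e using v w E
    by (simp add: power_divide power_mult_distrib) (simp add: E_def power2_eq_square mult_ac)
  from walk_prefactor_relative_error[OF A B bound _ _ q1 F F2] c
  show ?case unfolding vw unfolding v_def w_def E_def by simp
qed

section \<open>The boundary \<open>x + y = n\<close>, where the first factor is exactly
  \<open>1\<close>\<close>

lemma walk_prefactor_boundary_midpoint:
  "\<exists>C. \<forall>l3 :: nat \<Rightarrow> real.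
        l3 \<in> o(\<lambda>n. real n) \<and>
        filterlim l3 at_top sequentially \<longrightarrow>
        (\<forall>\<^sub>F n in sequentially. \<forall>x y.
          0 \<le> x \<and> x \<le> y \<and> reachable n x y \<and>
          real_of_int x = real n / 2 - l3 n \<and>
          real_of_int y = real n / 2 + l3 n \<longrightarrow>
          (\<exists>e. \<bar>e\<bar> \<le> C * abs (((l3 n)\<^sup>2 + real n) / (real n)\<^sup>2) \<and>
            walk_prefactor x y n = sqrt (2 / (pi * real n)) * (1 + e)))"
proof (intro exI[of _ "8 * exp (8 * 2)"] allI impI, elim conjE, goal_cases)
  case (1 l3)
  have "(1/4 :: real) > 0" by simp
  from smallo_real_le[OF 1(1) this] eventually_ge_at_top[of 1] show ?case
  proof eventually_elim
    case (elim n)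
    show ?case
    proof (intro allI impI, elim conjE, goal_cases)
      case (1 x y)
      define N where "N = real n"
      define r where "r = l3 n"
      have N: "N \<ge> 1" and r: "\<bar>r\<bar> \<le> N / 4" using elim by (simp_all add: N_def r_def)
      note even = reachable_even[OF 1(3)]
      have "real_of_int (x + y) = real_of_int (int n)" using 1(4,5) by simp
      hence u: "x + y = int n" by (simp only: of_int_eq_iff)
      have v: "real_of_int (y - x) = 2 * r" using 1(4,5) by (simp add: r_def)
      have A: "factor_approx n (x + y) 1 0" unfolding u by (rule factor_approx_full)
      have "\<bar>real_of_int (y - x)\<bar> \<le> real n / 2" using r unfolding v N_def by simp
      from factor_approx_origin[OF even(2) elim(2) this]
      have B: "factor_approx n (y - x) (2 / (pi * N)) (2 * ((2 * r / N)\<^sup>2 + 1 / N))"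
        unfolding v N_def .
      define q where "q = (r / N)\<^sup>2 + 1 / N"
      have qeq: "(r\<^sup>2 + N) / N\<^sup>2 = q"
        using N unfolding q_def by (simp add: field_simps power2_eq_square)
      have q0: "0 \<le> q" using N by (simp add: q_def)
      have "(2 * r / N)\<^sup>2 = 4 * (r / N)\<^sup>2" by (simp add: power_divide power_mult_distrib)
      hence bound: "0 + 2 * ((2 * r / N)\<^sup>2 + 1 / N) \<le> 8 * q"
        using N by (simp add: q_def divide_right_mono)
      have "(r / N)\<^sup>2 \<le> 1\<^sup>2" using r N by (intro real_square_le) (simp add: abs_divide divide_le_eq)
      moreover have "1 / N \<le> 1" using N by simp
      ultimately have q2: "q \<le> 2" by (simp add: q_def)
      have F: "sqrt (2 / (pi * N)) > 0" using N by simp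
      have F2: "(sqrt (2 / (pi * N)))\<^sup>2 = 1 * (2 / (pi * N))" using N by simp
      from walk_prefactor_relative_error[OF A B bound _ q0 q2 F F2]
      show ?case unfolding N_def[symmetric] r_def[symmetric] qeq by simp
    qed
  qed
qed

lemma walk_prefactor_boundary_interior:
  fixes ax ay :: real
  assumes a: "0 < ax" "ax < ay" "ay < 1" "ax + ay \<le> 1"
  shows "\<exists>C. \<forall>lx ly :: nat \<Rightarrow> real.
        lx \<in> o(\<lambda>n. real n) \<and>
        ly \<in> o(\<lambda>n. real n) \<longrightarrow>
        (\<forall>\<^sub>F n in sequentially. \<forall>x y.
          0 \<le> x \<and> x \<le> y \<and> reachable n x y \<and>
          real_of_int x = ax * real n + lx n \<and>
          real_of_int y = ay * real n + ly n \<and>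
          real_of_int (x + y) = real n \<longrightarrow>
          (\<exists>e1 e2. \<bar>e1\<bar> \<le> C * abs (lx n / real n) \<and>
            \<bar>e2\<bar> \<le> C * abs (1 / real n) \<and>
            walk_prefactor x y n = sqrt (2 / (pi * real n * (1 - (ay - ax)\<^sup>2))) * (1 + e1 + e2)))"
proof -
  define \<alpha> where "\<alpha> = ay - ax"
  define \<beta> where "\<beta> = (1 + \<alpha>) / 2"
  define k where "k = 2 / (1 - \<beta>)"
  define \<epsilon> where "\<epsilon> = (1 - \<alpha>) / 4"
  have \<alpha>: "0 < \<alpha>" "\<alpha> < 1" using a by (auto simp: \<alpha>_def)
  have \<beta>: "0 \<le> \<beta>" "\<beta> < 1" "\<bar>\<alpha>\<bar> \<le> \<beta>" and \<epsilon>: "\<epsilon> > 0" "\<epsilon> \<le> 1" and k: "k \<ge> 0"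
    using \<alpha> by (auto simp: \<beta>_def \<epsilon>_def k_def)
  have sq: "1 - \<alpha>\<^sup>2 > 0" using \<alpha> abs_square_less_1[of \<alpha>] by simp
  have zero: "(\<lambda>_. 0) \<in> o(\<lambda>n. real n)" by simp
  show ?thesis
  proof (intro exI[of _ "(2 * k) * exp ((2 * k) * 2)"] allI impI, elim conjE, goal_cases)
    case (1 lx ly)
    from smallo_real_le[OF 1(1) \<epsilon>(1)] eventually_ge_at_top[of 1]
      edge_slopes_sum[OF 1(1,2) zero a(4)]
    show ?case
    proof eventually_elim
      case (elim n)
      show ?case
      proof (intro allI impI, elim conjE, goal_cases)
        case (1 x y)
        define N where "N = real n"
        define m where "m = lx n"
        have N: "N \<ge> 1" using elim by (simp add: N_def)
        note even = reachable_even[OF 1(3)]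
        have "real_of_int (x + y) = real_of_int (int n)" using 1(6) by simp
        hence u: "x + y = int n" by (simp only: of_int_eq_iff)
        have one: "ax + ay = 1" using elim(3) 1(4,5,6) by simp
        have "ax * N + ay * N = N" using one by (simp flip: distrib_right)
        \<comment> \<open>On the boundary the two deviations cancel, so the error can be stated
          through \<open>lx\<close> alone.\<close>
        hence "ly n = - m" using 1(4,5,6) unfolding m_def N_def of_int_add by linarith
        hence v: "real_of_int (y - x) - \<alpha> * real n = - 2 * m"
          using 1(4,5) by (simp add: \<alpha>_def m_def algebra_simps)
        have mN: "\<bar>m\<bar> \<le> \<epsilon> * N" using elim(1) by (simp add: m_def N_def)
        have "\<bar>real_of_int (y - x)\<bar> \<le> \<alpha> * real n + 2 * \<bar>m\<bar>"
          using v \<alpha> mult_nonneg_nonneg[of \<alpha> "real n"] by linarith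
        also have "\<dots> \<le> \<beta> * real n" using mN by (simp add: \<beta>_def \<epsilon>_def N_def field_simps)
        finally have "factor_approx n (y - x) (2 / (pi * N * (1 - \<alpha>\<^sup>2)))
            (k * (\<bar>real_of_int (y - x) - \<alpha> * real n\<bar> / N + 1 / N))"
          unfolding N_def k_def by (rule factor_approx_bulk[OF even(2) elim(2) \<beta>(1,2) _ \<beta>(3)])
        hence B: "factor_approx n (y - x) (2 / (pi * N * (1 - \<alpha>\<^sup>2))) (k * (2 * \<bar>m\<bar> / N + 1 / N))"
          unfolding v by (simp add: abs_mult)
        have A: "factor_approx n (x + y) 1 0" unfolding u by (rule factor_approx_full)
        have "k * (2 * \<bar>m\<bar> / N + 1 / N) \<le> k * (2 * (\<bar>m / N\<bar> + \<bar>1 / N\<bar>))"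
          using k N by (intro mult_left_mono) (auto simp: abs_divide divide_right_mono)
        hence bound: "0 + k * (2 * \<bar>m\<bar> / N + 1 / N) \<le> (2 * k) * (\<bar>m / N\<bar> + \<bar>1 / N\<bar>)"
          by (simp add: mult_ac)
        have "\<epsilon> * N \<le> 1 * N" using \<epsilon> N by (intro mult_right_mono) auto
        hence "\<bar>m\<bar> \<le> N" using mN by linarith
        hence "\<bar>m / N\<bar> \<le> 1" "\<bar>1 / N\<bar> \<le> 1" using N by (simp_all add: abs_divide divide_le_eq)
        hence q2: "\<bar>m / N\<bar> + \<bar>1 / N\<bar> \<le> 2" by linarith
        have F: "sqrt (2 / (pi * N * (1 - \<alpha>\<^sup>2))) > 0" using N sq by simp
        have F2: "(sqrt (2 / (pi * N * (1 - \<alpha>\<^sup>2))))\<^sup>2 = 1 * (2 / (pi * N * (1 - \<alpha>\<^sup>2)))"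
          using N sq by simp
        from walk_prefactor_relative_error2[OF A B bound _ q2 F F2] k
        show ?case unfolding N_def m_def \<alpha>_def by simp
      qed
    qed
  qed
qed

lemma walk_prefactor_boundary_corner:
  "\<exists>C. \<forall>l3 :: nat \<Rightarrow> real.
        l3 \<in> o(\<lambda>n. real n) \<and>
        filterlim l3 at_top sequentially \<longrightarrow>
        (\<forall>\<^sub>F n in sequentially. \<forall>x y.
          0 \<le> x \<and> x \<le> y \<and> reachable n x y \<and>
          real_of_int x = l3 n \<and>
          real_of_int y = real n - l3 n \<longrightarrow>
          (\<exists>e1 e2. \<bar>e1\<bar> \<le> C * abs (l3 n / real n) \<and>
            \<bar>e2\<bar> \<le> C * abs (1 / l3 n) \<and>
            walk_prefactor x y n = 1 / sqrt (2 * pi * l3 n) * (1 + e1 + e2)))"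
proof (intro exI[of _ "2 * exp (2 * 2)"] allI impI, elim conjE, goal_cases)
  case (1 l3)
  from filterlim_at_top_ge[OF 1(2), of 1] eventually_ge_at_top[of 1] show ?case
  proof eventually_elim
    case (elim n)
    show ?case
    proof (intro allI impI, elim conjE, goal_cases)
      case (1 x y)
      define N where "N = real n"
      define r where "r = l3 n"
      have N: "N \<ge> 1" and r: "r \<ge> 1" using elim by (simp_all add: N_def r_def)
      note even = reachable_even[OF 1(3)]
      have "real_of_int (x + y) = real_of_int (int n)" using 1(4,5) by simp
      hence u: "x + y = int n" by (simp only: of_int_eq_iff)
      have v: "real_of_int (y - x) = real n - 2 * r" using 1(4,5) by (simp add: r_def)
      have rN: "r \<le> N" using 1(1,2,4,5) unfolding r_def N_def by linarith
      have A: "factor_approx n (x + y) 1 0" unfolding u by (rule factor_approx_full)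
      have B: "factor_approx n (y - x) (1 / (pi * (2 * r))) (2 * r / N + 1 / (6 * (2 * r)))"
        unfolding N_def using 1 even r v by (intro factor_approx_edge) auto
      have "1 / (6 * (2 * r)) \<le> 2 * (1 / r)" using r by (simp add: field_simps)
      hence "2 * (r / N) + 1 / (6 * (2 * r)) \<le> 2 * (r / N) + 2 * (1 / r)" by (rule add_left_mono)
      hence bound: "0 + (2 * r / N + 1 / (6 * (2 * r))) \<le> 2 * (\<bar>r / N\<bar> + \<bar>1 / r\<bar>)"
        using N r by simp
      have "\<bar>r / N\<bar> \<le> 1" "\<bar>1 / r\<bar> \<le> 1" using r N rN by simp_all
      hence q2: "\<bar>r / N\<bar> + \<bar>1 / r\<bar> \<le> 2" by linarith
      have F: "1 / sqrt (2 * pi * r) > 0" using r by simp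
      have F2: "(1 / sqrt (2 * pi * r))\<^sup>2 = 1 * (1 / (pi * (2 * r)))"
        using r by (simp add: power_divide mult_ac)
      from walk_prefactor_relative_error2[OF A B bound _ q2 F F2]
      show ?case unfolding N_def r_def by simp
    qed
  qed
qed

text \<open>The second factor is at distance \<open>2c\<close> from the edge, which explains
  \<open>edge_const (2 * c)\<close> and the exponent \<open>1/(12 c) = 1/(6 (2 c))\<close>.\<close>

lemma walk_prefactor_boundary_const_corner:
  fixes c :: real
  assumes c: "0 < c"
  shows "\<exists>d\<in>stirling_range. (\<exists>C.
        \<forall>n\<ge>1. \<forall>x y.
          0 \<le> x \<and> x \<le> y \<and> reachable n x y \<and>
          real_of_int x = c \<and>
          real_of_int y = real n - c \<longrightarrow>
          (\<exists>e. \<bar>e\<bar> \<le> C * abs (1 / real n) \<and>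
            walk_prefactor x y n = (d * exp (- 1 / (12 * c)) / sqrt (2 * pi * c)) * (1 + e)))"
proof (rule bexI[OF _ edge_const_in_range[of "2 * c"]],
    rule exI[of _ "(2 * c) * exp ((2 * c) * 1)"], intro allI impI, elim conjE, goal_cases)
  case (1 n x y)
  note even = reachable_even[OF 1(4)]
  have "real_of_int (x + y) = real_of_int (int n)" using 1(5,6) by simp
  hence u: "x + y = int n" by (simp only: of_int_eq_iff)
  have A: "factor_approx n (x + y) 1 0" unfolding u by (rule factor_approx_full)
  have B: "factor_approx n (y - x) ((edge_const (2 * c) * exp (- 1 / (6 * (2 * c))))\<^sup>2 / (pi * (2 * c)))
      (2 * c / real n)"
    using 1 even c by (intro factor_approx_const_edge) auto
  have bound: "0 + 2 * c / real n \<le> (2 * c) * (1 / real n)" by simp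
  have q1: "1 / real n \<le> 1" using 1(1) by simp
  have F: "edge_const (2 * c) * exp (- 1 / (12 * c)) / sqrt (2 * pi * c) > 0"
    using c edge_const_pos by simp
  have F2: "(edge_const (2 * c) * exp (- 1 / (12 * c)) / sqrt (2 * pi * c))\<^sup>2 =
      1 * ((edge_const (2 * c) * exp (- 1 / (6 * (2 * c))))\<^sup>2 / (pi * (2 * c)))"
    using c by (simp add: power_divide power_mult_distrib mult_ac)
  from walk_prefactor_relative_error[OF A B bound _ _ q1 F F2] c
  show ?case by simp
qed

lemma walk_prefactor_vertex: "walk_prefactor 0 (int n) n = 1"
  by (simp add: walk_prefactor_def log_factor_full)

subsection \<open>Local central limit regime\<close>

text \<open>In the even part of \<open>(A + B)^(2l)\<close> every monomial other than
  \<open>A^(2l)\<close> and \<open>B^(2l)\<close> contains \<open>A^2 B^2\<close>. The size is found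
  by recursion in \<open>l\<close>: the half-difference \<open>Q\<close> of \<open>s^l\<close> and
  \<open>t^l\<close> carries one factor \<open>p = A B\<close>, and it enters the recursion of
  \<open>E\<close> with another. The start \<open>E 1 = 0\<close> is the parallelogram law.\<close>

lemma cross_power_bound:
  fixes A B :: real
  assumes "\<bar>A\<bar> \<le> 1/4" "\<bar>B\<bar> \<le> 1/4"
  shows "\<bar>((A + B) ^ (2 * Suc l) + (A - B) ^ (2 * Suc l)) / 2 - A ^ (2 * Suc l) - B ^ (2 * Suc l)\<bar>
           \<le> 320 * (1/4) ^ Suc l * (A * B)\<^sup>2"
proof -
  define a b s t where "a = A\<^sup>2" and "b = B\<^sup>2" and "s = (A + B)\<^sup>2" and "t = (A - B)\<^sup>2"
  define p where "p = A * B"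
  have ab: "0 \<le> a" "a \<le> 1/16" "0 \<le> b" "b \<le> 1/16"
    using abs_le_square_iff[of A "1/4"] abs_le_square_iff[of B "1/4"] assms
    by (simp_all add: a_def b_def power2_eq_square)
  have "\<bar>A + B\<bar> \<le> \<bar>1/2\<bar>" "\<bar>A - B\<bar> \<le> \<bar>1/2\<bar>" using assms by linarith+
  hence "(A + B)\<^sup>2 \<le> (1/2)\<^sup>2" "(A - B)\<^sup>2 \<le> (1/2)\<^sup>2" by (simp_all only: abs_le_square_iff)
  hence st: "0 \<le> s" "s \<le> 1/4" "0 \<le> t" "t \<le> 1/4"
    by (simp_all add: s_def t_def power2_eq_square[of "1/2"])
  have st_eq: "s = a + b + 2 * p" "t = a + b - 2 * p" "p\<^sup>2 = a * b"
    by (simp_all add: s_def t_def a_def b_def p_def power2_eq_square algebra_simps)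
  define P where "P l = (s ^ l + t ^ l) / 2" for l
  define Q where "Q l = (s ^ l - t ^ l) / 2" for l
  define E where "E l = P l - a ^ l - b ^ l" for l
  have P: "\<bar>P l\<bar> \<le> (1/4) ^ l" for l
  proof -
    have "s ^ l \<le> (1/4) ^ l" "t ^ l \<le> (1/4) ^ l" "0 \<le> s ^ l" "0 \<le> t ^ l"
      using st by (auto intro!: power_mono)
    moreover have "\<bar>(p + q) / 2\<bar> \<le> r" if "p \<le> r" "q \<le> r" "0 \<le> p" "0 \<le> q" for p q r :: real
      using that by (simp add: abs_of_nonneg)
    ultimately show ?thesis unfolding P_def by blast
  qed
  have abs_ab: "\<bar>a + b\<bar> \<le> 1/8" using ab by linarith
  \<comment> \<open>The constant solves \<open>C/8 + 2 = C/4\<close>, so that the induction step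
    closes with equality.\<close>
  have Q: "\<bar>Q (Suc l)\<bar> \<le> 16 * (1/4) ^ Suc l * \<bar>p\<bar>" for l
  proof (induction l)
    case 0
    have "Q (Suc 0) = 2 * p" by (simp add: Q_def st_eq)
    thus ?case by (simp add: abs_mult)
  next
    case (Suc l)
    have "Q (Suc (Suc l)) = (a + b) * Q (Suc l) + 2 * p * P (Suc l)"
      unfolding Q_def P_def power_Suc[of _ "Suc l"] st_eq(1,2) by (simp add: field_simps)
    hence "\<bar>Q (Suc (Suc l))\<bar> \<le> \<bar>a + b\<bar> * \<bar>Q (Suc l)\<bar> + 2 * \<bar>p\<bar> * \<bar>P (Suc l)\<bar>"
      using abs_triangle_ineq[of "(a + b) * Q (Suc l)" "2 * p * P (Suc l)"] by (simp add: abs_mult)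
    also have "\<dots> \<le> 1/8 * (16 * (1/4) ^ Suc l * \<bar>p\<bar>) + 2 * \<bar>p\<bar> * (1/4) ^ Suc l"
      using abs_ab Suc P[of "Suc l"] by (intro add_mono mult_mono) auto
    also have "\<dots> = 16 * (1/4) ^ Suc (Suc l) * \<bar>p\<bar>" by simp
    finally show ?case .
  qed
  \<comment> \<open>Again the fixed point, of \<open>C/8 + 8 + 32 = C/4\<close>: \<open>8\<close>
    from \<open>a^l + b^l\<close> and \<open>32\<close> from \<open>2 p Q\<close>.\<close>
  have E: "\<bar>E (Suc l)\<bar> \<le> 320 * (1/4) ^ Suc l * p\<^sup>2" for l
  proof (induction l)
    case 0
    have "E (Suc 0) = 0" by (simp add: E_def P_def st_eq field_simps)
    thus ?case by simp
  next
    case (Suc l)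
    have "E (Suc (Suc l)) = (a + b) * E (Suc l) + p\<^sup>2 * (a ^ l + b ^ l) + 2 * p * Q (Suc l)"
      unfolding E_def Q_def P_def st_eq(3) power_Suc[of s "Suc l"] power_Suc[of t "Suc l"]
      unfolding st_eq(1,2) by (simp add: field_simps)
    hence "\<bar>E (Suc (Suc l))\<bar> \<le> \<bar>a + b\<bar> * \<bar>E (Suc l)\<bar> + p\<^sup>2 * \<bar>a ^ l + b ^ l\<bar> + 2 * \<bar>p\<bar> * \<bar>Q (Suc l)\<bar>"
      using abs_triangle_ineq[of "(a + b) * E (Suc l) + p\<^sup>2 * (a ^ l + b ^ l)" "2 * p * Q (Suc l)"]
        abs_triangle_ineq[of "(a + b) * E (Suc l)" "p\<^sup>2 * (a ^ l + b ^ l)"]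
      by (simp add: abs_mult)
    also have "\<dots> \<le> 1/8 * (320 * (1/4) ^ Suc l * p\<^sup>2) + p\<^sup>2 * (2 * (1/4) ^ l) +
        2 * \<bar>p\<bar> * (16 * (1/4) ^ Suc l * \<bar>p\<bar>)"
    proof -
      have "a ^ l \<le> (1/4) ^ l" "b ^ l \<le> (1/4) ^ l" using ab by (auto intro!: power_mono)
      moreover have "0 \<le> a ^ l" "0 \<le> b ^ l" using ab by simp_all
      ultimately have "\<bar>a ^ l + b ^ l\<bar> \<le> 2 * (1/4) ^ l" by (simp add: abs_of_nonneg)
      thus ?thesis using abs_ab Suc Q[of l] by (intro add_mono mult_mono) auto
    qed
    also have "\<dots> = 320 * (1/4) ^ Suc (Suc l) * p\<^sup>2"
      by (simp add: power2_eq_square abs_mult_self_eq mult.left_commute)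
    finally show ?case .
  qed
  show ?thesis
    using E[of l] by (simp only: E_def P_def s_def t_def a_def b_def p_def power_mult)
qed

text \<open>The previous bound is summed term by term; the weights \<open>1/c l\<close> are at most
  \<open>1\<close>, and the geometric series gives \<open>80 * 4/3 \<le> 320\<close>.\<close>

lemma binary_entropy_defect_cross:
  fixes A B :: real
  assumes "\<bar>A\<bar> \<le> 1/4" "\<bar>B\<bar> \<le> 1/4"
  shows "\<bar>binary_entropy_defect A + binary_entropy_defect B -
     (binary_entropy_defect (A + B) + binary_entropy_defect (A - B)) / 2\<bar> \<le> 320 * (A * B)\<^sup>2"
proof -
  define c where "c l = 2 * real (Suc l) * (2 * real (Suc l) - 1)" for l
  define F where "F l = ((A + B) ^ (2 * Suc l) + (A - B) ^ (2 * Suc l)) / 2 -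
    A ^ (2 * Suc l) - B ^ (2 * Suc l)" for l
  have c: "c l \<ge> 1" for l
    using mult_mono[of 1 "2 * real (Suc l)" 1 "2 * real (Suc l) - 1"] by (simp add: c_def)
  have s: "(\<lambda>l. t ^ (2 * Suc l) / c l) sums binary_entropy_defect t" if "\<bar>t\<bar> \<le> 1" for t
    unfolding c_def using that by (rule binary_entropy_defect_sums)
  have "(\<lambda>l. ((A + B) ^ (2 * Suc l) / c l + (A - B) ^ (2 * Suc l) / c l) / 2 -
      (A ^ (2 * Suc l) / c l + B ^ (2 * Suc l) / c l)) sums
    ((binary_entropy_defect (A + B) + binary_entropy_defect (A - B)) / 2 -
      (binary_entropy_defect A + binary_entropy_defect B))"
    using assms by (intro sums_diff sums_divide sums_add s) auto
  also have "(\<lambda>l. ((A + B) ^ (2 * Suc l) / c l + (A - B) ^ (2 * Suc l) / c l) / 2 -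
      (A ^ (2 * Suc l) / c l + B ^ (2 * Suc l) / c l)) = (\<lambda>l. F l / c l)"
    by (rule ext) (simp only: F_def diff_divide_distrib add_divide_distrib, simp)
  finally have sums: "(\<lambda>l. F l / c l) sums
    ((binary_entropy_defect (A + B) + binary_entropy_defect (A - B)) / 2 -
      (binary_entropy_defect A + binary_entropy_defect B))" (is "_ sums ?S") .
  have le: "\<bar>F l / c l\<bar> \<le> 80 * (A * B)\<^sup>2 * (1/4) ^ l" for l
  proof -
    have "\<bar>F l / c l\<bar> = \<bar>F l\<bar> / c l" using c[of l] by (simp add: abs_divide)
    also have "\<dots> \<le> \<bar>F l\<bar> / 1" using c[of l] by (intro divide_left_mono) auto
    also have "\<dots> \<le> 80 * (A * B)\<^sup>2 * (1/4) ^ l"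
      using cross_power_bound[OF assms, of l] by (simp add: F_def mult_ac)
    finally show ?thesis .
  qed
  have geo: "(\<lambda>l. 80 * (A * B)\<^sup>2 * (1/4) ^ l) sums (80 * (A * B)\<^sup>2 * (1 / (1 - 1/4)))"
    by (intro sums_mult geometric_sums) simp
  have "?S \<le> 80 * (A * B)\<^sup>2 * (1 / (1 - 1/4))"
    by (rule sums_le[OF order_trans[OF abs_ge_self le] sums geo])
  moreover have "- ?S \<le> 80 * (A * B)\<^sup>2 * (1 / (1 - 1/4))"
    by (rule sums_le[OF order_trans[OF abs_ge_minus_self le] sums_minus[OF sums] geo])
  ultimately have "\<bar>?S\<bar> \<le> 80 * (A * B)\<^sup>2 * (1 / (1 - 1/4))" by linarith
  also have "\<dots> \<le> 320 * (A * B)\<^sup>2" by simp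
  finally show ?thesis by (simp only: abs_minus_commute[of "(_ + _) / 2"])
qed

section \<open>Comparing the exponent with \<open>s0\<close> and with its truncation\<close>

text \<open>For \<open>A = (x + y)/n\<close> and \<open>B = (y - x)/n\<close> one has
  \<open>A + B = 2y/n\<close> and \<open>A - B = 2x/n\<close>, so the two exponents differ by
  \<open>n\<close> times the cross term. It is of size
  \<open>n (A B)^2 = (y^2 - x^2)^2/n^3\<close>.\<close>

lemma walk_exponent_minus_s0:
  assumes n: "n \<ge> 1" and R: "reachable n x y"
    and xy: "\<bar>real_of_int x\<bar> + \<bar>real_of_int y\<bar> \<le> real n / 4"
  shows "\<bar>walk_exponent n x y - s0 n x y\<bar> \<le>
    320 * (((real_of_int y)\<^sup>2 - (real_of_int x)\<^sup>2)\<^sup>2 / real n ^ 3)"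
proof -
  define N where "N = real n"
  have N: "N \<ge> 1" using n by (simp add: N_def)
  define A where "A = real_of_int (x + y) / N"
  define B where "B = real_of_int (y - x) / N"
  have "\<bar>real_of_int (x + y)\<bar> \<le> N / 4" "\<bar>real_of_int (y - x)\<bar> \<le> N / 4"
    using xy unfolding N_def by linarith+
  hence AB: "\<bar>A\<bar> \<le> 1/4" "\<bar>B\<bar> \<le> 1/4" using N by (simp_all add: A_def B_def abs_divide divide_le_eq)
  have eqs: "A + B = real_of_int (2 * y) / N" "A - B = real_of_int (2 * x) / N"
    by (simp_all add: A_def B_def flip: add_divide_distrib diff_divide_distrib)
  have "\<bar>A - B\<bar> \<le> 1" "\<bar>A + B\<bar> \<le> 1" using AB by linarith+
  hence s0: "s0 n x y = N / 2 * (binary_entropy_defect (A - B) + binary_entropy_defect (A + B))"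
    unfolding eqs N_def by (intro s0_eq n)
  have w: "walk_exponent n x y = N * (binary_entropy_defect A + binary_entropy_defect B)"
    unfolding A_def B_def N_def by (rule walk_exponent_eq[OF n R])
  have "walk_exponent n x y - s0 n x y = N * (binary_entropy_defect A + binary_entropy_defect B -
     (binary_entropy_defect (A + B) + binary_entropy_defect (A - B)) / 2)"
    unfolding s0 w by (simp add: field_simps)
  hence "\<bar>walk_exponent n x y - s0 n x y\<bar> = N * \<bar>binary_entropy_defect A + binary_entropy_defect B -
     (binary_entropy_defect (A + B) + binary_entropy_defect (A - B)) / 2\<bar>"
    using N by (simp add: abs_mult)
  also have "\<dots> \<le> N * (320 * (A * B)\<^sup>2)"
    using N binary_entropy_defect_cross[OF AB] by (intro mult_left_mono) auto
  also have "A * B = ((real_of_int y)\<^sup>2 - (real_of_int x)\<^sup>2) / N\<^sup>2"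
    by (simp add: A_def B_def power2_eq_square algebra_simps)
  also have "N * (320 * (((real_of_int y)\<^sup>2 - (real_of_int x)\<^sup>2) / N\<^sup>2)\<^sup>2) =
      320 * (((real_of_int y)\<^sup>2 - (real_of_int x)\<^sup>2)\<^sup>2 / N ^ 3)"
    using N by (simp add: power_divide power_numeral_reduce)
  finally show ?thesis by (simp add: N_def)
qed

text \<open>As \<open>(2x/n)^2\<close> and \<open>(2y/n)^2\<close> are at most \<open>1/4\<close>,
  the tail is dominated by a geometric series starting at the term of index \<open>K\<close>. The
  sign matters as well: a nonnegative tail means that truncation can only enlarge the
  exponential.\<close>

lemma s0_tail:
  assumes n: "n \<ge> 1" and xy: "\<bar>real_of_int x\<bar> + \<bar>real_of_int y\<bar> \<le> real n / 4" and K: "K \<ge> 1"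
  shows "0 \<le> s0 n x y - (\<Sum>l=1..K-1. s0_term n x y l)"
    and "s0 n x y - (\<Sum>l=1..K-1. s0_term n x y l) \<le>
      4 ^ K * (((real_of_int x)\<^sup>2 + (real_of_int y)\<^sup>2) ^ K / real n ^ (2 * K - 1))"
proof -
  define N where "N = real n"
  have N: "N \<ge> 1" using n by (simp add: N_def)
  obtain k where k: "K = Suc k" using K by (cases K) auto
  define a where "a = (real_of_int (2 * x) / N)\<^sup>2"
  define b where "b = (real_of_int (2 * y) / N)\<^sup>2"
  have small: "\<bar>real_of_int (2 * x) / N\<bar> \<le> \<bar>1/2\<bar>" "\<bar>real_of_int (2 * y) / N\<bar> \<le> \<bar>1/2\<bar>"
    using xy N by (auto simp: abs_divide divide_le_eq abs_mult N_def)
  hence "a \<le> (1/2)\<^sup>2" "b \<le> (1/2)\<^sup>2" unfolding a_def b_def by (simp_all only: abs_le_square_iff)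
  hence ab: "0 \<le> a" "a \<le> 1/4" "0 \<le> b" "b \<le> 1/4"
    by (simp_all add: a_def b_def power2_eq_square[of "1/2"])
  have "(\<lambda>l. s0_term n x y (Suc l)) sums s0 n x y"
  proof -
    have small1: "\<bar>real_of_int (2 * x) / real n\<bar> \<le> 1" "\<bar>real_of_int (2 * y) / real n\<bar> \<le> 1"
      using small unfolding N_def by linarith+
    from s0_sums[OF n this] show ?thesis unfolding s0_eq[OF n small1] .
  qed
  from sums_split_initial_segment[OF this, of k]
  have "(\<lambda>l. s0_term n x y (Suc (l + k))) sums (s0 n x y - (\<Sum>l<k. s0_term n x y (Suc l)))" .
  moreover have "(\<Sum>l<k. s0_term n x y (Suc l)) = (\<Sum>l=1..K-1. s0_term n x y l)"
    by (rule sum.reindex_bij_witness[of _ "\<lambda>l. l - 1" Suc]) (auto simp: k)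
  ultimately have sums: "(\<lambda>l. s0_term n x y (Suc (l + k))) sums (s0 n x y - (\<Sum>l=1..K-1. s0_term n x y l))"
    by simp
  show "0 \<le> s0 n x y - (\<Sum>l=1..K-1. s0_term n x y l)"
    by (rule sums_le[OF _ sums_zero sums]) (rule s0_term_nonneg)
  have le: "s0_term n x y (Suc (l + k)) \<le> (N / 2 * (a ^ K + b ^ K)) * (1/4) ^ l" for l
  proof -
    define m where "m = Suc (l + k)"
    have m: "m = l + K" by (simp add: m_def k)
    define c where "c = 2 * real m * (2 * real m - 1)"
    have c: "c \<ge> 1" using mult_mono[of 1 "2 * real m" 1 "2 * real m - 1"] by (simp add: c_def m_def)
    have "s0_term n x y m = N / 2 * (a ^ m / c + b ^ m / c)"
      using s0_term_Suc[OF n, of x y "l + k"]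
      by (simp only: m_def a_def b_def c_def N_def power_mult)
    also have "\<dots> \<le> N / 2 * (a ^ K * (1/4) ^ l + b ^ K * (1/4) ^ l)"
    proof -
      have *: "t ^ m / c \<le> t ^ K * (1/4) ^ l" if "0 \<le> t" "t \<le> 1/4" for t
      proof -
        have "t ^ m / c \<le> t ^ m / 1" using c that by (intro divide_left_mono) auto
        also have "\<dots> = t ^ K * t ^ l" by (simp add: m power_add)
        also have "\<dots> \<le> t ^ K * (1/4) ^ l" using that by (intro mult_left_mono power_mono) auto
        finally show ?thesis .
      qed
      show ?thesis using N ab by (intro mult_left_mono add_mono *) auto
    qed
    finally show ?thesis by (simp add: m_def algebra_simps)
  qed
  have geo: "(\<lambda>l. (N / 2 * (a ^ K + b ^ K)) * (1/4) ^ l) sums ((N / 2 * (a ^ K + b ^ K)) * (1 / (1 - 1/4)))"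
    by (intro sums_mult geometric_sums) simp
  define r where "r = (real_of_int x)\<^sup>2 + (real_of_int y)\<^sup>2"
  have abr: "a + b = 4 * r / N\<^sup>2"
    by (simp add: a_def b_def r_def power_divide power_mult_distrib add_divide_distrib distrib_left)
  have "s0 n x y - (\<Sum>l=1..K-1. s0_term n x y l) \<le> (N / 2 * (a ^ K + b ^ K)) * (1 / (1 - 1/4))"
    by (rule sums_le[OF le sums geo])
  also have "\<dots> = N * (2/3 * (a ^ K + b ^ K))" by simp
  also have "\<dots> \<le> N * (a + b) ^ K"
  proof (intro mult_left_mono)
    \<comment> \<open>Superadditivity of powers merges the two coordinates into
      \<open>x^2 + y^2\<close>.\<close>
    have "a ^ Suc j + b ^ Suc j \<le> (a + b) ^ Suc j" for j
    proof (induction j)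
      case (Suc j)
      have "a ^ Suc (Suc j) + b ^ Suc (Suc j) \<le> (a + b) * (a ^ Suc j + b ^ Suc j)"
        using ab by (simp add: algebra_simps)
      also have "\<dots> \<le> (a + b) * (a + b) ^ Suc j" using Suc ab by (intro mult_left_mono) auto
      finally show ?case by simp
    qed simp
    from this[of k] show "2/3 * (a ^ K + b ^ K) \<le> (a + b) ^ K"
      using ab by (simp add: k) (smt (verit) mult_nonneg_nonneg zero_le_power)
  qed (use N in auto)
  also have "\<dots> = 4 ^ K * (r ^ K / N ^ (2 * K - 1))"
  proof -
    have "N ^ (2 * K) = N * N ^ (2 * K - 1)" by (simp add: k)
    thus ?thesis using N unfolding abr
      by (simp add: power_divide power_mult_distrib flip: power_mult)
  qed
  finally show "s0 n x y - (\<Sum>l=1..K-1. s0_term n x y l) \<le>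
      4 ^ K * (((real_of_int x)\<^sup>2 + (real_of_int y)\<^sup>2) ^ K / real n ^ (2 * K - 1))"
    by (simp add: r_def N_def)
qed

text \<open>Combines the error \<open>e\<close> of the prefactor with the error
  \<open>exp t - 1\<close> made by passing from \<open>walk_exponent\<close> to \<open>s0\<close>.
  The exponent \<open>332\<close> is \<open>12 + 320\<close>: the first part belongs to the
  prefactor constant, the second bounds \<open>t\<close>.\<close>

lemma planar_srw_prob_s0:
  assumes srw: "planar_srw M S" and n: "n \<ge> 1" and even: "even (x + y + int n)"
    and xy: "\<bar>real_of_int x\<bar> + \<bar>real_of_int y\<bar> \<le> real n / 4"
    and z: "((real_of_int y)\<^sup>2 - (real_of_int x)\<^sup>2)\<^sup>2 / real n ^ 3 \<le> 1"
  shows "\<exists>e0 e2. \<bar>e0\<bar> \<le> 320 * exp 332 * abs ((real n + (real_of_int x)\<^sup>2 + (real_of_int y)\<^sup>2) / (real n)\<^sup>2) \<and>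
     \<bar>e2\<bar> \<le> 320 * exp 332 * abs (((real_of_int y)\<^sup>2 - (real_of_int x)\<^sup>2)\<^sup>2 / real n ^ 3) \<and>
     \<P>(\<omega> in M. S n \<omega> = (x, y)) = 2 / (pi * real n) * exp (- s0 n x y) * (1 + e0 + e2)"
proof -
  define q where "q = (real n + (real_of_int x)\<^sup>2 + (real_of_int y)\<^sup>2) / (real n)\<^sup>2"
  define z where "z = ((real_of_int y)\<^sup>2 - (real_of_int x)\<^sup>2)\<^sup>2 / real n ^ 3"
  have z0: "0 \<le> z" by (simp add: z_def)
  have "\<bar>real_of_int x\<bar> + \<bar>real_of_int y\<bar> \<le> real n / 2" using xy by linarith
  from walk_prefactor_origin[OF n even this]
  obtain e where e: "\<bar>e\<bar> \<le> 4 * exp 12 * \<bar>q\<bar>" "walk_prefactor x y n = 2 / (pi * real n) * (1 + e)"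
    by (auto simp: q_def)
  have "\<bar>x\<bar> + \<bar>y\<bar> \<le> int n" using xy by linarith
  with even have R: "reachable n x y" by (simp add: reachable_def)
  define t where "t = s0 n x y - walk_exponent n x y"
  have t: "\<bar>t\<bar> \<le> 320 * z"
    using walk_exponent_minus_s0[OF n R xy] by (simp add: t_def z_def abs_minus_commute)
  define g where "g = exp t - 1"
  have g: "\<bar>g\<bar> \<le> 320 * exp 320 * z"
    using relative_error_of_exp[OF t _ z0, of 1] assms(5) by (simp add: g_def z_def)
  have "320 * z \<le> 320" using assms(5) by (simp add: z_def)
  hence "exp t \<le> exp 320" using t by simp
  hence "\<bar>e * exp t\<bar> \<le> (4 * exp 12 * \<bar>q\<bar>) * exp 320"
    unfolding abs_mult using e(1) by (intro mult_mono) auto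
  also have "\<dots> = 4 * exp 332 * \<bar>q\<bar>" by (simp flip: exp_add)
  also have "\<dots> \<le> 320 * exp 332 * \<bar>q\<bar>" by (intro mult_right_mono) auto
  finally have e0: "\<bar>e * exp t\<bar> \<le> 320 * exp 332 * \<bar>q\<bar>" .
  have "320 * exp 320 * z \<le> 320 * exp 332 * z" using z0 by (intro mult_right_mono) auto
  hence e2: "\<bar>g\<bar> \<le> 320 * exp 332 * \<bar>z\<bar>" using g z0 by simp
  have "\<P>(\<omega> in M. S n \<omega> = (x, y)) = 2 / (pi * real n) * (1 + e) * exp (- walk_exponent n x y)"
    unfolding planar_srw_prob_reachable[OF srw n R] e(2) ..
  also have "exp (- walk_exponent n x y) = exp (- s0 n x y) * exp t"
    by (simp add: t_def flip: exp_add)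
  \<comment> \<open>Writing \<open>(1 + e) exp t\<close> as \<open>1 + e exp t + (exp t - 1)\<close>
    leaves no mixed term to be distributed.\<close>
  also have "2 / (pi * real n) * (1 + e) * (exp (- s0 n x y) * exp t) =
      2 / (pi * real n) * exp (- s0 n x y) * (1 + e * exp t + g)"
    unfolding g_def by (simp add: algebra_simps)
  finally show ?thesis using e0 e2 unfolding q_def z_def by blast
qed

section \<open>Local limit statements for all \<open>n \<ge> 2\<close>\<close>

text \<open>The error quantity is positive for \<open>n \<ge> 1\<close>, so the sum of the finitely
  many quotients serves as \<open>C\<close>. This replaces "eventually" by all
  \<open>n\<close>.\<close>

lemma finite_relative_error:
  fixes g :: "nat \<Rightarrow> int \<Rightarrow> int \<Rightarrow> real"
  assumes "finite T"
  shows "\<exists>C\<ge>0. \<forall>n x y. (n, x, y) \<in> T \<and> n \<ge> 1 \<longrightarrow>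
    \<bar>g n x y\<bar> \<le> C * abs ((real n + (real_of_int x)\<^sup>2 + (real_of_int y)\<^sup>2) / (real n)\<^sup>2)"
proof -
  define q where "q n x y = \<bar>(real n + (real_of_int x)\<^sup>2 + (real_of_int y)\<^sup>2) / (real n)\<^sup>2\<bar>"
    for n :: nat and x y :: int
  define C where "C = (\<Sum>(n, x, y)\<in>T. \<bar>g n x y\<bar> / q n x y)"
  have q0: "q n x y \<ge> 0" for n x y by (simp add: q_def)
  have "C \<ge> 0" unfolding C_def by (intro sum_nonneg) (auto simp: q0)
  moreover have "\<bar>g n x y\<bar> \<le> C * q n x y" if "(n, x, y) \<in> T" "n \<ge> 1" for n x y
  proof -
    have "real n + (real_of_int x)\<^sup>2 + (real_of_int y)\<^sup>2 > 0"
      using that by (intro add_pos_nonneg) auto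
    hence q: "q n x y > 0" using that by (simp add: q_def)
    have "(\<lambda>(n, x, y). \<bar>g n x y\<bar> / q n x y) (n, x, y) \<le> C"
      unfolding C_def using that assms by (intro member_le_sum) (auto simp: q0)
    thus ?thesis using q by (simp add: field_simps)
  qed
  ultimately show ?thesis unfolding q_def by blast
qed

lemma abs_sum_le_of_sum_squares:
  fixes x y N :: real
  assumes "x\<^sup>2 + y\<^sup>2 \<le> (N / 8)\<^sup>2" "0 \<le> N"
  shows "\<bar>x\<bar> + \<bar>y\<bar> \<le> N / 4"
proof -
  have "sqrt (x\<^sup>2 + y\<^sup>2) \<le> N / 8" using assms by (intro real_le_lsqrt) auto
  moreover have "\<bar>x\<bar> \<le> sqrt (x\<^sup>2 + y\<^sup>2)" "\<bar>y\<bar> \<le> sqrt (x\<^sup>2 + y\<^sup>2)"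
    by (rule real_sqrt_ge_abs1 real_sqrt_ge_abs2)+
  ultimately show ?thesis by linarith
qed

lemma square_over_cube_le_1:
  assumes "n \<ge> 3" "\<bar>d\<bar> \<le> real n powr (3/2) / ln (real n)"
  shows "d\<^sup>2 / real n ^ 3 \<le> 1"
proof -
  have "exp 1 \<le> real n" using exp_le assms(1) by linarith
  hence ln1: "ln (real n) \<ge> 1" using assms(1) by (subst ln_ge_iff) auto
  have "\<bar>d\<bar> \<le> real n powr (3/2) / 1"
    using assms(2) by (rule order_trans) (use ln1 in \<open>intro divide_left_mono; simp\<close>)
  hence "d\<^sup>2 \<le> (real n powr (3/2))\<^sup>2" by (intro real_square_le) simp
  also have "\<dots> = real n powr 3" by (simp add: power2_eq_square flip: powr_add)
  also have "\<dots> = real n ^ 3" using assms(1) by (simp add: powr_numeral)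
  finally show ?thesis using assms(1) by (simp add: divide_le_eq)
qed

lemma planar_srw_local_s0:
  assumes srw: "planar_srw M S"
  shows "\<exists>C. \<forall>n\<ge>2. \<forall>x y.
        even (x + y + int n) \<and>
        (real_of_int x)\<^sup>2 + (real_of_int y)\<^sup>2 \<le> (real n)\<^sup>2 / ln (real n) ^ 4 \<and>
        \<bar>(real_of_int y)\<^sup>2 - (real_of_int x)\<^sup>2\<bar> \<le> real n powr (3/2) / ln (real n) \<longrightarrow>
          (\<exists>e0 e1 e2. \<bar>e0\<bar> \<le> C * abs ((real n + (real_of_int x)\<^sup>2 + (real_of_int y)\<^sup>2) / (real n)\<^sup>2) \<and>
            \<bar>e1\<bar> \<le> C * abs (((real_of_int y)\<^sup>2 - (real_of_int x)\<^sup>2) / (real n)\<^sup>2) \<and>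
            \<bar>e2\<bar> \<le> C * abs (((real_of_int y)\<^sup>2 - (real_of_int x)\<^sup>2)\<^sup>2 / real n ^ 3) \<and>
            \<P>(\<omega> in M. S n \<omega> = (x, y)) = 2 / (pi * real n) * exp (- s0 n x y) * (1 + e0 + e1 + e2))"
proof -
  txt \<open>Below \<open>n0\<close> only finitely many points are admissible, and \<open>e0\<close> absorbs the whole error there.\<close>
  define n0 where "n0 = nat \<lceil>exp (3 :: real)\<rceil>"
  \<comment> \<open>Bounds \<open>x^2 + y^2\<close> for \<open>2 \<le> n < n0\<close>, since
    \<open>ln n \<ge> ln 2\<close>; the coordinates being integers, it also bounds
    \<open>|x|\<close> and \<open>|y|\<close>.\<close>
  define Z where "Z = \<lceil>(real n0)\<^sup>2 / ln 2 ^ 4\<rceil>"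
  \<comment> \<open>The exact relative error. Where the series diverges, \<open>s0\<close> has its
    default value, but the main term is still positive and \<open>g\<close> makes sense.\<close>
  define g where "g n x y = \<P>(\<omega> in M. S n \<omega> = (x, y)) / (2 / (pi * real n) * exp (- s0 n x y)) - 1"
    for n x y
  obtain C where C: "C \<ge> 0" "\<And>n x y. (n, x, y) \<in> {..<n0} \<times> {-Z..Z} \<times> {-Z..Z} \<Longrightarrow> n \<ge> 1 \<Longrightarrow>
    \<bar>g n x y\<bar> \<le> C * abs ((real n + (real_of_int x)\<^sup>2 + (real_of_int y)\<^sup>2) / (real n)\<^sup>2)"
    using finite_relative_error[of "{..<n0} \<times> {-Z..Z} \<times> {-Z..Z}" g] by auto
  show ?thesis
  proof (rule exI[of _ "max C (320 * exp 332)"], intro allI impI, elim conjE, goal_cases)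
    case (1 n x y)
    show ?case
    proof (cases "n < n0")
      case True
      have "ln (real n) \<ge> ln 2" using 1(1) by simp
      hence "(real n)\<^sup>2 / ln (real n) ^ 4 \<le> (real n0)\<^sup>2 / ln 2 ^ 4"
        using 1(1) True by (intro frac_le power_mono) auto
      hence r: "(real_of_int x)\<^sup>2 + (real_of_int y)\<^sup>2 \<le> real_of_int Z" using 1(3) unfolding Z_def by linarith
      have "real_of_int (x\<^sup>2 + y\<^sup>2) \<le> real_of_int Z" using r by simp
      hence rZ: "x\<^sup>2 + y\<^sup>2 \<le> Z" by (simp only: of_int_le_iff)
      have sq: "\<bar>t\<bar> \<le> t\<^sup>2" for t :: int
        using mult_left_mono[of 1 "\<bar>t\<bar>" "\<bar>t\<bar>"] by (cases "t = 0") (auto simp: power2_eq_square)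
      have "\<bar>x\<bar> \<le> Z" "\<bar>y\<bar> \<le> Z"
        using rZ sq[of x] sq[of y] zero_le_power2[of x] zero_le_power2[of y] by linarith+
      hence "(n, x, y) \<in> {..<n0} \<times> {-Z..Z} \<times> {-Z..Z}" using True by auto
      from C(2)[OF this] 1(1)
      have "\<bar>g n x y\<bar> \<le> C * abs ((real n + (real_of_int x)\<^sup>2 + (real_of_int y)\<^sup>2) / (real n)\<^sup>2)" by simp
      also have "\<dots> \<le> max C (320 * exp 332) * abs ((real n + (real_of_int x)\<^sup>2 + (real_of_int y)\<^sup>2) / (real n)\<^sup>2)"
        by (intro mult_right_mono) auto
      finally show ?thesis
        by - (rule exI[of _ "g n x y"], rule exI[of _ 0], rule exI[of _ 0],
          use 1(1) C(1) in \<open>simp add: g_def\<close>)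
    next
      case False
      hence "exp 3 \<le> real n" unfolding n0_def by linarith
      \<comment> \<open>The threshold \<open>exp 3\<close> gives
        \<open>ln^4 n \<ge> 81 \<ge> 64\<close>, hence \<open>x^2 + y^2 \<le> (n/8)^2\<close>, which
        places the point within \<open>|x| + |y| \<le> n/4\<close>.\<close>
      hence "ln (real n) \<ge> 3" using 1(1) by (subst ln_ge_iff) auto
      hence "ln (real n) ^ 4 \<ge> 3 ^ 4" by (intro power_mono) auto
      hence "(real n)\<^sup>2 / ln (real n) ^ 4 \<le> (real n)\<^sup>2 / 64" by (intro divide_left_mono) auto
      also have "(real n)\<^sup>2 / 64 = (real n / 8)\<^sup>2" by (simp add: power_divide)
      finally have "(real_of_int x)\<^sup>2 + (real_of_int y)\<^sup>2 \<le> (real n / 8)\<^sup>2"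
        by (rule order_trans[OF 1(3)])
      from abs_sum_le_of_sum_squares[OF this]
      have xy: "\<bar>real_of_int x\<bar> + \<bar>real_of_int y\<bar> \<le> real n / 4" by simp
      have "exp 3 \<ge> (1 + 3 :: real)" by (rule exp_ge_add_one_self)
      with \<open>exp 3 \<le> real n\<close> have n3: "n \<ge> 3" by linarith
      obtain e0 e2 where e: "\<bar>e0\<bar> \<le> 320 * exp 332 * abs ((real n + (real_of_int x)\<^sup>2 + (real_of_int y)\<^sup>2) / (real n)\<^sup>2)"
        "\<bar>e2\<bar> \<le> 320 * exp 332 * abs (((real_of_int y)\<^sup>2 - (real_of_int x)\<^sup>2)\<^sup>2 / real n ^ 3)"
        "\<P>(\<omega> in M. S n \<omega> = (x, y)) = 2 / (pi * real n) * exp (- s0 n x y) * (1 + e0 + e2)"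
        using planar_srw_prob_s0[OF srw _ 1(2) xy square_over_cube_le_1[OF n3 1(4)]] n3 by auto
      have "320 * exp 332 * \<bar>t\<bar> \<le> max C (320 * exp 332) * \<bar>t\<bar>" for t :: real
        by (intro mult_right_mono) auto
      hence b: "\<bar>e0\<bar> \<le> max C (320 * exp 332) * abs ((real n + (real_of_int x)\<^sup>2 + (real_of_int y)\<^sup>2) / (real n)\<^sup>2)"
        "\<bar>e2\<bar> \<le> max C (320 * exp 332) * abs (((real_of_int y)\<^sup>2 - (real_of_int x)\<^sup>2)\<^sup>2 / real n ^ 3)"
        using e(1,2) order_trans by blast+
      show ?thesis
        by (rule exI[of _ e0], rule exI[of _ 0], rule exI[of _ e2], intro conjI b) (use e(3) C(1) in simp_all)
    qed
  qed
qed

text \<open>Every admissible \<open>a\<close> gives \<open>n^a \<le> n^(1 - 1/(2N))\<close>, so a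
  single constant serves all \<open>a\<close>. The truncated tail is then a further relative error
  of the size of its bound in \<open>s0_tail\<close>.\<close>

lemma planar_srw_local_truncated:
  assumes srw: "planar_srw M S" and N: "N \<ge> 2"
  shows "\<exists>C. \<forall>a :: real. a < (2 * real N - 1) / (2 * real N) \<longrightarrow> (\<forall>n\<ge>2. \<forall>x y.
        even (x + y + int n) \<and>
        sqrt ((real_of_int x)\<^sup>2 + (real_of_int y)\<^sup>2) \<le> real n powr a \<and>
        \<bar>(real_of_int y)\<^sup>2 - (real_of_int x)\<^sup>2\<bar> \<le> real n powr (3/2) / ln (real n) \<longrightarrow>
          (\<exists>e0 e1 e2 e3. \<bar>e0\<bar> \<le> C * abs ((real n + (real_of_int x)\<^sup>2 + (real_of_int y)\<^sup>2) / (real n)\<^sup>2) \<and>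
            \<bar>e1\<bar> \<le> C * abs (((real_of_int y)\<^sup>2 - (real_of_int x)\<^sup>2) / (real n)\<^sup>2) \<and>
            \<bar>e2\<bar> \<le> C * abs (((real_of_int y)\<^sup>2 - (real_of_int x)\<^sup>2)\<^sup>2 / real n ^ 3) \<and>
            \<bar>e3\<bar> \<le> C * abs (((real_of_int x)\<^sup>2 + (real_of_int y)\<^sup>2) ^ N / real n ^ (2 * N - 1)) \<and>
            \<P>(\<omega> in M. S n \<omega> = (x, y)) = 2 / (pi * real n) * exp (- (\<Sum>l=1..N-1. s0_term n x y l)) * (1 + e0 + e1 + e2 + e3)))"
proof -
  \<comment> \<open>From here on \<open>n^(1/(2N)) \<ge> 8\<close>, so the points lie within
    distance \<open>n/8\<close> of the origin.\<close>
  define n0 :: nat where "n0 = 64 ^ N"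
  define T where "T = {..<n0} \<times> {- int n0..int n0} \<times> {- int n0..int n0}"
  define g where "g n x y = \<P>(\<omega> in M. S n \<omega> = (x, y)) /
      (2 / (pi * real n) * exp (- (\<Sum>l=1..N-1. s0_term n x y l))) - 1" for n x y
  obtain C where C: "C \<ge> 0" "\<And>n x y. (n, x, y) \<in> T \<Longrightarrow> n \<ge> 1 \<Longrightarrow>
    \<bar>g n x y\<bar> \<le> C * abs ((real n + (real_of_int x)\<^sup>2 + (real_of_int y)\<^sup>2) / (real n)\<^sup>2)"
    using finite_relative_error[of T g] by (auto simp: T_def)
  define D where "D = max C (max (320 * exp 332) (4 ^ N))"
  have D: "C \<le> D" "320 * exp 332 \<le> D" "4 ^ N \<le> D" "0 \<le> D" using C(1) by (auto simp: D_def)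
  have Dmono: "c * \<bar>t\<bar> \<le> D * \<bar>t\<bar>" if "c \<le> D" for c t :: real
    using that by (intro mult_right_mono) auto
  show ?thesis
  proof (rule exI[of _ D], intro allI impI, elim conjE, goal_cases)
    case (1 a n x y)
    define \<rho> where "\<rho> = sqrt ((real_of_int x)\<^sup>2 + (real_of_int y)\<^sup>2)"
    have "\<rho> \<le> real n powr a" using 1 by (simp add: \<rho>_def)
    also have "\<dots> \<le> real n powr ((2 * real N - 1) / (2 * real N))" using 1 by (intro powr_mono) auto
    also have "(2 * real N - 1) / (2 * real N) = 1 - 1 / (2 * real N)" using N by (simp add: field_simps)
    finally have \<rho>: "\<rho> \<le> real n powr (1 - 1 / (2 * real N))" .
    show ?case
    proof (cases "n < n0")
      case True
      note \<rho>
      also have "real n powr (1 - 1 / (2 * real N)) \<le> real n powr 1" using 1 by (intro powr_mono) auto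
      also have "\<dots> = real n" using 1 by simp
      finally have \<rho>n: "\<rho> \<le> real n" .
      have "\<bar>real_of_int x\<bar> \<le> \<rho>" "\<bar>real_of_int y\<bar> \<le> \<rho>"
        unfolding \<rho>_def by (rule real_sqrt_ge_abs1 real_sqrt_ge_abs2)+
      hence "\<bar>x\<bar> \<le> int n" "\<bar>y\<bar> \<le> int n" using \<rho>n by linarith+
      hence "(n, x, y) \<in> T" using True by (auto simp: T_def)
      from C(2)[OF this] 1(2)
      have "\<bar>g n x y\<bar> \<le> C * abs ((real n + (real_of_int x)\<^sup>2 + (real_of_int y)\<^sup>2) / (real n)\<^sup>2)" by simp
      also have "\<dots> \<le> D * abs ((real n + (real_of_int x)\<^sup>2 + (real_of_int y)\<^sup>2) / (real n)\<^sup>2)"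
        by (rule Dmono[OF D(1)])
      finally show ?thesis
        by - (rule exI[of _ "g n x y"], rule exI[of _ 0], rule exI[of _ 0], rule exI[of _ 0],
          use 1(2) D(4) in \<open>simp add: g_def\<close>)
    next
      case False
      hence n0: "64 ^ N \<le> n" by (simp add: n0_def)
      have n64: "64 \<le> n" using n0 N power_increasing[of 1 N "64 :: nat"] by simp
      have "(8 :: real) = (64 ^ N) powr (1 / (2 * real N))"
      proof -
        have "(64 :: real) ^ N = 8 powr (2 * real N)"
          using powr_realpow[of 8 "2 * N"] by (simp add: power_mult)
        thus ?thesis using N by (simp add: powr_powr)
      qed
      also have "\<dots> \<le> real n powr (1 / (2 * real N))"
        using of_nat_mono[OF n0, where 'a = real] by (intro powr_mono2) simp_all
      finally have "8 \<le> real n powr (1 / (2 * real N))" .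
      hence "real n / real n powr (1 / (2 * real N)) \<le> real n / 8"
        using n64 by (intro divide_left_mono) auto
      moreover have "real n powr (1 - 1 / (2 * real N)) = real n / real n powr (1 / (2 * real N))"
        using n64 by (simp add: powr_diff)
      ultimately have "\<rho> \<le> real n / 8" using \<rho> by linarith
      hence "\<rho>\<^sup>2 \<le> (real n / 8)\<^sup>2" by (intro power_mono) (auto simp: \<rho>_def)
      hence "(real_of_int x)\<^sup>2 + (real_of_int y)\<^sup>2 \<le> (real n / 8)\<^sup>2" by (simp add: \<rho>_def)
      from abs_sum_le_of_sum_squares[OF this]
      have xy: "\<bar>real_of_int x\<bar> + \<bar>real_of_int y\<bar> \<le> real n / 4" by simp
      have n3: "n \<ge> 3" and n1: "n \<ge> 1" using n64 by auto
      obtain e0 e2 where e: "\<bar>e0\<bar> \<le> 320 * exp 332 * abs ((real n + (real_of_int x)\<^sup>2 + (real_of_int y)\<^sup>2) / (real n)\<^sup>2)"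
        "\<bar>e2\<bar> \<le> 320 * exp 332 * abs (((real_of_int y)\<^sup>2 - (real_of_int x)\<^sup>2)\<^sup>2 / real n ^ 3)"
        "\<P>(\<omega> in M. S n \<omega> = (x, y)) = 2 / (pi * real n) * exp (- s0 n x y) * (1 + e0 + e2)"
        using planar_srw_prob_s0[OF srw n1 1(3) xy square_over_cube_le_1[OF n3 1(5)]] by auto
      define \<tau> where "\<tau> = s0 n x y - (\<Sum>l=1..N-1. s0_term n x y l)"
      have \<tau>: "0 \<le> \<tau>" "\<tau> \<le> 4 ^ N * (((real_of_int x)\<^sup>2 + (real_of_int y)\<^sup>2) ^ N / real n ^ (2 * N - 1))"
        unfolding \<tau>_def using s0_tail[OF n1 xy, of N] N by auto
      \<comment> \<open>The tail is nonnegative, so \<open>0 < h \<le> 1\<close>: multiplying by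
        \<open>h\<close> does not enlarge the earlier errors, and \<open>h - 1\<close> is bounded by
        the tail itself without any exponential constant.\<close>
      define h where "h = exp (- \<tau>)"
      have h: "0 \<le> h" "h \<le> 1" "1 - \<tau> \<le> h"
        using \<tau>(1) exp_ge_add_one_self[of "- \<tau>"] by (auto simp: h_def)
      have "\<bar>e0 * h\<bar> \<le> \<bar>e0\<bar>" "\<bar>e2 * h\<bar> \<le> \<bar>e2\<bar>"
        using h(1,2) by (simp_all add: abs_mult mult_left_le)
      hence b: "\<bar>e0 * h\<bar> \<le> D * abs ((real n + (real_of_int x)\<^sup>2 + (real_of_int y)\<^sup>2) / (real n)\<^sup>2)"
        "\<bar>e2 * h\<bar> \<le> D * abs (((real_of_int y)\<^sup>2 - (real_of_int x)\<^sup>2)\<^sup>2 / real n ^ 3)"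
        using order_trans[OF e(1) Dmono[OF D(2)]] order_trans[OF e(2) Dmono[OF D(2)]] by linarith+
      have "\<bar>h - 1\<bar> \<le> \<tau>" using h by linarith
      also have "\<dots> \<le> 4 ^ N * \<bar>((real_of_int x)\<^sup>2 + (real_of_int y)\<^sup>2) ^ N / real n ^ (2 * N - 1)\<bar>"
        using \<tau>(2) by simp
      also have "\<dots> \<le> D * \<bar>((real_of_int x)\<^sup>2 + (real_of_int y)\<^sup>2) ^ N / real n ^ (2 * N - 1)\<bar>"
        by (rule Dmono[OF D(3)])
      finally have b3: "\<bar>h - 1\<bar> \<le> D * \<bar>((real_of_int x)\<^sup>2 + (real_of_int y)\<^sup>2) ^ N / real n ^ (2 * N - 1)\<bar>" .
      have "exp (- s0 n x y) = exp (- (\<Sum>l=1..N-1. s0_term n x y l)) * h"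
        by (simp add: h_def \<tau>_def flip: exp_add)
      hence "\<P>(\<omega> in M. S n \<omega> = (x, y)) = 2 / (pi * real n) * exp (- (\<Sum>l=1..N-1. s0_term n x y l)) *
          (1 + e0 * h + 0 + e2 * h + (h - 1))"
        unfolding e(3) by (simp add: algebra_simps)
      thus ?thesis using D(4)
        by - (rule exI[of _ "e0 * h"], rule exI[of _ 0], rule exI[of _ "e2 * h"],
            rule exI[of _ "h - 1"], intro conjI b b3, simp_all)
    qed
  qed
qed

theorem theorem2p2:
  fixes M :: "'a measure" and S :: "nat \<Rightarrow> 'a \<Rightarrow> int \<times> int"
  assumes srw: "planar_srw M S"
  shows "(\<exists>f :: int \<Rightarrow> int \<Rightarrow> nat \<Rightarrow> real.
     (\<forall>n\<ge>1. \<forall>x y. reachable n x y \<longrightarrow>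
        \<P>(\<omega> in M. S n \<omega> = (x, y)) = f x y n * exp (- walk_exponent n x y)) \<and>
     (\<forall>n\<ge>1. \<forall>x y. reachable n x y \<longrightarrow>
        f (- x) y n = f x y n \<and> f x (- y) n = f x y n \<and> f y x n = f x y n) \<and>
     (\<exists>C. \<forall>x y :: nat \<Rightarrow> int.
        (\<lambda>n. real_of_int (\<bar>x n\<bar> + \<bar>y n\<bar>)) \<in> o(\<lambda>n. real n) \<longrightarrow>
        (\<forall>\<^sub>F n in sequentially.
          0 \<le> x n \<and> x n \<le> y n \<and> reachable n (x n) (y n) \<longrightarrow>
          (\<exists>e. \<bar>e\<bar> \<le> C * abs ((real n + (real_of_int (x n))\<^sup>2 + (real_of_int (y n))\<^sup>2) / (real n)\<^sup>2) \<and>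
            f (x n) (y n) n = 2 / (pi * real n) * (1 + e)))) \<and>
     (\<forall>a :: real. 0 < a \<and> a < 1/2 \<longrightarrow> (\<exists>C. \<forall>la la' :: nat \<Rightarrow> real.
        la \<in> o(\<lambda>n. real n) \<and>
        la' \<in> o(\<lambda>n. real n) \<longrightarrow>
        (\<forall>\<^sub>F n in sequentially. \<forall>x y.
          0 \<le> x \<and> x \<le> y \<and> reachable n x y \<and>
          real_of_int x = a * real n + la n \<and>
          real_of_int y = a * real n + la' n \<longrightarrow>
          (\<exists>e. \<bar>e\<bar> \<le> C * abs ((real n * \<bar>la n + la' n\<bar> + real n + (la' n - la n)\<^sup>2) / (real n)\<^sup>2) \<and>
            f x y n = 2 / (pi * real n * sqrt (1 - 4 * a\<^sup>2)) * (1 + e))))) \<and>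
     (\<forall>b :: real. 0 < b \<and> b < 1 \<longrightarrow> (\<exists>C. \<forall>(l1 :: nat \<Rightarrow> int) (lb :: nat \<Rightarrow> real).
        (\<lambda>n. real_of_int (l1 n)) \<in> o(\<lambda>n. real n) \<and>
        lb \<in> o(\<lambda>n. real n) \<longrightarrow>
        (\<forall>\<^sub>F n in sequentially. \<forall>x y.
          0 \<le> x \<and> x \<le> y \<and> reachable n x y \<and>
          real_of_int x = real_of_int (l1 n) \<and>
          real_of_int y = b * real n + lb n \<longrightarrow>
          (\<exists>e1 e2. \<bar>e1\<bar> \<le> C * abs ((\<bar>real_of_int (l1 n)\<bar> + \<bar>lb n\<bar>) / real n) \<and>
            \<bar>e2\<bar> \<le> C * abs (1 / real n) \<and>
            f x y n = 2 / (pi * real n * (1 - b\<^sup>2)) * (1 + e1 + e2))))) \<and>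
     (\<forall>ax ay :: real. 0 < ax \<and> ax < ay \<and> ay < 1 \<and> ax + ay < 1 \<longrightarrow> (\<exists>C. \<forall>lx ly :: nat \<Rightarrow> real.
        lx \<in> o(\<lambda>n. real n) \<and>
        ly \<in> o(\<lambda>n. real n) \<longrightarrow>
        (\<forall>\<^sub>F n in sequentially. \<forall>x y.
          0 \<le> x \<and> x \<le> y \<and> reachable n x y \<and>
          real_of_int x = ax * real n + lx n \<and>
          real_of_int y = ay * real n + ly n \<longrightarrow>
          (\<exists>e1 e2. \<bar>e1\<bar> \<le> C * abs ((\<bar>lx n\<bar> + \<bar>ly n\<bar>) / real n) \<and>
            \<bar>e2\<bar> \<le> C * abs (1 / real n) \<and>
            f x y n = 2 / (pi * real n * sqrt (1 - 2 * (ax\<^sup>2 + ay\<^sup>2) + ((ay - ax) * (ax + ay))\<^sup>2)) * (1 + e1 + e2))))) \<and>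
     (\<exists>C. \<forall>(l1 :: nat \<Rightarrow> int) (l1' :: nat \<Rightarrow> int) (l3 :: nat \<Rightarrow> real).
        (\<lambda>n. real_of_int (l1 n)) \<in> o(\<lambda>n. real n) \<and>
        (\<lambda>n. real_of_int (l1' n)) \<in> o(\<lambda>n. real n) \<and>
        l3 \<in> o(\<lambda>n. real n) \<and>
        filterlim l3 at_top sequentially \<longrightarrow>
        (\<forall>\<^sub>F n in sequentially. \<forall>x y.
          0 \<le> x \<and> x \<le> y \<and> reachable n x y \<and>
          real_of_int x = real n / 2 + real_of_int (l1 n) \<and>
          real_of_int y = real n / 2 + real_of_int (l1' n) \<and>
          real_of_int (x + y) = real n - l3 n \<longrightarrow>
          (\<exists>e. \<bar>e\<bar> \<le> C * abs ((real_of_int (l1' n) - real_of_int (l1 n))\<^sup>2 / (real n)\<^sup>2 + l3 n / real n + 1 / l3 n) \<and>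
            f x y n = sqrt 2 / (pi * sqrt (real n * l3 n)) * (1 + e)))) \<and>
     (\<forall>ax ay :: real. 0 < ax \<and> ax < ay \<and> ay < 1 \<and> ax + ay \<le> 1 \<longrightarrow> (\<exists>C. \<forall>lx ly l3 :: nat \<Rightarrow> real.
        lx \<in> o(\<lambda>n. real n) \<and>
        ly \<in> o(\<lambda>n. real n) \<and>
        l3 \<in> o(\<lambda>n. real n) \<and>
        filterlim l3 at_top sequentially \<longrightarrow>
        (\<forall>\<^sub>F n in sequentially. \<forall>x y.
          0 \<le> x \<and> x \<le> y \<and> reachable n x y \<and>
          real_of_int x = ax * real n + lx n \<and>
          real_of_int y = ay * real n + ly n \<and>
          real_of_int (x + y) = real n - l3 n \<longrightarrow>
          (\<exists>e. \<bar>e\<bar> \<le> C * abs ((\<bar>ly n\<bar> + \<bar>lx n\<bar>) / real n + 1 / l3 n) \<and>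
            f x y n = sqrt 2 / (pi * sqrt (real n * (1 - (ay - ax)\<^sup>2) * l3 n)) * (1 + e))))) \<and>
     (\<exists>C. \<forall>(l1 :: nat \<Rightarrow> int) (l3 :: nat \<Rightarrow> real) (l3' :: nat \<Rightarrow> real).
        (\<lambda>n. real_of_int (l1 n)) \<in> o(\<lambda>n. real n) \<and>
        l3 \<in> o(\<lambda>n. real n) \<and>
        filterlim l3 at_top sequentially \<and>
        l3' \<in> o(\<lambda>n. real n) \<and>
        filterlim l3' at_top sequentially \<longrightarrow>
        (\<forall>\<^sub>F n in sequentially. \<forall>x y.
          0 \<le> x \<and> x \<le> y \<and> reachable n x y \<and>
          real_of_int x = real_of_int (l1 n) \<and>
          real_of_int y = real n - l3 n \<and>
          l3 n - real_of_int (l1 n) = l3' n \<longrightarrow>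
          (\<exists>e. \<bar>e\<bar> \<le> C * abs (l3 n / real n + 1 / \<bar>l3' n\<bar>) \<and>
            f x y n = 1 / (pi * sqrt ((l3 n)\<^sup>2 - (real_of_int (l1 n))\<^sup>2)) * (1 + e)))) \<and>
     (\<forall>c :: real. 0 < c \<longrightarrow> (\<exists>d\<in>stirling_range. (\<exists>C. \<forall>l1 l1' :: nat \<Rightarrow> int.
        (\<lambda>n. real_of_int (l1 n)) \<in> o(\<lambda>n. real n) \<and>
        (\<lambda>n. real_of_int (l1' n)) \<in> o(\<lambda>n. real n) \<longrightarrow>
        (\<forall>\<^sub>F n in sequentially. \<forall>x y.
          0 \<le> x \<and> x \<le> y \<and> reachable n x y \<and>
          real_of_int x = real n / 2 + real_of_int (l1 n) \<and>
          real_of_int y = real n / 2 + real_of_int (l1' n) \<and>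
          real_of_int (x + y) = real n - c \<longrightarrow>
          (\<exists>e. \<bar>e\<bar> \<le> C * abs (((real_of_int (l1' n) - real_of_int (l1 n))\<^sup>2 + real n) / (real n)\<^sup>2) \<and>
            f x y n = (d * sqrt 2 * exp (- 1 / (6 * c)) / (pi * sqrt (real n * c))) * (1 + e)))))) \<and>
     (\<forall>c :: real. 0 < c \<longrightarrow> (\<exists>d\<in>stirling_range. (\<forall>ax ay :: real. 0 < ax \<and> ax < ay \<and> ay < 1 \<and> ax + ay \<le> 1 \<longrightarrow> (\<exists>C. \<forall>lx ly :: nat \<Rightarrow> real.
        lx \<in> o(\<lambda>n. real n) \<and>
        ly \<in> o(\<lambda>n. real n) \<longrightarrow>
        (\<forall>\<^sub>F n in sequentially. \<forall>x y.
          0 \<le> x \<and> x \<le> y \<and> reachable n x y \<and>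
          real_of_int x = ax * real n + lx n \<and>
          real_of_int y = ay * real n + ly n \<and>
          real_of_int (x + y) = real n - c \<longrightarrow>
          (\<exists>e. \<bar>e\<bar> \<le> C * abs ((1 + \<bar>ly n - lx n\<bar>) / real n) \<and>
            f x y n = (d * sqrt 2 * exp (- 1 / (6 * c)) / (pi * sqrt (real n * c * (1 - (ay - ax)\<^sup>2)))) * (1 + e))))))) \<and>
     (\<forall>c :: real. 0 < c \<longrightarrow> (\<exists>d\<in>stirling_range. (\<exists>C. \<forall>(l1 :: nat \<Rightarrow> int) (l3 :: nat \<Rightarrow> real).
        (\<lambda>n. real_of_int (l1 n)) \<in> o(\<lambda>n. real n) \<and>
        l3 \<in> o(\<lambda>n. real n) \<and>
        filterlim l3 at_top sequentially \<longrightarrow>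
        (\<forall>\<^sub>F n in sequentially. \<forall>x y.
          0 \<le> x \<and> x \<le> y \<and> reachable n x y \<and>
          real_of_int x = real_of_int (l1 n) \<and>
          real_of_int y = real n - l3 n \<and>
          l3 n - real_of_int (l1 n) = c \<longrightarrow>
          (\<exists>e1 e2. \<bar>e1\<bar> \<le> C * abs (real_of_int (l1 n) / real n) \<and>
            \<bar>e2\<bar> \<le> C * abs (1 / real_of_int (l1 n)) \<and>
            f x y n = (d * exp (- 1 / (6 * c)) / (pi * sqrt (c * (real_of_int (l1 n) + l3 n)))) * (1 + e1 + e2)))))) \<and>
     (\<forall>cx cy :: real. 0 < cx \<and> 0 < cy \<and> cx \<noteq> cy \<longrightarrow> (\<exists>d\<in>stirling_range. (\<exists>C.
        \<forall>n\<ge>1. \<forall>x y.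
          0 \<le> x \<and> x \<le> y \<and> reachable n x y \<and>
          real_of_int x = cx \<and>
          real_of_int y = real n - cy \<longrightarrow>
          (\<exists>e. \<bar>e\<bar> \<le> C * abs (1 / real n) \<and>
            f x y n = (d\<^sup>2 * exp (- cy / (3 * (cy\<^sup>2 - cx\<^sup>2))) / (pi * sqrt (cy\<^sup>2 - cx\<^sup>2))) * (1 + e))))) \<and>
     (\<exists>C. \<forall>l3 :: nat \<Rightarrow> real.
        l3 \<in> o(\<lambda>n. real n) \<and>
        filterlim l3 at_top sequentially \<longrightarrow>
        (\<forall>\<^sub>F n in sequentially. \<forall>x y.
          0 \<le> x \<and> x \<le> y \<and> reachable n x y \<and>
          real_of_int x = real n / 2 - l3 n \<and>
          real_of_int y = real n / 2 + l3 n \<longrightarrow>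
          (\<exists>e. \<bar>e\<bar> \<le> C * abs (((l3 n)\<^sup>2 + real n) / (real n)\<^sup>2) \<and>
            f x y n = sqrt (2 / (pi * real n)) * (1 + e)))) \<and>
     (\<forall>ax ay :: real. 0 < ax \<and> ax < ay \<and> ay < 1 \<and> ax + ay \<le> 1 \<longrightarrow> (\<exists>C. \<forall>lx ly :: nat \<Rightarrow> real.
        lx \<in> o(\<lambda>n. real n) \<and>
        ly \<in> o(\<lambda>n. real n) \<longrightarrow>
        (\<forall>\<^sub>F n in sequentially. \<forall>x y.
          0 \<le> x \<and> x \<le> y \<and> reachable n x y \<and>
          real_of_int x = ax * real n + lx n \<and>
          real_of_int y = ay * real n + ly n \<and>
          real_of_int (x + y) = real n \<longrightarrow>
          (\<exists>e1 e2. \<bar>e1\<bar> \<le> C * abs (lx n / real n) \<and>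
            \<bar>e2\<bar> \<le> C * abs (1 / real n) \<and>
            f x y n = sqrt (2 / (pi * real n * (1 - (ay - ax)\<^sup>2))) * (1 + e1 + e2))))) \<and>
     (\<exists>C. \<forall>l3 :: nat \<Rightarrow> real.
        l3 \<in> o(\<lambda>n. real n) \<and>
        filterlim l3 at_top sequentially \<longrightarrow>
        (\<forall>\<^sub>F n in sequentially. \<forall>x y.
          0 \<le> x \<and> x \<le> y \<and> reachable n x y \<and>
          real_of_int x = l3 n \<and>
          real_of_int y = real n - l3 n \<longrightarrow>
          (\<exists>e1 e2. \<bar>e1\<bar> \<le> C * abs (l3 n / real n) \<and>
            \<bar>e2\<bar> \<le> C * abs (1 / l3 n) \<and>
            f x y n = 1 / sqrt (2 * pi * l3 n) * (1 + e1 + e2)))) \<and>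
     (\<forall>c :: real. 0 < c \<longrightarrow> (\<exists>d\<in>stirling_range. (\<exists>C.
        \<forall>n\<ge>1. \<forall>x y.
          0 \<le> x \<and> x \<le> y \<and> reachable n x y \<and>
          real_of_int x = c \<and>
          real_of_int y = real n - c \<longrightarrow>
          (\<exists>e. \<bar>e\<bar> \<le> C * abs (1 / real n) \<and>
            f x y n = (d * exp (- 1 / (12 * c)) / sqrt (2 * pi * c)) * (1 + e))))) \<and>
     (\<forall>n\<ge>1. f 0 (int n) n = 1)) \<and>
     (\<exists>C. \<forall>n\<ge>2. \<forall>x y.
        even (x + y + int n) \<and>
        (real_of_int x)\<^sup>2 + (real_of_int y)\<^sup>2 \<le> (real n)\<^sup>2 / ln (real n) ^ 4 \<and>
        \<bar>(real_of_int y)\<^sup>2 - (real_of_int x)\<^sup>2\<bar> \<le> real n powr (3/2) / ln (real n) \<longrightarrow>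
          (\<exists>e0 e1 e2. \<bar>e0\<bar> \<le> C * abs ((real n + (real_of_int x)\<^sup>2 + (real_of_int y)\<^sup>2) / (real n)\<^sup>2) \<and>
            \<bar>e1\<bar> \<le> C * abs (((real_of_int y)\<^sup>2 - (real_of_int x)\<^sup>2) / (real n)\<^sup>2) \<and>
            \<bar>e2\<bar> \<le> C * abs (((real_of_int y)\<^sup>2 - (real_of_int x)\<^sup>2)\<^sup>2 / real n ^ 3) \<and>
            \<P>(\<omega> in M. S n \<omega> = (x, y)) = 2 / (pi * real n) * exp (- s0 n x y) * (1 + e0 + e1 + e2))) \<and>
     (\<forall>N\<ge>2. \<exists>C. \<forall>a :: real. a < (2 * real N - 1) / (2 * real N) \<longrightarrow> (\<forall>n\<ge>2. \<forall>x y.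
        even (x + y + int n) \<and>
        sqrt ((real_of_int x)\<^sup>2 + (real_of_int y)\<^sup>2) \<le> real n powr a \<and>
        \<bar>(real_of_int y)\<^sup>2 - (real_of_int x)\<^sup>2\<bar> \<le> real n powr (3/2) / ln (real n) \<longrightarrow>
          (\<exists>e0 e1 e2 e3. \<bar>e0\<bar> \<le> C * abs ((real n + (real_of_int x)\<^sup>2 + (real_of_int y)\<^sup>2) / (real n)\<^sup>2) \<and>
            \<bar>e1\<bar> \<le> C * abs (((real_of_int y)\<^sup>2 - (real_of_int x)\<^sup>2) / (real n)\<^sup>2) \<and>
            \<bar>e2\<bar> \<le> C * abs (((real_of_int y)\<^sup>2 - (real_of_int x)\<^sup>2)\<^sup>2 / real n ^ 3) \<and>
            \<bar>e3\<bar> \<le> C * abs (((real_of_int x)\<^sup>2 + (real_of_int y)\<^sup>2) ^ N / real n ^ (2 * N - 1)) \<and>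
            \<P>(\<omega> in M. S n \<omega> = (x, y)) = 2 / (pi * real n) * exp (- (\<Sum>l=1..N-1. s0_term n x y l)) * (1 + e0 + e1 + e2 + e3))))"
proof (intro conjI exI[of _ walk_prefactor], goal_cases)
  \<comment> \<open>The witness for \<open>f\<close> is the exact quotient of the probability by the
    exponential, defined for all points at once; thus one and the same function satisfies every
    regime and all symmetries.\<close>
  case 1
  show ?case using planar_srw_prob_reachable[OF srw] by blast
next
  case 2
  show ?case by (simp add: walk_prefactor_symmetric)
next
  case 3
  show ?case by (rule walk_prefactor_near_origin)
next
  case 4
  show ?case by (intro allI impI, elim conjE, rule walk_prefactor_near_diagonal)
next
  case 5
  show ?case by (intro allI impI, elim conjE, rule walk_prefactor_near_axis)
next
  case 6
  show ?case by (intro allI impI, elim conjE, rule walk_prefactor_generic_direction)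
next
  case 7
  show ?case by (rule walk_prefactor_edge_midpoint)
next
  case 8
  show ?case by (intro allI impI, elim conjE, rule walk_prefactor_edge_interior)
next
  case 9
  show ?case by (rule walk_prefactor_corner)
next
  case 10
  show ?case by (intro allI impI, rule walk_prefactor_const_edge_midpoint)
next
  case 11
  show ?case by (intro allI impI, rule walk_prefactor_const_edge_interior)
next
  case 12
  show ?case by (intro allI impI, rule walk_prefactor_const_edge_corner)
next
  case 13
  show ?case by (intro allI impI, elim conjE, rule walk_prefactor_const_corner)
next
  case 14
  show ?case by (rule walk_prefactor_boundary_midpoint)
next
  case 15
  show ?case by (intro allI impI, elim conjE, rule walk_prefactor_boundary_interior)
next
  case 16
  show ?case by (rule walk_prefactor_boundary_corner)
next
  case 17
  show ?case by (intro allI impI, rule walk_prefactor_boundary_const_corner)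
next
  case 18
  show ?case by (simp add: walk_prefactor_vertex)
next
  case 19
  show ?case by (rule planar_srw_local_s0[OF srw])
next
  case 20
  show ?case by (intro allI impI, rule planar_srw_local_truncated[OF srw])
qed

end
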